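(* Let $n \geq 2$ be an integer. Every virtual knot diagram can be transformed into a diagram of the trivial knot by a finite sequence of $H(n)$-moves and generalized Reidemeister moves.
   Context: Virtual link diagrams. A virtual link diagram is a generic immersion of finitely many circles in the plane (considered up to planar isotopy), each of whose finitely many transverse double points is marked either as a classical crossing (with over/under information) or as a virtual crossing (no over/under information). A virtual knot diagram is a virtual link diagram with one component. The trivial knot is the class of the crossingless diagram of one circle. Generalized Reidemeister moves. These are the classical Reidemeister moves R1, R2, R3 (involving only classical crossings), the virtual Reidemeister moves VR1, VR2, VR3 (the same moves with all crossings virtual), and the mixed move VR4 (an arc having two consecutive virtual crossings with the two strands of a classical crossing is moved across that classical crossing). All moves may be used in both directions. $H(n)$-move ($n\ge 2$). Let $B$ be a disk in the plane meeting a diagram $D$ in exactly $n$ pairwise disjoint simple arcs with no crossings in $B$, whose $2n$ endpoints $p_1,\dots,p_{2n}$, in cyclic order on $\partial B$, are joined in pairs $p_{2i-1},p_{2i}$ ($1\le i\le n$). The $H(n)$-move replaces these arcs by $n$ pairwise disjoint simple arcs in $B$ joining $p_{2i}$ to $p_{2i+1}$ ($1\le i\le n$, indices mod $2n$), leaving $D$ unchanged outside $B$. An $H(n)$-move is required to preserve the number of components of the diagram. The move is performed on the underlying unoriented diagram; it need not preserve orientations outside $B$. *)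

theory Defs
  imports "HOL-Analysis.Analysis"
begin

section \<open>Virtual link diagrams\<close>

text \<open>
  The plane is \<^typ>\<open>complex\<close>; the \<open>m\<close> parametrising circles are the set \<open>{..<m} \<times> sphere 0 1\<close>.
  Diagrams are unoriented, and everything is done in the topological category: an immersion is a
  locally injective continuous map, and a double point is transverse if some local chart of the plane
  carries the two branches to the two coordinate axes.

  The crossing decoration is put on the parameters: \<open>decor\<close> says how the curve passes through the point
  with that parameter, namely not through a crossing at all (\<open>Plain\<close>), along the over- or under-strand
  of a classical crossing, or through a virtual crossing.
\<close>

datatype passage = Plain | Over | Under | Virtual

record vdiagram =
  ncomp :: nat
  curve :: "nat \<times> complex \<Rightarrow> complex"
  decor :: "nat \<times> complex \<Rightarrow> passage"

definition source :: "vdiagram \<Rightarrow> (nat \<times> complex) set" where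
  "source D = {..<ncomp D} \<times> sphere 0 1"

definition crossings :: "vdiagram \<Rightarrow> complex set" where
  "crossings D = {x. \<exists>s\<in>source D. \<exists>t\<in>source D. s \<noteq> t \<and> curve D s = x \<and> curve D t = x}"

definition virtual_crossings :: "vdiagram \<Rightarrow> complex set" where
  "virtual_crossings D =
    {x \<in> crossings D. \<forall>s\<in>source D. curve D s = x \<longrightarrow> decor D s = Virtual}"

definition classical_crossings :: "vdiagram \<Rightarrow> complex set" where
  "classical_crossings D = crossings D - virtual_crossings D"

definition transverse_at :: "vdiagram \<Rightarrow> nat \<times> complex \<Rightarrow> nat \<times> complex \<Rightarrow> bool" where
  "transverse_at D s t \<longleftrightarrow>
    (\<exists>W \<psi> \<psi>' U V. open W \<and> homeomorphism W (ball 0 1) \<psi> \<psi>' \<and>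
       openin (top_of_set (source D)) U \<and> openin (top_of_set (source D)) V \<and>
       s \<in> U \<and> t \<in> V \<and> U \<inter> V = {} \<and>
       {r \<in> source D. curve D r \<in> W} = U \<union> V \<and>
       \<psi> (curve D s) = 0 \<and> \<psi> (curve D t) = 0 \<and>
       \<psi> ` curve D ` U = {z \<in> ball 0 1. Im z = 0} \<and>
       \<psi> ` curve D ` V = {z \<in> ball 0 1. Re z = 0})"

definition generic_immersion :: "vdiagram \<Rightarrow> bool" where
  "generic_immersion D \<longleftrightarrow>
     continuous_on (source D) (curve D) \<and>
     (\<forall>s\<in>source D. \<exists>U. open U \<and> s \<in> U \<and> inj_on (curve D) (U \<inter> source D)) \<and>
     finite (crossings D) \<and>
     (\<forall>x\<in>crossings D. card {s \<in> source D. curve D s = x} = 2) \<and>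
     (\<forall>s\<in>source D. \<forall>t\<in>source D. s \<noteq> t \<and> curve D s = curve D t \<longrightarrow> transverse_at D s t)"

definition virtual_link_diagram :: "vdiagram \<Rightarrow> bool" where
  "virtual_link_diagram D \<longleftrightarrow>
     generic_immersion D \<and>
     (\<forall>s\<in>source D. curve D s \<notin> crossings D \<longrightarrow> decor D s = Plain) \<and>
     (\<forall>s\<in>source D. \<forall>t\<in>source D. s \<noteq> t \<and> curve D s = curve D t \<longrightarrow>
        (decor D s, decor D t) \<in> {(Over, Under), (Under, Over), (Virtual, Virtual)})"

definition virtual_knot_diagram :: "vdiagram \<Rightarrow> bool" where
  "virtual_knot_diagram D \<longleftrightarrow> virtual_link_diagram D \<and> ncomp D = 1"


section \<open>Planar isotopy\<close>

text \<open>Besides moving the plane this also allows reparametrising the circles (by \<open>h\<close>).\<close>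

definition planar_isotopic :: "vdiagram \<Rightarrow> vdiagram \<Rightarrow> bool" where
  "planar_isotopic D D' \<longleftrightarrow>
    (\<exists>F :: real \<times> complex \<Rightarrow> complex. \<exists>h k.
       continuous_on ({0..1} \<times> UNIV) F \<and>
       (\<forall>x. F (0, x) = x) \<and>
       (\<forall>t\<in>{0..1}. \<exists>G. homeomorphism UNIV UNIV (\<lambda>x. F (t, x)) G) \<and>
       homeomorphism (source D) (source D') h k \<and>
       (\<forall>s\<in>source D. curve D' (h s) = F (1, curve D s) \<and> decor D' (h s) = decor D s))"


section \<open>Local moves\<close>

text \<open>
  All moves take place in a closed disk \<open>B\<close>. The diagrams before and after the move coincide outside
  the interior of \<open>B\<close>, up to reparametrisation.
\<close>

definition disk :: "complex set \<Rightarrow> bool" where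
  "disk B \<longleftrightarrow> B homeomorphic cball (0::complex) 1"

definition agree_outside :: "complex set \<Rightarrow> vdiagram \<Rightarrow> vdiagram \<Rightarrow> bool" where
  "agree_outside B D D' \<longleftrightarrow>
    (\<exists>h k. homeomorphism {s \<in> source D. curve D s \<notin> interior B}
                         {s \<in> source D'. curve D' s \<notin> interior B} h k \<and>
       (\<forall>s\<in>source D. curve D s \<notin> interior B \<longrightarrow>
          curve D' (h s) = curve D s \<and> decor D' (h s) = decor D s))"

text \<open>
  \<open>strands D B k \<alpha>\<close>: the part of \<open>D\<close> in \<open>B\<close> consists of \<open>k\<close> strands running from boundary to boundary,
  the \<open>i\<close>-th one (\<open>i < k\<close>) being \<open>curve D \<circ> \<alpha> i\<close>. The arcs \<open>\<alpha> i\<close> live on the parametrising circles, so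
  they are disjoint and simple even when the strands cross each other or themselves.
\<close>

definition strands :: "vdiagram \<Rightarrow> complex set \<Rightarrow> nat \<Rightarrow> (nat \<Rightarrow> real \<Rightarrow> nat \<times> complex) \<Rightarrow> bool" where
  "strands D B k \<alpha> \<longleftrightarrow>
     (\<forall>i<k. arc (\<alpha> i)) \<and>
     (\<forall>i<k. \<forall>j<k. i \<noteq> j \<longrightarrow> path_image (\<alpha> i) \<inter> path_image (\<alpha> j) = {}) \<and>
     (\<Union>i<k. path_image (\<alpha> i)) = {s \<in> source D. curve D s \<in> B} \<and>
     (\<forall>i<k. \<forall>t\<in>{0..1}. curve D (\<alpha> i t) \<in> frontier B \<longleftrightarrow> t = 0 \<or> t = 1) \<and>
     crossings D \<inter> frontier B = {}"

definition same_ends ::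
  "vdiagram \<Rightarrow> vdiagram \<Rightarrow> nat \<Rightarrow> (nat \<Rightarrow> real \<Rightarrow> nat \<times> complex) \<Rightarrow> (nat \<Rightarrow> real \<Rightarrow> nat \<times> complex) \<Rightarrow> bool"
  where "same_ends D D' k \<alpha> \<alpha>' \<longleftrightarrow>
     (\<forall>i<k. curve D (\<alpha> i 0) = curve D' (\<alpha>' i 0) \<and> curve D (\<alpha> i 1) = curve D' (\<alpha>' i 1))"

definition simple_strand :: "vdiagram \<Rightarrow> (real \<Rightarrow> nat \<times> complex) \<Rightarrow> bool" where
  "simple_strand D a \<longleftrightarrow> inj_on (curve D) (path_image a)"

text \<open>
  \<open>cross D a b m c\<close>: the strands \<open>a\<close> and \<open>b\<close> meet in exactly \<open>m\<close> crossings, and \<open>a\<close> passes through all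
  of them as \<open>c\<close>. For a virtual link diagram this determines how \<open>b\<close> passes through them.
\<close>

definition cross ::
  "vdiagram \<Rightarrow> (real \<Rightarrow> nat \<times> complex) \<Rightarrow> (real \<Rightarrow> nat \<times> complex) \<Rightarrow> nat \<Rightarrow> passage \<Rightarrow> bool" where
  "cross D a b m c \<longleftrightarrow>
     card (curve D ` path_image a \<inter> curve D ` path_image b) = m \<and>
     (\<forall>s\<in>path_image a. curve D s \<in> curve D ` path_image b \<longrightarrow> decor D s = c)"


section \<open>Generalized Reidemeister moves\<close>

text \<open>
  The pictures in \<open>B\<close> are given by which strands cross each other how often. Up to a homeomorphism of
  \<open>B\<close>, possibly reversing orientation, there is only one arc with one transverse double point, only one
  pair of simple arcs crossing twice, and only one triple of simple arcs crossing pairwise once; for the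
  last there are two pictures up to isotopy fixing the boundary of \<open>B\<close>, the two sides of the third move.
\<close>

definition kink_move :: "bool \<Rightarrow> vdiagram \<Rightarrow> vdiagram \<Rightarrow> bool" where
  "kink_move virt D D' \<longleftrightarrow>
    (\<exists>B \<alpha> \<alpha>'. disk B \<and> agree_outside B D D' \<and>
       strands D B 1 \<alpha> \<and> strands D' B 1 \<alpha>' \<and> same_ends D D' 1 \<alpha> \<alpha>' \<and>
       crossings D \<inter> B = {} \<and>
       (\<exists>x. crossings D' \<inter> B = {x} \<and>
            x \<in> (if virt then virtual_crossings D' else classical_crossings D')))"

definition bigon_move :: "passage \<Rightarrow> vdiagram \<Rightarrow> vdiagram \<Rightarrow> bool" where
  "bigon_move c D D' \<longleftrightarrow>
    (\<exists>B \<alpha> \<alpha>'. disk B \<and> agree_outside B D D' \<and>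
       strands D B 2 \<alpha> \<and> strands D' B 2 \<alpha>' \<and> same_ends D D' 2 \<alpha> \<alpha>' \<and>
       crossings D \<inter> B = {} \<and>
       (\<forall>i<2. simple_strand D' (\<alpha>' i)) \<and> cross D' (\<alpha>' 0) (\<alpha>' 1) 2 c)"

definition triangle ::
  "passage \<Rightarrow> passage \<Rightarrow> passage \<Rightarrow> vdiagram \<Rightarrow> (nat \<Rightarrow> real \<Rightarrow> nat \<times> complex) \<Rightarrow> bool" where
  "triangle c01 c02 c12 D \<alpha> \<longleftrightarrow>
     (\<forall>i<3. simple_strand D (\<alpha> i)) \<and>
     cross D (\<alpha> 0) (\<alpha> 1) 1 c01 \<and> cross D (\<alpha> 0) (\<alpha> 2) 1 c02 \<and> cross D (\<alpha> 1) (\<alpha> 2) 1 c12"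

definition triangle_move :: "passage \<Rightarrow> passage \<Rightarrow> passage \<Rightarrow> vdiagram \<Rightarrow> vdiagram \<Rightarrow> bool" where
  "triangle_move c01 c02 c12 D D' \<longleftrightarrow>
    (\<exists>B \<alpha> \<alpha>'. disk B \<and> agree_outside B D D' \<and>
       strands D B 3 \<alpha> \<and> strands D' B 3 \<alpha>' \<and> same_ends D D' 3 \<alpha> \<alpha>' \<and>
       triangle c01 c02 c12 D \<alpha> \<and> triangle c01 c02 c12 D' \<alpha>')"

definition R1 :: "vdiagram \<Rightarrow> vdiagram \<Rightarrow> bool" where "R1 = kink_move False"
definition R2 :: "vdiagram \<Rightarrow> vdiagram \<Rightarrow> bool" where "R2 = bigon_move Over"
definition R3 :: "vdiagram \<Rightarrow> vdiagram \<Rightarrow> bool" where "R3 = triangle_move Over Over Over"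
definition VR1 :: "vdiagram \<Rightarrow> vdiagram \<Rightarrow> bool" where "VR1 = kink_move True"
definition VR2 :: "vdiagram \<Rightarrow> vdiagram \<Rightarrow> bool" where "VR2 = bigon_move Virtual"
definition VR3 :: "vdiagram \<Rightarrow> vdiagram \<Rightarrow> bool" where
  "VR3 = triangle_move Virtual Virtual Virtual"
definition VR4 :: "vdiagram \<Rightarrow> vdiagram \<Rightarrow> bool" where
  "VR4 = triangle_move Virtual Virtual Over"

definition generalized_reidemeister_move :: "vdiagram \<Rightarrow> vdiagram \<Rightarrow> bool" where
  "generalized_reidemeister_move D D' \<longleftrightarrow>
     virtual_link_diagram D \<and> virtual_link_diagram D' \<and>
     (\<exists>M \<in> {R1, R2, R3, VR1, VR2, VR3, VR4}. M D D' \<or> M D' D)"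


section \<open>The H(n)-move\<close>

text \<open>
  The endpoints are numbered \<open>p 0, \<dots>, p (2 * n - 1)\<close>; their cyclic order on the boundary of \<open>B\<close> is
  expressed by increasing angles in a parametrisation of \<open>B\<close> by the unit disk. Since there are no
  crossings in \<open>B\<close>, the strands are simple and pairwise disjoint.
\<close>

definition H_move :: "nat \<Rightarrow> vdiagram \<Rightarrow> vdiagram \<Rightarrow> bool" where
  "H_move n D D' \<longleftrightarrow>
     virtual_link_diagram D \<and> virtual_link_diagram D' \<and> ncomp D' = ncomp D \<and>
     (\<exists>B \<phi> \<phi>' \<theta> p \<alpha> \<alpha>'.
        homeomorphism (cball 0 1) B \<phi> \<phi>' \<and> agree_outside B D D' \<and>
        strict_mono_on {..<2 * n} \<theta> \<and> (\<forall>j<2 * n. 0 \<le> \<theta> j \<and> \<theta> j < 2 * pi) \<and>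
        (\<forall>j<2 * n. p j = \<phi> (cis (\<theta> j))) \<and>
        strands D B n \<alpha> \<and> crossings D \<inter> B = {} \<and>
        (\<forall>i<n. curve D (\<alpha> i 0) = p (2 * i) \<and> curve D (\<alpha> i 1) = p (2 * i + 1)) \<and>
        strands D' B n \<alpha>' \<and> crossings D' \<inter> B = {} \<and>
        (\<forall>i<n. curve D' (\<alpha>' i 0) = p (2 * i + 1) \<and>
                curve D' (\<alpha>' i 1) = p ((2 * i + 2) mod (2 * n))))"


section \<open>The trivial knot\<close>

definition virtually_equivalent :: "vdiagram \<Rightarrow> vdiagram \<Rightarrow> bool" where
  "virtually_equivalent =
     (\<lambda>D D'. virtual_link_diagram D \<and> virtual_link_diagram D' \<and> planar_isotopic D D' \<or>
             generalized_reidemeister_move D D')\<^sup>*\<^sup>*"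

definition trivial_knot_diagram :: "vdiagram \<Rightarrow> bool" where
  "trivial_knot_diagram D \<longleftrightarrow>
     (\<exists>U. virtual_knot_diagram U \<and> crossings U = {} \<and> virtually_equivalent D U)"

text \<open>A finite sequence of moves; planar isotopies are allowed in between, as diagrams are considered
  up to planar isotopy.\<close>

definition H_transformable :: "nat \<Rightarrow> vdiagram \<Rightarrow> vdiagram \<Rightarrow> bool" where
  "H_transformable n =
     (\<lambda>D D'. virtual_link_diagram D \<and> virtual_link_diagram D' \<and> planar_isotopic D D' \<or>
             generalized_reidemeister_move D D' \<or> H_move n D D')\<^sup>*\<^sup>*"

end

theory Submission
  imports Defs
begin

text \<open>
  A crossing of a knot diagram can be smoothed in two ways, and one of them keeps the diagram a knot:
  the one that runs through one of the two loops at the crossing backwards. An H(2)-move performs it. Put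
  the disk of the move into a quadrant at the crossing, so that it cuts the two arms that bound this
  quadrant. Inside, the move joins the two ends that lead to the crossing, so the crossing becomes the
  crossing of a kink, which a first Reidemeister move, classical or virtual, removes. One crossing has
  disappeared and the others have not changed, so induction on the number of crossings ends with a circle
  without crossings (\<open>remove_crossing\<close>). For one of the two pairs of opposite quadrants this
  preserves the number of components; \<open>frame_ordered\<close> chooses the coordinates such that the first
  quadrant is of this kind.

  For larger \<open>n\<close>, an H(n)-move is simulated by an H(n+1)-move (\<open>simulate\<close>). Near the last
  endpoint the diagram crosses the boundary of the disk. Give it there a virtual kink that returns to the
  disk and leaves it again, so that the disk contains one more strand. The H(n+1)-move then replaces this
  kink by its mirror image and otherwise acts as the H(n)-move did. Virtual first moves insert the kink
  before and remove the mirror image afterwards. To repeat this, a move is carried along together with a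
  chart at its last endpoint (locale \<open>extendable_H_move\<close>); the kinked diagrams again have such a chart.

  Diagrams are merely topological immersions, so every change of a diagram happens in a chart where the
  curve is a polygon given by a formula. The facts that make this work are that being a diagram only has to be
  checked where the curve changes (\<open>virtual_link_diagram_local_change\<close>), and that one strand in a disk can
  be exchanged for another with the same endpoints (locale \<open>strand_replacement\<close>).
\<close>

section \<open>Diagrams that agree outside a set\<close>

lemma homeomorphism_mem1: "homeomorphism S T f g \<Longrightarrow> x \<in> S \<Longrightarrow> f x \<in> T"
  by (auto simp: homeomorphism_def)

lemma homeomorphism_mem2: "homeomorphism S T f g \<Longrightarrow> y \<in> T \<Longrightarrow> g y \<in> S"
  by (auto simp: homeomorphism_def)

lemma agree_outside_sym:
  assumes "agree_outside B D D'"
  shows "agree_outside B D' D"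
proof -
  obtain h k where hk: "homeomorphism {s \<in> source D. curve D s \<notin> interior B}
      {s \<in> source D'. curve D' s \<notin> interior B} h k"
    and c: "\<forall>s\<in>source D. curve D s \<notin> interior B \<longrightarrow>
      curve D' (h s) = curve D s \<and> decor D' (h s) = decor D s"
    using assms unfolding agree_outside_def by blast
  have "homeomorphism {s \<in> source D'. curve D' s \<notin> interior B}
      {s \<in> source D. curve D s \<notin> interior B} k h"
    using hk by (rule homeomorphism_symD)
  moreover have "curve D (k s) = curve D' s \<and> decor D (k s) = decor D' s"
    if "s \<in> source D'" "curve D' s \<notin> interior B" for s
  proof -
    have "h (k s) = s" "k s \<in> source D" "curve D (k s) \<notin> interior B"
      using homeomorphism_mem2[OF hk, of s] homeomorphism_apply2[OF hk, of s] that by auto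
    then show ?thesis using c[rule_format, of "k s"] by simp
  qed
  ultimately show ?thesis unfolding agree_outside_def by blast
qed

lemma crossings_agree_outside_subset:
  assumes "agree_outside B D D'"
  shows "crossings D - interior B \<subseteq> crossings D'"
proof
  fix x assume x: "x \<in> crossings D - interior B"
  obtain h k where hk: "homeomorphism {s \<in> source D. curve D s \<notin> interior B}
      {s \<in> source D'. curve D' s \<notin> interior B} h k"
    and c: "\<forall>s\<in>source D. curve D s \<notin> interior B \<longrightarrow>
      curve D' (h s) = curve D s \<and> decor D' (h s) = decor D s"
    using assms unfolding agree_outside_def by blast
  from x obtain s t where st: "s \<in> source D" "t \<in> source D" "s \<noteq> t"
    "curve D s = x" "curve D t = x" by (auto simp: crossings_def)
  then have "h s \<in> source D'" "h t \<in> source D'" "k (h s) = s" "k (h t) = t"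
    using homeomorphism_mem1[OF hk] homeomorphism_apply1[OF hk] x by auto
  moreover have "h s \<noteq> h t" using st calculation by metis
  moreover have "curve D' (h s) = x" "curve D' (h t) = x" using c st x by auto
  ultimately show "x \<in> crossings D'" unfolding crossings_def by blast
qed

lemma crossings_agree_outside:
  assumes "agree_outside B D D'" "x \<notin> interior B"
  shows "x \<in> crossings D' \<longleftrightarrow> x \<in> crossings D"
  using crossings_agree_outside_subset[OF assms(1)]
    crossings_agree_outside_subset[OF agree_outside_sym[OF assms(1)]] assms(2) by blast

lemma crossingsI:
  assumes "s \<in> source D" "t \<in> source D" "s \<noteq> t" "curve D s = curve D t"
  shows "curve D s \<in> crossings D"
  unfolding crossings_def using assms by (intro CollectI bexI[of _ s] bexI[of _ t]) simp_all

lemma compact_source: "compact (source D)"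
  unfolding source_def by (intro compact_Times) (auto intro: finite_imp_compact)

lemma transverse_atE:
  assumes "transverse_at D s t"
  obtains W \<psi> \<psi>' U V where "open W" "homeomorphism W (ball 0 1) \<psi> \<psi>'"
    "openin (top_of_set (source D)) U" "openin (top_of_set (source D)) V"
    "s \<in> U" "t \<in> V" "U \<inter> V = {}"
    "{r \<in> source D. curve D r \<in> W} = U \<union> V"
    "\<psi> (curve D s) = 0" "\<psi> (curve D t) = 0"
    "\<psi> ` curve D ` U = {z \<in> ball 0 1. Im z = 0}"
    "\<psi> ` curve D ` V = {z \<in> ball 0 1. Re z = 0}"
  using assms unfolding transverse_at_def by (elim exE conjE) (rule that)

lemma transverse_at_curve_eq:
  assumes "transverse_at D s t" shows "curve D s = curve D t"
  using assms
proof (rule transverse_atE)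
  fix W U V and \<psi> \<psi>' :: "complex \<Rightarrow> complex"
  assume W: "homeomorphism W (ball 0 1) \<psi> \<psi>'" "s \<in> U" "t \<in> V"
    "{r \<in> source D. curve D r \<in> W} = U \<union> V" "\<psi> (curve D s) = 0" "\<psi> (curve D t) = 0"
  then have "curve D s \<in> W" "curve D t \<in> W" by blast+
  then show ?thesis using W homeomorphism_apply1[OF W(1)] by metis
qed

text \<open>Multiplication of the chart by \<open>\<i>\<close> exchanges the two coordinate axes.\<close>

lemma transverse_at_sym:
  assumes "transverse_at D s t" shows "transverse_at D t s"
proof -
  obtain W \<psi> \<psi>' U V where W: "open W" "homeomorphism W (ball 0 1) \<psi> \<psi>'"
      "openin (top_of_set (source D)) U" "openin (top_of_set (source D)) V"
      "s \<in> U" "t \<in> V" "U \<inter> V = {}"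
      "{r \<in> source D. curve D r \<in> W} = U \<union> V"
      "\<psi> (curve D s) = 0" "\<psi> (curve D t) = 0"
      and U: "\<psi> ` curve D ` U = {z \<in> ball 0 1. Im z = 0}"
      and V: "\<psi> ` curve D ` V = {z \<in> ball 0 1. Re z = 0}"
    using assms by (rule transverse_atE)
  have rot: "homeomorphism (ball 0 1) (ball 0 1) (\<lambda>z. \<i> * z) (\<lambda>z. - \<i> * z)"
    by (rule homeomorphismI)
      (simp_all add: image_subset_iff norm_mult continuous_on_mult_left continuous_on_minus flip: mult.assoc)
  have h: "homeomorphism W (ball 0 1) ((\<lambda>z. \<i> * z) \<circ> \<psi>) (\<psi>' \<circ> (\<lambda>z. - \<i> * z))"
    by (rule homeomorphism_compose[OF W(2) rot])
  have 1: "((\<lambda>z. \<i> * z) \<circ> \<psi>) ` curve D ` V = {z \<in> ball 0 1. Im z = 0}"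
  proof -
    have "((\<lambda>z. \<i> * z) \<circ> \<psi>) ` curve D ` V = (\<lambda>z. \<i> * z) ` {z \<in> ball 0 1. Re z = 0}"
      unfolding V[symmetric] by (simp add: image_comp)
    also have "\<dots> = {z \<in> ball 0 1. Im z = 0}"
    proof (intro set_eqI iffI)
      fix w assume "w \<in> {z \<in> ball 0 1. Im z = 0}"
      then have "w = \<i> * (- \<i> * w)" "- \<i> * w \<in> {z \<in> ball 0 1. Re z = 0}"
        by (simp_all add: norm_mult flip: mult.assoc)
      then show "w \<in> (\<lambda>z. \<i> * z) ` {z \<in> ball 0 1. Re z = 0}" by blast
    qed (force simp: norm_mult)
    finally show ?thesis .
  qed
  have 2: "((\<lambda>z. \<i> * z) \<circ> \<psi>) ` curve D ` U = {z \<in> ball 0 1. Re z = 0}"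
  proof -
    have "((\<lambda>z. \<i> * z) \<circ> \<psi>) ` curve D ` U = (\<lambda>z. \<i> * z) ` {z \<in> ball 0 1. Im z = 0}"
      unfolding U[symmetric] by (simp add: image_comp)
    also have "\<dots> = {z \<in> ball 0 1. Re z = 0}"
    proof (intro set_eqI iffI)
      fix w assume "w \<in> {z \<in> ball 0 1. Re z = 0}"
      then have "w = \<i> * (- \<i> * w)" "- \<i> * w \<in> {z \<in> ball 0 1. Im z = 0}"
        by (simp_all add: norm_mult flip: mult.assoc)
      then show "w \<in> (\<lambda>z. \<i> * z) ` {z \<in> ball 0 1. Im z = 0}" by blast
    qed (force simp: norm_mult)
    finally show ?thesis .
  qed
  show ?thesis unfolding transverse_at_def
    apply (rule exI[of _ W], rule exI[of _ "(\<lambda>z. \<i> * z) \<circ> \<psi>"], rule exI[of _ "\<psi>' \<circ> (\<lambda>z. - \<i> * z)"],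
        rule exI[of _ V], rule exI[of _ U])
    using W h 1 2 by (auto simp: Un_commute Int_commute)
qed

text \<open>
  Transversality is local: a chart at the double point can be shrunk until it lies in the open set where the
  two diagrams correspond, and then be rescaled to the unit disk.
\<close>

lemma transverse_at_transfer:
  assumes tr: "transverse_at D s t"
    and N: "open N" "curve D s \<in> N"
    and hk: "homeomorphism {r \<in> source D. curve D r \<in> N} {r \<in> source D'. curve D' r \<in> N} h k"
    and c: "\<And>r. r \<in> source D \<Longrightarrow> curve D r \<in> N \<Longrightarrow> curve D' (h r) = curve D r"
    and cD: "continuous_on (source D) (curve D)"
    and cD': "continuous_on (source D') (curve D')"
  shows "transverse_at D' (h s) (h t)"
proof -
  obtain W \<psi> \<psi>' U V where W: "open W" "homeomorphism W (ball 0 1) \<psi> \<psi>'"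
      and op: "openin (top_of_set (source D)) U" "openin (top_of_set (source D)) V"
      and mem: "s \<in> U" "t \<in> V" "U \<inter> V = {}"
      and UV: "{r \<in> source D. curve D r \<in> W} = U \<union> V"
      and z: "\<psi> (curve D s) = 0" "\<psi> (curve D t) = 0"
      and U: "\<psi> ` curve D ` U = {z \<in> ball 0 1. Im z = 0}"
      and V: "\<psi> ` curve D ` V = {z \<in> ball 0 1. Re z = 0}"
    using tr by (rule transverse_atE)
  have st: "s \<in> source D" "t \<in> source D" "curve D s \<in> W" "curve D t \<in> W"
    using UV mem by blast+
  have eq: "curve D s = curve D t" by (rule transverse_at_curve_eq[OF tr])
  have inj: "\<psi>' (\<psi> w) = w" if "w \<in> W" for w using W that by (auto simp: homeomorphism_def)
  have inj': "\<psi> (\<psi>' w) = w" "\<psi>' w \<in> W" if "norm w < 1" for w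
    using W that by (auto simp: homeomorphism_def)
  have cpsi: "continuous_on W \<psi>" "continuous_on (ball 0 1) \<psi>'" using W by (auto simp: homeomorphism_def)
  have "open (ball 0 1 \<inter> \<psi>' -` (W \<inter> N))"
    using cpsi(2) W(1) N(1) by (intro continuous_open_preimage) auto
  moreover have "0 \<in> ball 0 1 \<inter> \<psi>' -` (W \<inter> N)"
    using inj[OF st(3)] z st N by auto
  ultimately obtain r where r: "r > 0" "ball 0 r \<subseteq> ball 0 1 \<inter> \<psi>' -` (W \<inter> N)"
    using open_contains_ball by blast
  have r1: "norm w < 1" "\<psi>' w \<in> N" if "norm w < r" for w using r that by auto
  define W1 where "W1 = W \<inter> \<psi> -` ball 0 r"
  have oW1: "open W1" unfolding W1_def using W(1) cpsi(1) by (intro continuous_open_preimage) auto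
  have W1N: "W1 \<subseteq> N" "W1 \<subseteq> W" using r1 inj by (force simp: W1_def)+
  define P where "P = {r \<in> source D. curve D r \<in> N}"
  define P' where "P' = {r \<in> source D'. curve D' r \<in> N}"
  have oP': "openin (top_of_set (source D')) P'"
    using continuous_openin_preimage_gen[OF cD' N(1)] by (simp add: P'_def vimage_def Int_def)
  have hP: "homeomorphism P P' h k" using hk by (simp add: P_def P'_def)
  have hP': "h a \<in> P'" "k (h a) = a" if "a \<in> P" for a using hP that by (auto simp: homeomorphism_def)
  have kP': "k a \<in> P" "h (k a) = a" if "a \<in> P'" for a using hP that by (auto simp: homeomorphism_def)
  have curves: "curve D' (h a) = curve D a" if "a \<in> P" for a using c that by (simp add: P_def)
  have opW1: "openin (top_of_set (source D)) {r \<in> source D. curve D r \<in> W1}"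
    using continuous_openin_preimage_gen[OF cD oW1] by (simp add: vimage_def Int_def)
  have gen: "openin (top_of_set (source D')) (h ` {r \<in> X. curve D r \<in> W1})"
    if "openin (top_of_set (source D)) X" for X
  proof -
    have "openin (top_of_set (source D)) {r \<in> X. curve D r \<in> W1}"
    proof -
      have "{r \<in> X. curve D r \<in> W1} = X \<inter> {r \<in> source D. curve D r \<in> W1}"
        using openin_imp_subset[OF that] by blast
      then show ?thesis using openin_Int[OF that opW1] by simp
    qed
    moreover have "{r \<in> X. curve D r \<in> W1} \<subseteq> P"
      using openin_imp_subset[OF that] W1N by (auto simp: P_def)
    ultimately have "openin (top_of_set P) {r \<in> X. curve D r \<in> W1}"
      by (rule openin_subset_trans) (auto simp: P_def)
    then have "openin (top_of_set P') (h ` {r \<in> X. curve D r \<in> W1})"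
      by (rule homeomorphism_imp_open_map[OF hP])
    then show ?thesis using oP' openin_trans by blast
  qed
  have img: "(\<lambda>w. \<psi> w / of_real r) ` curve D' ` h ` {a \<in> X. curve D a \<in> W1} = {z \<in> ball 0 1. Q z}"
    if X: "X \<subseteq> {r \<in> source D. curve D r \<in> W}" "\<psi> ` curve D ` X = {z \<in> ball 0 1. Q z}" 
      and Q: "\<And>z. Q (of_real r * z) = Q z" for X Q
  proof -
    have "curve D' ` h ` {a \<in> X. curve D a \<in> W1} = curve D ` {a \<in> X. curve D a \<in> W1}"
      using curves X(1) W1N by (force simp: image_image P_def intro!: image_cong)
    moreover have "(\<lambda>w. \<psi> w / of_real r) ` curve D ` {a \<in> X. curve D a \<in> W1} = {z \<in> ball 0 1. Q z}"
    proof (intro set_eqI iffI)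
      fix y assume "y \<in> (\<lambda>w. \<psi> w / of_real r) ` curve D ` {a \<in> X. curve D a \<in> W1}"
      then obtain a where a: "a \<in> X" "curve D a \<in> W1" "y = \<psi> (curve D a) / of_real r" by blast
      then have "Q (\<psi> (curve D a))" using X(2) by blast
      moreover have "\<psi> (curve D a) = of_real r * y" using a r by simp
      moreover have "norm y < 1" using a r by (simp add: W1_def norm_divide)
      ultimately show "y \<in> {z \<in> ball 0 1. Q z}" using Q by auto
    next
      fix y assume y: "y \<in> {z \<in> ball 0 1. Q z}"
      then have "norm (of_real r * y) < r" using r by (simp add: norm_mult)
      then have "of_real r * y \<in> {z \<in> ball 0 1. Q z}" using r1 Q y by auto
      then obtain a where a: "a \<in> X" "\<psi> (curve D a) = of_real r * y" using X(2) by (metis (no_types, lifting) imageE)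
      have "of_real r * y \<in> ball 0 r" using \<open>norm (of_real r * y) < r\<close> by simp
      moreover have "curve D a \<in> W" using a X by blast
      ultimately have "curve D a \<in> W1" using a by (simp add: W1_def)
      moreover have "y = \<psi> (curve D a) / of_real r" using a r by simp
      ultimately show "y \<in> (\<lambda>w. \<psi> w / of_real r) ` curve D ` {a \<in> X. curve D a \<in> W1}"
        using a by blast
    qed
    ultimately show ?thesis by simp
  qed
  have WU: "U \<subseteq> {r \<in> source D. curve D r \<in> W}" "V \<subseteq> {r \<in> source D. curve D r \<in> W}" using UV by blast+
  have s1: "s \<in> P" "t \<in> P" "curve D s \<in> W1" "curve D t \<in> W1"
    using st z r N eq by (auto simp: P_def W1_def)
  have hW1: "homeomorphism W1 (ball 0 1) (\<lambda>w. \<psi> w / of_real r) (\<lambda>w. \<psi>' (of_real r * w))"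
  proof (rule homeomorphismI)
    show "continuous_on W1 (\<lambda>w. \<psi> w / of_real r)"
      using r cpsi W1N by (intro continuous_intros continuous_on_subset[OF cpsi(1)]) auto
    have "(*) (complex_of_real r) ` ball 0 1 \<subseteq> ball 0 r" using r by (auto simp: norm_mult)
    then have "(*) (complex_of_real r) ` ball 0 1 \<subseteq> ball 0 1" using r by blast
    then show "continuous_on (ball 0 1) (\<lambda>w. \<psi>' (of_real r * w))"
      by (intro continuous_on_compose2[OF cpsi(2)] continuous_intros) auto
    have small: "norm (of_real r * w) < r" "norm (of_real r * w) < 1" if "w \<in> ball 0 1" for w :: complex
    proof -
      show "norm (of_real r * w) < r" using that r by (simp add: norm_mult)
      then show "norm (of_real r * w) < 1" by (rule r1)
    qed
    show "(\<lambda>w. \<psi> w / of_real r) ` W1 \<subseteq> ball 0 1"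
      using r by (auto simp: W1_def norm_divide)
    show "(\<lambda>w. \<psi>' (of_real r * w)) ` ball 0 1 \<subseteq> W1"
      using small inj' by (auto simp: W1_def)
    show "\<psi>' (of_real r * (\<psi> x / of_real r)) = x" if "x \<in> W1" for x
      using that r W1N inj by auto
    show "\<psi> (\<psi>' (of_real r * y)) / of_real r = y" if "y \<in> ball 0 1" for y
      using small[OF that] inj' r by auto
  qed
  let ?U = "h ` {a \<in> U. curve D a \<in> W1}" and ?V = "h ` {a \<in> V. curve D a \<in> W1}"
  have disj: "?U \<inter> ?V = {}"
  proof -
    have "{a \<in> U. curve D a \<in> W1} \<subseteq> P" "{a \<in> V. curve D a \<in> W1} \<subseteq> P"
      using WU W1N by (auto simp: P_def)
    then show ?thesis using hP'(2) mem(3)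
      by (smt (verit) disjoint_iff imageE mem_Collect_eq subsetD)
  qed
  have un: "{r \<in> source D'. curve D' r \<in> W1} = ?U \<union> ?V"
  proof (intro set_eqI iffI)
    fix b assume b: "b \<in> {r \<in> source D'. curve D' r \<in> W1}"
    then have bP: "b \<in> P'" using W1N by (auto simp: P'_def)
    then have k: "k b \<in> P" "h (k b) = b" using kP' by auto
    then have "curve D (k b) \<in> W1" using curves[OF k(1)] b by auto
    moreover have "k b \<in> U \<union> V" using UV k W1N calculation by (auto simp: P_def)
    ultimately show "b \<in> ?U \<union> ?V" using k by (metis (mono_tags, lifting) UnCI UnE image_eqI mem_Collect_eq)
  next
    fix b assume "b \<in> ?U \<union> ?V"
    then obtain a where a: "a \<in> U \<union> V" "curve D a \<in> W1" "b = h a" by blast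
    then have "a \<in> P" using WU W1N by (auto simp: P_def)
    then show "b \<in> {r \<in> source D'. curve D' r \<in> W1}"
      using hP' curves a by (auto simp: P'_def)
  qed
  show ?thesis unfolding transverse_at_def
  proof (intro exI conjI)
    show "open W1" by (rule oW1)
    show "homeomorphism W1 (ball 0 1) (\<lambda>w. \<psi> w / of_real r) (\<lambda>w. \<psi>' (of_real r * w))" by (rule hW1)
    show "openin (top_of_set (source D')) ?U" "openin (top_of_set (source D')) ?V"
      using gen op by blast+
    show "h s \<in> ?U" "h t \<in> ?V" using s1 mem by blast+
    show "?U \<inter> ?V = {}" by (rule disj)
    show "{r \<in> source D'. curve D' r \<in> W1} = ?U \<union> ?V" by (rule un)
    show "\<psi> (curve D' (h s)) / of_real r = 0" "\<psi> (curve D' (h t)) / of_real r = 0"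
      using curves s1 z by auto
    show "(\<lambda>w. \<psi> w / of_real r) ` curve D' ` ?U = {z \<in> ball 0 1. Im z = 0}"
      by (rule img[OF WU(1) U]) (use r in auto)
    show "(\<lambda>w. \<psi> w / of_real r) ` curve D' ` ?V = {z \<in> ball 0 1. Re z = 0}"
      by (rule img[OF WU(2) V]) (use r in auto)
  qed
qed

text \<open>
  What a diagram has to satisfy at a crossing, stated for a single point so that it can be transferred between
  diagrams that agree near this point.
\<close>

definition crossing_ok :: "vdiagram \<Rightarrow> complex \<Rightarrow> bool" where
  "crossing_ok D y \<longleftrightarrow>
     card {s \<in> source D. curve D s = y} = 2 \<and>
     (\<forall>s\<in>source D. \<forall>t\<in>source D. s \<noteq> t \<and> curve D s = y \<and> curve D t = y \<longrightarrow>
        transverse_at D s t \<and>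
        (decor D s, decor D t) \<in> {(Over, Under), (Under, Over), (Virtual, Virtual)}) \<and>
     (\<forall>s\<in>source D. curve D s = y \<longrightarrow> (\<exists>U. open U \<and> s \<in> U \<and> inj_on (curve D) (U \<inter> source D)))"

lemma open_vimage_curve:
  assumes "continuous_on (source D) (curve D)" "open N"
  shows "openin (top_of_set (source D)) {r \<in> source D. curve D r \<in> N}"
  using continuous_openin_preimage_gen[OF assms] by (simp add: vimage_def Int_def)

lemma crossing_ok_diagram:
  assumes "virtual_link_diagram D" "y \<in> crossings D"
  shows "crossing_ok D y"
  using assms unfolding virtual_link_diagram_def generic_immersion_def crossing_ok_def by auto

text \<open>
  Local injectivity is automatic at a parameter that does not pass through a crossing: the crossings are
  finite in number, hence closed, and the curve is injective on the preimage of the complement.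
\<close>

lemma virtual_link_diagramI:
  assumes cont: "continuous_on (source D) (curve D)"
    and fin: "finite (crossings D)"
    and ok: "\<And>y. y \<in> crossings D \<Longrightarrow> crossing_ok D y"
    and plain: "\<And>s. s \<in> source D \<Longrightarrow> curve D s \<notin> crossings D \<Longrightarrow> decor D s = Plain"
  shows "virtual_link_diagram D"
proof -
  have cr: "curve D s \<in> crossings D" if "s \<in> source D" "t \<in> source D" "s \<noteq> t" "curve D s = curve D t" for s t
    using that by (rule crossingsI)
  have "\<exists>U. open U \<and> s \<in> U \<and> inj_on (curve D) (U \<inter> source D)" if s: "s \<in> source D" for s
  proof (cases "curve D s \<in> crossings D")
    case True
    then show ?thesis using ok[OF True] s unfolding crossing_ok_def by blast
  next
    case False
    have "open (- crossings D)" using fin by (simp add: finite_imp_closed open_Compl)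
    from open_vimage_curve[OF cont this] obtain U where
      U: "open U" "{r \<in> source D. curve D r \<in> - crossings D} = source D \<inter> U"
      unfolding openin_open by blast
    have "s \<in> U" using False s U(2) by blast
    moreover have "inj_on (curve D) (U \<inter> source D)"
    proof (rule inj_onI)
      fix a b assume ab: "a \<in> U \<inter> source D" "b \<in> U \<inter> source D" "curve D a = curve D b"
      have "curve D a \<notin> crossings D" using ab U(2) by blast
      then show "a = b" using cr[of a b] ab by blast
    qed
    ultimately show ?thesis using U(1) by blast
  qed
  moreover have "card {s \<in> source D. curve D s = x} = 2" if "x \<in> crossings D" for x
    using ok[OF that] by (simp add: crossing_ok_def)
  moreover have *: "transverse_at D s t \<and>
      (decor D s, decor D t) \<in> {(Over, Under), (Under, Over), (Virtual, Virtual)}"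
    if "s \<in> source D" "t \<in> source D" "s \<noteq> t \<and> curve D s = curve D t" for s t
    using ok[OF cr[of s t]] that by (auto simp: crossing_ok_def)
  ultimately have "generic_immersion D"
    using cont fin unfolding generic_immersion_def by auto
  then show ?thesis
    using * plain unfolding virtual_link_diagram_def by auto
qed

text \<open>
  Outside the closed set \<open>B\<close> the homeomorphism between the parameter sets matches the preimages of
  \<open>y\<close>, their neighbourhoods and their decorations.
\<close>

lemma crossing_ok_transfer:
  assumes ok: "crossing_ok D y"
    and ag: "agree_outside B D D'" and B: "closed B" "y \<notin> B"
    and cD: "continuous_on (source D) (curve D)"
    and cD': "continuous_on (source D') (curve D')"
  shows "crossing_ok D' y"
proof -
  obtain h k where hk0: "homeomorphism {s \<in> source D. curve D s \<notin> interior B}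
      {s \<in> source D'. curve D' s \<notin> interior B} h k"
    and c: "\<forall>s\<in>source D. curve D s \<notin> interior B \<longrightarrow>
      curve D' (h s) = curve D s \<and> decor D' (h s) = decor D s"
    using ag unfolding agree_outside_def by blast
  define N where "N = - B"
  have N: "open N" "y \<in> N" using B by (auto simp: N_def)
  have NB: "w \<notin> interior B" if "w \<in> N" for w using that interior_subset by (auto simp: N_def)
  have bk: "curve D (k s) = curve D' s" if "s \<in> source D'" "curve D' s \<notin> interior B" for s
    using homeomorphism_mem2[OF hk0, of s] homeomorphism_apply2[OF hk0, of s] that c[rule_format, of "k s"] by auto
  define P where "P = {r \<in> source D. curve D r \<in> N}"
  define P' where "P' = {r \<in> source D'. curve D' r \<in> N}"
  have hk: "homeomorphism P P' h k"
  proof (rule homeomorphismI)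
    show "continuous_on P h"
      by (rule continuous_on_subset[OF homeomorphism_cont1[OF hk0]]) (use NB in \<open>auto simp: P_def\<close>)
    show "continuous_on P' k"
      by (rule continuous_on_subset[OF homeomorphism_cont2[OF hk0]]) (use NB in \<open>auto simp: P'_def\<close>)
    show "h ` P \<subseteq> P'" using c NB homeomorphism_mem1[OF hk0] by (auto simp: P_def P'_def)
    show "k ` P' \<subseteq> P" using bk NB homeomorphism_mem2[OF hk0] by (auto simp: P_def P'_def)
    show "k (h x) = x" if "x \<in> P" for x
      by (rule homeomorphism_apply1[OF hk0]) (use that NB in \<open>auto simp: P_def\<close>)
    show "h (k x) = x" if "x \<in> P'" for x
      by (rule homeomorphism_apply2[OF hk0]) (use that NB in \<open>auto simp: P'_def\<close>)
  qed
  have ch: "curve D' (h r) = curve D r" "decor D' (h r) = decor D r" if "r \<in> P" for r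
    using c that NB by (auto simp: P_def)
  have hk1: "h r \<in> P'" "k (h r) = r" if "r \<in> P" for r
    using homeomorphism_mem1[OF hk that] homeomorphism_apply1[OF hk that] by auto
  have hk2: "k r \<in> P" "h (k r) = r" if "r \<in> P'" for r
    using homeomorphism_mem2[OF hk that] homeomorphism_apply2[OF hk that] by auto
  have Py: "s \<in> P" if "s \<in> source D" "curve D s = y" for s using that N by (auto simp: P_def)
  have Py': "s \<in> P'" if "s \<in> source D'" "curve D' s = y" for s using that N by (auto simp: P'_def)
  have from_k: "k s \<in> source D" "curve D (k s) = y" "h (k s) = s" "decor D (k s) = decor D' s"
    if "s \<in> source D'" "curve D' s = y" for s
    using hk2[OF Py'[OF that]] ch[of "k s"] that by (auto simp: P_def)
  have img: "{s \<in> source D'. curve D' s = y} = h ` {s \<in> source D. curve D s = y}"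
  proof (intro set_eqI iffI)
    fix s assume "s \<in> {s \<in> source D'. curve D' s = y}"
    then show "s \<in> h ` {s \<in> source D. curve D s = y}"
      using from_k[of s] by (metis (mono_tags, lifting) imageI mem_Collect_eq)
  next
    fix s assume "s \<in> h ` {s \<in> source D. curve D s = y}"
    then show "s \<in> {s \<in> source D'. curve D' s = y}"
      using Py hk1 ch by (auto simp: P'_def)
  qed
  have "inj_on h {s \<in> source D. curve D s = y}"
    by (rule inj_on_inverseI[of _ k]) (use Py hk1 in auto)
  then have "card {s \<in> source D'. curve D' s = y} = 2"
    using ok by (simp add: img card_image crossing_ok_def)
  moreover have "transverse_at D' s t \<and>
        (decor D' s, decor D' t) \<in> {(Over, Under), (Under, Over), (Virtual, Virtual)}"
    if st: "s \<in> source D'" "t \<in> source D'" "s \<noteq> t" "curve D' s = y" "curve D' t = y" for s t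
  proof -
    have ne: "k s \<noteq> k t" using from_k st by metis
    have "transverse_at D (k s) (k t) \<and>
        (decor D (k s), decor D (k t)) \<in> {(Over, Under), (Under, Over), (Virtual, Virtual)}"
      using ok from_k[OF st(1,4)] from_k[OF st(2,5)] ne unfolding crossing_ok_def by blast
    moreover have "transverse_at D' (h (k s)) (h (k t))"
      if "transverse_at D (k s) (k t)"
      by (rule transverse_at_transfer[OF that N(1) _ hk[unfolded P_def P'_def] _ cD cD'])
        (use from_k st N ch in \<open>auto simp: P_def\<close>)
    ultimately show ?thesis using from_k st by auto
  qed
  moreover have "\<exists>U. open U \<and> s \<in> U \<and> inj_on (curve D') (U \<inter> source D')"
    if s: "s \<in> source D'" "curve D' s = y" for s
  proof -
    obtain U where U: "open U" "k s \<in> U" "inj_on (curve D) (U \<inter> source D)"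
      using ok from_k[OF s] unfolding crossing_ok_def by blast
    have "openin (top_of_set (source D)) (U \<inter> P)"
      using openin_Int_open[OF open_vimage_curve[OF cD N(1)] U(1)] by (simp add: P_def inf_commute)
    then have "openin (top_of_set P) (U \<inter> P)"
      by (rule openin_subset_trans) (auto simp: P_def)
    then have "openin (top_of_set P') (h ` (U \<inter> P))"
      by (rule homeomorphism_imp_open_map[OF hk])
    then have "openin (top_of_set (source D')) (h ` (U \<inter> P))"
      using open_vimage_curve[OF cD' N(1)] openin_trans unfolding P'_def by blast
    then obtain T where T: "open T" "h ` (U \<inter> P) = source D' \<inter> T" unfolding openin_open by blast
    have "s \<in> h ` (U \<inter> P)" using from_k[OF s] Py U(2) by (metis IntI imageI)
    then have "s \<in> T" using T by blast
    moreover have "inj_on (curve D') (T \<inter> source D')"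
    proof (rule inj_onI)
      fix a b assume ab: "a \<in> T \<inter> source D'" "b \<in> T \<inter> source D'" "curve D' a = curve D' b"
      then have "a \<in> h ` (U \<inter> P)" "b \<in> h ` (U \<inter> P)" using T by auto
      then obtain a' b' where "a' \<in> U \<inter> P" "b' \<in> U \<inter> P" "a = h a'" "b = h b'" by blast
      moreover have "a' = b'"
        using inj_onD[OF U(3), of a' b'] calculation ab ch by (auto simp: P_def)
      ultimately show "a = b" by simp
    qed
    ultimately show ?thesis using T(1) by blast
  qed
  ultimately show ?thesis unfolding crossing_ok_def by blast
qed

text \<open>
  The criterion by which all diagrams below are recognised. A crossing outside \<open>B\<close> is a crossing of
  \<open>D\<close> and inherits everything from it, so only \<open>B\<close> has to be inspected.
\<close>

lemma virtual_link_diagram_local_change: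
  assumes D: "virtual_link_diagram D"
    and ag: "agree_outside B D D'" and B: "closed B"
    and cont: "continuous_on (source D') (curve D')"
    and fin: "finite (crossings D' \<inter> B)"
    and ok: "\<And>y. y \<in> crossings D' \<inter> B \<Longrightarrow> crossing_ok D' y"
    and plain: "\<And>s. s \<in> source D' \<Longrightarrow> curve D' s \<in> B - crossings D' \<Longrightarrow> decor D' s = Plain"
  shows "virtual_link_diagram D'"
proof (rule virtual_link_diagramI[OF cont])
  have cD: "continuous_on (source D) (curve D)" "finite (crossings D)"
    using D by (auto simp: virtual_link_diagram_def generic_immersion_def)
  have out: "y \<in> crossings D' \<longleftrightarrow> y \<in> crossings D" if "y \<notin> B" for y
    using crossings_agree_outside[OF ag, of y] that interior_subset by blast
  have "crossings D' \<subseteq> crossings D \<union> (crossings D' \<inter> B)" using out by blast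
  then show "finite (crossings D')" using cD fin finite_subset by blast
  show "crossing_ok D' y" if "y \<in> crossings D'" for y
  proof (cases "y \<in> B")
    case True then show ?thesis using ok that by blast
  next
    case False
    then have "crossing_ok D y" using crossing_ok_diagram[OF D] out that by blast
    then show ?thesis by (rule crossing_ok_transfer[OF _ ag B False cD(1) cont])
  qed
  show "decor D' s = Plain" if s: "s \<in> source D'" "curve D' s \<notin> crossings D'" for s
  proof (cases "curve D' s \<in> B")
    case True then show ?thesis using plain s by blast
  next
    case False
    obtain h k where hk: "homeomorphism {s \<in> source D'. curve D' s \<notin> interior B}
        {s \<in> source D. curve D s \<notin> interior B} h k"
      and c: "\<forall>s\<in>source D'. curve D' s \<notin> interior B \<longrightarrow>
        curve D (h s) = curve D' s \<and> decor D (h s) = decor D' s"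
      using agree_outside_sym[OF ag] unfolding agree_outside_def by blast
    have *: "curve D' s \<notin> interior B" using False interior_subset by blast
    then have "h s \<in> source D" "curve D (h s) = curve D' s" "decor D (h s) = decor D' s"
      using homeomorphism_mem1[OF hk, of s] c s by auto
    then show ?thesis using D s out[OF False] unfolding virtual_link_diagram_def by metis
  qed
qed

section \<open>Replacing one strand\<close>

text \<open>
  The parameters of the strand stay the same; only their images and decorations change, to those
  prescribed by \<open>\<beta>\<close> and \<open>dd\<close> in terms of the parameter of the arc \<open>a\<close>.
\<close>

definition replace_strand ::
  "vdiagram \<Rightarrow> (real \<Rightarrow> nat \<times> complex) \<Rightarrow> (real \<Rightarrow> complex) \<Rightarrow> (real \<Rightarrow> passage) \<Rightarrow> vdiagram" where
  "replace_strand D a \<beta> dd = D\<lparr>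
     curve := (\<lambda>s. if s \<in> path_image a then \<beta> (inv_into {0..1} a s) else curve D s),
     decor := (\<lambda>s. if s \<in> path_image a then dd (inv_into {0..1} a s) else decor D s)\<rparr>"

lemma replace_strand_simps [simp]:
  "source (replace_strand D a \<beta> dd) = source D"
  "ncomp (replace_strand D a \<beta> dd) = ncomp D"
  "s \<notin> path_image a \<Longrightarrow> curve (replace_strand D a \<beta> dd) s = curve D s"
  "s \<notin> path_image a \<Longrightarrow> decor (replace_strand D a \<beta> dd) s = decor D s"
  by (auto simp: replace_strand_def source_def)

lemma replace_strand_on:
  assumes "arc a" "t \<in> {0..1}"
  shows "curve (replace_strand D a \<beta> dd) (a t) = \<beta> t"
    "decor (replace_strand D a \<beta> dd) (a t) = dd t"
  using assms by (auto simp: replace_strand_def path_image_def arc_def)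

lemma strands_single:
  "strands D B 1 (\<lambda>_. a) \<longleftrightarrow> arc a \<and> path_image a = {s \<in> source D. curve D s \<in> B} \<and>
     (\<forall>t\<in>{0..1}. curve D (a t) \<in> frontier B \<longleftrightarrow> t = 0 \<or> t = 1) \<and> crossings D \<inter> frontier B = {}"
  by (simp add: strands_def lessThan_Suc)

text \<open>
  The part of \<open>D\<close> in \<open>B\<close> is one strand, and \<open>\<beta>\<close> is another curve in \<open>B\<close> with the
  same endpoints. Then the new diagram agrees with \<open>D\<close> outside \<open>B\<close> by the identity on parameters.
  Both directions of a first Reidemeister move are of this form: \<open>\<beta>\<close> is embedded when a kink is
  removed (\<open>unkink\<close>), and has one double point when a kink is inserted (\<open>virtual_kink\<close>).
\<close>

locale strand_replacement =
  fixes D :: vdiagram and B a \<beta> and dd :: "real \<Rightarrow> passage"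
  assumes D: "virtual_link_diagram D"
    and st: "strands D B 1 (\<lambda>_. a)"
    and B: "closed B"
    and path: "path \<beta>" and ends: "\<beta> 0 = curve D (a 0)" "\<beta> 1 = curve D (a 1)"
    and inB: "\<And>t. t \<in> {0..1} \<Longrightarrow> \<beta> t \<in> B"
    and fr: "\<And>t. t \<in> {0..1} \<Longrightarrow> \<beta> t \<in> frontier B \<longleftrightarrow> t = 0 \<or> t = 1"
    and plain_ends: "dd 0 = Plain" "dd 1 = Plain"
begin

abbreviation "E \<equiv> replace_strand D a \<beta> dd"

lemma arc_a: "arc a" using st by (simp add: strands_def)

lemma image_a: "path_image a = {s \<in> source D. curve D s \<in> B}"
  using st unfolding strands_single by blast

lemma on_a: assumes "t \<in> {0..1}" shows "curve E (a t) = \<beta> t" "decor E (a t) = dd t"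
  using replace_strand_on[OF arc_a assms] by auto

lemma curve_E_in: "s \<in> source D \<Longrightarrow> curve E s \<in> B \<longleftrightarrow> curve D s \<in> B"
proof (cases "s \<in> path_image a")
  case True
  then obtain t where "t \<in> {0..1}" "s = a t" by (auto simp: path_image_def)
  then show ?thesis using on_a inB image_a True by auto
qed simp

lemma frontier_iff: 
  assumes "t \<in> {0..1}" shows "curve D (a t) \<in> frontier B \<longleftrightarrow> t = 0 \<or> t = 1"
  using st assms by (auto simp: strands_def)

lemma at_ends: assumes "t = 0 \<or> t = 1" 
  shows "curve E (a t) = curve D (a t)" "decor E (a t) = decor D (a t)"
proof -
  have t: "t \<in> {0..1}" using assms by auto
  show "curve E (a t) = curve D (a t)" using on_a[OF t] ends assms by auto
  have "a t \<in> source D" using image_a t by (auto simp: path_image_def)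
  moreover have "curve D (a t) \<notin> crossings D"
    using frontier_iff[OF t] assms st by (auto simp: strands_def)
  ultimately have "decor D (a t) = Plain" using D by (auto simp: virtual_link_diagram_def)
  then show "decor E (a t) = decor D (a t)" using on_a[OF t] plain_ends assms by auto
qed

lemma interior_iff: assumes "s \<in> source D"
  shows "curve E s \<in> interior B \<longleftrightarrow> curve D s \<in> interior B"
    "curve D s \<notin> interior B \<Longrightarrow> curve E s = curve D s \<and> decor E s = decor D s"
proof -
  have int: "interior B = B - frontier B" using B interior_subset[of B] by (auto simp: frontier_def)
  have "(curve E s \<in> interior B \<longleftrightarrow> curve D s \<in> interior B) \<and>
    (curve D s \<notin> interior B \<longrightarrow> curve E s = curve D s \<and> decor E s = decor D s)"
  proof (cases "s \<in> path_image a")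
    case True
    then obtain t where t: "t \<in> {0..1}" "s = a t" by (auto simp: path_image_def)
    then have "curve E s \<in> B" "curve D s \<in> B" using on_a(1)[of t] inB[of t] image_a True by auto
    have int': "x \<in> interior B \<longleftrightarrow> x \<in> B \<and> x \<notin> frontier B" for x using int by blast
    have "curve E s \<in> frontier B \<longleftrightarrow> t = 0 \<or> t = 1"
      using on_a(1)[OF t(1)] fr[OF t(1)] t(2) by simp
    moreover have "curve D s \<in> frontier B \<longleftrightarrow> t = 0 \<or> t = 1"
      using frontier_iff[OF t(1)] t(2) by simp
    ultimately show ?thesis
      using at_ends[of t] int' \<open>curve E s \<in> B\<close> \<open>curve D s \<in> B\<close> t(2) by metis
  qed simp
  then show "curve E s \<in> interior B \<longleftrightarrow> curve D s \<in> interior B"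
    "curve D s \<notin> interior B \<Longrightarrow> curve E s = curve D s \<and> decor E s = decor D s" by auto
qed

lemma agree: "agree_outside B D E"
proof -
  have "{s \<in> source E. curve E s \<notin> interior B} = {s \<in> source D. curve D s \<notin> interior B}"
    using interior_iff by auto
  moreover have "homeomorphism X X (\<lambda>s. s) (\<lambda>s. s)" for X :: "(nat \<times> complex) set"
    by (rule homeomorphism_ident)
  ultimately show ?thesis unfolding agree_outside_def using interior_iff
    by (metis (no_types, lifting))
qed

lemma continuous_E: "continuous_on (source E) (curve E)"
proof -
  have cD: "continuous_on (source D) (curve D)" using D by (auto simp: virtual_link_diagram_def generic_immersion_def)
  define T where "T = {s \<in> source D. curve D s \<notin> interior B}"
  have clT: "closedin (top_of_set (source D)) T"
    using continuous_closedin_preimage[OF cD, of "- interior B"]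
    by (simp add: T_def vimage_def Int_def closed_Compl)
  have clA: "closedin (top_of_set (source D)) (path_image a)"
  proof (rule closed_subset)
    show "closed (path_image a)" using arc_a by (simp add: closed_path_image arc_imp_path)
  qed (use image_a in auto)
  have un: "source D = T \<union> path_image a" using image_a interior_subset by (auto simp: T_def)
  have "continuous_on T (curve E)"
    by (rule continuous_on_eq[OF continuous_on_subset[OF cD]]) (use interior_iff in \<open>auto simp: T_def\<close>)
  moreover have "continuous_on (path_image a) (curve E)"
  proof -
    have "continuous_on (path_image a) (inv_into {0..1} a)" unfolding path_image_def
      by (rule continuous_on_inv) (use arc_a in \<open>auto simp: arc_def path_def\<close>)
    moreover have "inv_into {0..1} a ` path_image a \<subseteq> {0..1}"
      unfolding path_image_def by (auto intro!: inv_into_into)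
    ultimately have "continuous_on (path_image a) (\<lambda>s. \<beta> (inv_into {0..1} a s))"
      by (rule continuous_on_compose2[OF path[unfolded path_def]])
    then show ?thesis by (rule continuous_on_eq) (auto simp: replace_strand_def)
  qed
  ultimately have "continuous_on (T \<union> path_image a) (curve E)"
    using clT clA un by (intro continuous_on_Un_local) auto
  then show ?thesis using un by simp
qed

lemma strands_E: 
  assumes "crossings E \<inter> frontier B = {}"
  shows "strands E B 1 (\<lambda>_. a)"
proof -
  have "{s \<in> source E. curve E s \<in> B} = {s \<in> source D. curve D s \<in> B}"
    using curve_E_in by auto
  then show ?thesis using assms arc_a image_a on_a fr unfolding strands_single by auto
qed

lemma same_ends_E: "same_ends D E 1 (\<lambda>_. a) (\<lambda>_. a)"
  using on_a[of 0] on_a[of 1] ends by (simp add: same_ends_def)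

lemma crossings_E_in: "crossings E \<inter> B = {\<beta> u |u v. u \<in> {0..1} \<and> v \<in> {0..1} \<and> u \<noteq> v \<and> \<beta> u = \<beta> v}"
proof (intro set_eqI iffI)
  fix y assume "y \<in> crossings E \<inter> B"
  then obtain s t where s: "s \<in> source D" "t \<in> source D" "s \<noteq> t" "curve E s = y" "curve E t = y" "y \<in> B"
    by (auto simp: crossings_def)
  then have "s \<in> path_image a" "t \<in> path_image a" using curve_E_in image_a by auto
  then obtain u v where "u \<in> {0..1}" "v \<in> {0..1}" "s = a u" "t = a v" by (auto simp: path_image_def)
  then show "y \<in> {\<beta> u |u v. u \<in> {0..1} \<and> v \<in> {0..1} \<and> u \<noteq> v \<and> \<beta> u = \<beta> v}"
    using s on_a[of u] on_a[of v] by (intro CollectI exI[of _ u] exI[of _ v]) auto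
next
  fix y assume "y \<in> {\<beta> u |u v. u \<in> {0..1} \<and> v \<in> {0..1} \<and> u \<noteq> v \<and> \<beta> u = \<beta> v}"
  then obtain u v where uv: "u \<in> {0..1}" "v \<in> {0..1}" "u \<noteq> v" "\<beta> u = \<beta> v" "y = \<beta> u" by blast
  have "a u \<noteq> a v" using arc_a uv by (auto simp: arc_def inj_on_def)
  moreover have "a u \<in> source E" "a v \<in> source E" using image_a uv by (auto simp: path_image_def)
  ultimately have "y \<in> crossings E"
    using crossingsI[of "a u" E "a v"] on_a[of u] on_a[of v] uv by simp
  then show "y \<in> crossings E \<inter> B" using inB uv by auto
qed

lemma curve_E_in_path:
  assumes "s \<in> source E" "curve E s \<in> B"
  obtains t where "t \<in> {0..1}" "s = a t"
proof -
  have "s \<in> path_image a" using assms curve_E_in image_a by simp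
  then show ?thesis using that unfolding path_image_def by blast
qed

text \<open>
  Without double points on \<open>\<beta>\<close> no crossing is left in \<open>B\<close>. The move from \<open>E\<close> back to
  \<open>D\<close> is R1 or VR1 according to the decoration of the crossing that is removed.
\<close>

lemma unkink:
  assumes inj: "inj_on \<beta> {0..1}" and dd: "\<And>t. dd t = Plain"
    and disk: "disk B" and x: "crossings D \<inter> B = {x}"
  shows "virtual_link_diagram E" "generalized_reidemeister_move E D" "crossings E = crossings D - {x}"
proof -
  have cr: "crossings E \<inter> B = {}" using inj by (auto simp: crossings_E_in inj_on_def)
  show vE: "virtual_link_diagram E"
  proof (rule virtual_link_diagram_local_change[OF D agree B continuous_E])
    fix s assume "s \<in> source E" "curve E s \<in> B - crossings E"
    then obtain t where "t \<in> {0..1}" "s = a t" using curve_E_in_path by blast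
    then show "decor E s = Plain" using on_a dd by simp
  qed (use cr in auto)
  have out: "y \<in> crossings E \<longleftrightarrow> y \<in> crossings D" if "y \<notin> B" for y
    using crossings_agree_outside[OF agree, of y] that interior_subset by blast
  show "crossings E = crossings D - {x}" using out cr x by blast
  have fE: "crossings E \<inter> frontier B = {}" using cr B by (auto simp: frontier_def)
  have "kink_move (x \<in> virtual_crossings D) E D"
    unfolding kink_move_def
  proof (intro exI conjI)
    show "disk B" by (rule disk)
    show "agree_outside B E D" by (rule agree_outside_sym[OF agree])
    show "strands E B 1 (\<lambda>_. a)" by (rule strands_E[OF fE])
    show "strands D B 1 (\<lambda>_. a)" by (rule st)
    show "same_ends E D 1 (\<lambda>_. a) (\<lambda>_. a)" using same_ends_E by (simp add: same_ends_def)
    show "crossings E \<inter> B = {}" by (rule cr)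
    show "crossings D \<inter> B = {x}" by (rule x)
    show "x \<in> (if x \<in> virtual_crossings D then virtual_crossings D else classical_crossings D)"
      using x by (auto simp: classical_crossings_def)
  qed
  then have "R1 E D \<or> VR1 E D" unfolding R1_def VR1_def by (cases "x \<in> virtual_crossings D") auto
  then show "generalized_reidemeister_move E D"
    using D vE unfolding generalized_reidemeister_move_def by blast
qed

text \<open>
  Here the double point \<open>y\<close> of \<open>\<beta>\<close> is the only crossing in \<open>B\<close>, so it is the only point
  at which transversality has to be supplied by the caller.
\<close>

lemma virtual_kink:
  assumes no: "crossings D \<inter> B = {}" and disk: "disk B"
    and y: "crossings E \<inter> B = {y}" "crossing_ok E y" "y \<notin> frontier B"
    and dd: "\<And>t. t \<in> {0..1} \<Longrightarrow> dd t = (if \<beta> t = y then Virtual else Plain)"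
  shows "virtual_link_diagram E" "generalized_reidemeister_move D E"
proof -
  show vE: "virtual_link_diagram E"
  proof (rule virtual_link_diagram_local_change[OF D agree B continuous_E])
    fix s assume s: "s \<in> source E" "curve E s \<in> B - crossings E"
    then obtain t where "t \<in> {0..1}" "s = a t" using curve_E_in_path by blast
    then show "decor E s = Plain" using on_a dd y s by auto
  qed (use y in auto)
  have fE: "crossings E \<inter> frontier B = {}" using y B by (auto simp: frontier_def)
  have vir: "y \<in> virtual_crossings E"
  proof -
    have "decor E s = Virtual" if s: "s \<in> source E" "curve E s = y" for s
    proof -
      obtain t where "t \<in> {0..1}" "s = a t" using curve_E_in_path y s by blast
      then show ?thesis using on_a dd s by auto
    qed
    then show ?thesis using y by (auto simp: virtual_crossings_def)
  qed
  have "kink_move True D E"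
    unfolding kink_move_def
  proof (intro exI conjI)
    show "disk B" by (rule disk)
    show "agree_outside B D E" by (rule agree)
    show "strands E B 1 (\<lambda>_. a)" by (rule strands_E[OF fE])
    show "strands D B 1 (\<lambda>_. a)" by (rule st)
    show "same_ends D E 1 (\<lambda>_. a) (\<lambda>_. a)" by (rule same_ends_E)
    show "crossings D \<inter> B = {}" by (rule no)
    show "crossings E \<inter> B = {y}" by (rule y)
    show "y \<in> (if True then virtual_crossings E else classical_crossings E)" using vir by simp
  qed
  then show "generalized_reidemeister_move D E"
    using D vE unfolding generalized_reidemeister_move_def VR1_def by blast
qed

end

section \<open>A polygonal kink\<close>

text \<open>Stays at \<open>0\<close> up to \<open>a\<close>, grows with slope one, and is constant from \<open>b\<close> on.\<close>

definition ramp :: "real \<Rightarrow> real \<Rightarrow> real \<Rightarrow> real" where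
  "ramp a b u = max a (min b u) - a"

text \<open>
  A polygon that follows the real axis up to \<open>-3\<close>, then visits the corners \<open>-3-\<i>\<close>, \<open>1-\<i>\<close>, \<open>1+\<i>\<close>,
  \<open>-1+\<i>\<close>, \<open>-1\<close>, and from there follows the real axis to infinity, crossing itself at \<open>1\<close> at a right
  angle, at the times \<open>2\<close> and \<open>8\<close>. If the left half plane is the disk of an H-move, the polygon
  leaves it at \<open>-\<i>\<close> (time \<open>0\<close>), returns at \<open>\<i>\<close> (time \<open>4\<close>) and leaves again at \<open>0\<close>
  (time \<open>7\<close>). The speed is one around the passages of the imaginary axis and at the crossing; the
  stretches of speed two catch up with the identity, which holds for \<open>u \<le> -5\<close> and \<open>u \<ge> 16\<close>.
\<close>

definition kink :: "real \<Rightarrow> complex" where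
  "kink u = Complex
     (min u (-5) + 2 * ramp (-5) (-4) u + ramp (-3) 1 u - ramp 3 5 u + ramp 6 9 u
        + 2 * ramp 9 16 u + (max u 16 - 16))
     (- ramp (-4) (-3) u + ramp 1 3 u - ramp 5 6 u)"

lemma continuous_on_kink: "continuous_on S kink"
  unfolding kink_def ramp_def complex_eq by (intro continuous_intros)

lemma kink_eqs:
  "u \<le> -5 \<Longrightarrow> kink u = Complex u 0"
  "-5 \<le> u \<Longrightarrow> u \<le> -4 \<Longrightarrow> kink u = Complex (2 * u + 5) 0"
  "-4 \<le> u \<Longrightarrow> u \<le> -3 \<Longrightarrow> kink u = Complex (-3) (- u - 4)"
  "-3 \<le> u \<Longrightarrow> u \<le> 1 \<Longrightarrow> kink u = Complex u (-1)"
  "1 \<le> u \<Longrightarrow> u \<le> 3 \<Longrightarrow> kink u = Complex 1 (u - 2)"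
  "3 \<le> u \<Longrightarrow> u \<le> 5 \<Longrightarrow> kink u = Complex (4 - u) 1"
  "5 \<le> u \<Longrightarrow> u \<le> 6 \<Longrightarrow> kink u = Complex (-1) (6 - u)"
  "6 \<le> u \<Longrightarrow> u \<le> 9 \<Longrightarrow> kink u = Complex (u - 7) 0"
  "9 \<le> u \<Longrightarrow> u \<le> 16 \<Longrightarrow> kink u = Complex (2 * u - 16) 0"
  "16 \<le> u \<Longrightarrow> kink u = Complex u 0"
  by (simp_all add: kink_def ramp_def)

lemma kink_cases:
  obtains "u \<le> -5" "kink u = Complex u 0"
  | "-5 \<le> u" "u \<le> -4" "kink u = Complex (2 * u + 5) 0"
  | "-4 < u" "u < -3" "kink u = Complex (-3) (- u - 4)"
  | "-3 \<le> u" "u \<le> 1" "kink u = Complex u (-1)"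
  | "1 < u" "u < 3" "kink u = Complex 1 (u - 2)"
  | "3 \<le> u" "u \<le> 5" "kink u = Complex (4 - u) 1"
  | "5 < u" "u < 6" "kink u = Complex (-1) (6 - u)"
  | "6 \<le> u" "u \<le> 9" "kink u = Complex (u - 7) 0"
  | "9 \<le> u" "u \<le> 16" "kink u = Complex (2 * u - 16) 0"
  | "16 \<le> u" "kink u = Complex u 0"
proof -
  consider "u \<le> -5"
    | "-5 \<le> u" "u \<le> -4"
    | "-4 < u" "u < -3"
    | "-3 \<le> u" "u \<le> 1"
    | "1 < u" "u < 3"
    | "3 \<le> u" "u \<le> 5"
    | "5 < u" "u < 6"
    | "6 \<le> u" "u \<le> 9"
    | "9 \<le> u" "u \<le> 16"
    | "16 \<le> u" by linarith
  then show thesis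
  proof cases
    case 1
    then show thesis using that(1) kink_eqs(1)[of u] by simp
  next
    case 2
    then show thesis using that(2) kink_eqs(2)[of u] by simp
  next
    case 3
    then show thesis using that(3) kink_eqs(3)[of u] by simp
  next
    case 4
    then show thesis using that(4) kink_eqs(4)[of u] by simp
  next
    case 5
    then show thesis using that(5) kink_eqs(5)[of u] by simp
  next
    case 6
    then show thesis using that(6) kink_eqs(6)[of u] by simp
  next
    case 7
    then show thesis using that(7) kink_eqs(7)[of u] by simp
  next
    case 8
    then show thesis using that(8) kink_eqs(8)[of u] by simp
  next
    case 9
    then show thesis using that(9) kink_eqs(9)[of u] by simp
  next
    case 10
    then show thesis using that(10) kink_eqs(10)[of u] by simp
  qed
qed

lemma kink_double_point:
  assumes "kink u = kink v" "u < v" shows "u = 2 \<and> v = 8"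
  by (rule kink_cases[of u]; rule kink_cases[of v]) (use assms in auto)

lemma kink_2_8 [simp]: "kink 2 = 1" "kink 8 = 1"
  by (simp_all add: kink_eqs complex_eq_iff)

lemma kink_0_4_7 [simp]: "kink 0 = - \<i>" "kink 4 = \<i>" "kink 7 = 0"
  by (simp_all add: kink_eqs complex_eq_iff)

lemma Re_kink_neg: "Re (kink u) < 0 \<longleftrightarrow> u < 0 \<or> 4 < u \<and> u < 7"
  by (rule kink_cases[of u]) auto

lemma Re_kink_zero: "Re (kink u) = 0 \<longleftrightarrow> u = 0 \<or> u = 4 \<or> u = 7"
  by (rule kink_cases[of u]) auto

lemma kink_far: "u \<le> -5 \<or> 16 \<le> u \<Longrightarrow> kink u = of_real u"
  by (auto simp: kink_eqs complex_eq_iff)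

lemma norm_kink_less: "norm (kink u) < 20 \<longleftrightarrow> \<bar>u\<bar> < 20"
proof (cases "u \<le> -5 \<or> 16 \<le> u")
  case True then show ?thesis by (simp add: kink_far)
next
  case False
  have "\<bar>Re (kink u)\<bar> \<le> 16 \<and> \<bar>Im (kink u)\<bar> \<le> 1"
    by (rule kink_cases[of u]) (use False in auto)
  then show ?thesis using cmod_le[of "kink u"] False by linarith
qed

text \<open>
  Near the upper passage of the imaginary axis the polygon is a single horizontal segment; \<open>kink_near_0\<close> is
  the same for the lower passage. This is what provides the chart for the next kink.
\<close>

lemma kink_near_4:
  "\<bar>Re (kink u)\<bar> < 1/2 \<and> \<bar>Im (kink u) - 1\<bar> < 1/2 \<longleftrightarrow> \<bar>u - 4\<bar> < 1/2"
  by (rule kink_cases[of u]) (auto simp: abs_if)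

lemma kink_near_0:
  "\<bar>Re (kink u)\<bar> < 1/2 \<and> \<bar>Im (kink u) + 1\<bar> < 1/2 \<longleftrightarrow> \<bar>u\<bar> < 1/2"
  by (rule kink_cases[of u]) (auto simp: abs_if)

lemma kink_near_crossing:
  assumes "norm (kink u - 1) < 1/2"
  shows "\<bar>u - 2\<bar> < 1/2 \<or> \<bar>u - 8\<bar> < 1/2"
proof -
  have "\<bar>Re (kink u) - 1\<bar> < 1/2" "\<bar>Im (kink u)\<bar> < 1/2"
    using abs_Re_le_cmod[of "kink u - 1"] abs_Im_le_cmod[of "kink u - 1"] assms by auto
  then show ?thesis by (cases rule: kink_cases[of u]) (auto simp: abs_if split: if_splits)
qed

lemma kink_at_crossing:
  "\<bar>u - 2\<bar> < 1/2 \<Longrightarrow> kink u = 1 + \<i> * of_real (u - 2)"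
  "\<bar>u - 8\<bar> < 1/2 \<Longrightarrow> kink u = 1 + of_real (u - 8)"
proof -
  assume u: "\<bar>u - 2\<bar> < 1/2"
  then have "1 \<le> u" "u \<le> 3" by linarith+
  then show "kink u = 1 + \<i> * of_real (u - 2)" by (simp add: kink_eqs(5) complex_eq_iff)
next
  assume u: "\<bar>u - 8\<bar> < 1/2"
  then have "6 \<le> u" "u \<le> 9" by linarith+
  then show "kink u = 1 + of_real (u - 8)" by (simp add: kink_eqs(8) complex_eq_iff)
qed

section \<open>Straight charts\<close>

lemma chart_open_image:
  fixes \<Phi> :: "complex \<Rightarrow> complex"
  assumes "continuous_on M \<Phi>" "inj_on \<Phi> M" "open S" "S \<subseteq> M"
  shows "open (\<Phi> ` S)"
  using assms by (intro invariance_of_domain) (auto intro: continuous_on_subset inj_on_subset)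

text \<open>By invariance of domain the image of the open ball is the interior of the image of the closed ball.\<close>

lemma frontier_chart_cball:
  fixes \<Phi> :: "complex \<Rightarrow> complex"
  assumes "open M" "continuous_on M \<Phi>" "inj_on \<Phi> M" "cball c r \<subseteq> M" "r > 0"
  shows "closed (\<Phi> ` cball c r)" "frontier (\<Phi> ` cball c r) = \<Phi> ` sphere c r" "disk (\<Phi> ` cball c r)"
proof -
  have c: "continuous_on (cball c r) \<Phi>" and i: "inj_on \<Phi> (cball c r)"
    using assms by (auto intro: continuous_on_subset inj_on_subset)
  show cl: "closed (\<Phi> ` cball c r)"
    by (rule compact_imp_closed[OF compact_continuous_image[OF c compact_cball]])
  have int: "interior (\<Phi> ` cball c r) = \<Phi> ` ball c r"
  proof
    have "open (M \<inter> \<Phi> -` interior (\<Phi> ` cball c r))"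
      using assms by (intro continuous_open_preimage) auto
    moreover have "M \<inter> \<Phi> -` interior (\<Phi> ` cball c r) \<subseteq> cball c r"
    proof
      fix z assume z: "z \<in> M \<inter> \<Phi> -` interior (\<Phi> ` cball c r)"
      then have "\<Phi> z \<in> \<Phi> ` cball c r" using interior_subset by blast
      then obtain w where "w \<in> cball c r" "\<Phi> z = \<Phi> w" by blast
      then show "z \<in> cball c r" using assms z by (metis IntD1 inj_onD subsetD)
    qed
    ultimately have *: "M \<inter> \<Phi> -` interior (\<Phi> ` cball c r) \<subseteq> ball c r"
      using interior_maximal interior_cball by metis
    show "interior (\<Phi> ` cball c r) \<subseteq> \<Phi> ` ball c r"
    proof
      fix y assume y: "y \<in> interior (\<Phi> ` cball c r)"
      then obtain w where w: "w \<in> cball c r" "y = \<Phi> w" using interior_subset by blast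
      then have "w \<in> ball c r" using * y assms by blast
      then show "y \<in> \<Phi> ` ball c r" using w by blast
    qed
    have "open (\<Phi> ` ball c r)"
      by (rule chart_open_image[OF assms(2,3)]) (use assms ball_subset_cball in auto)
    then show "\<Phi> ` ball c r \<subseteq> interior (\<Phi> ` cball c r)"
      by (rule interior_maximal[rotated]) (use ball_subset_cball in auto)
  qed
  have "sphere c r = cball c r - ball c r" by auto
  then have "\<Phi> ` sphere c r = \<Phi> ` cball c r - \<Phi> ` ball c r"
    using inj_on_image_set_diff[OF i] by (metis Diff_subset ball_subset_cball)
  then show "frontier (\<Phi> ` cball c r) = \<Phi> ` sphere c r"
    using cl int by (simp add: frontier_def)
  have "(\<Phi> ` cball c r) homeomorphic cball c r"
    using homeomorphic_compact[OF compact_cball c refl i] homeomorphic_sym by blast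
  moreover have "cball c r homeomorphic cball (0::complex) 1"
    using assms(5) by (intro homeomorphic_balls) auto
  ultimately show "disk (\<Phi> ` cball c r)" unfolding disk_def by (rule homeomorphic_trans)
qed

text \<open>
  An open subset of the plane, parametrised by the whole plane, in which the diagram is the real axis.
  Since \<open>curve D \<circ> g\<close> is \<open>\<tau>\<close> on the reals, \<open>g\<close> is automatically a homeomorphism onto an
  open set of parameters.
\<close>

locale straight_chart =
  fixes D :: vdiagram and \<tau> :: "complex \<Rightarrow> complex" and g :: "real \<Rightarrow> nat \<times> complex"
  assumes D: "virtual_link_diagram D"
    and cont: "continuous_on UNIV \<tau>" and inj: "inj \<tau>"
    and cont_g: "continuous_on UNIV g"
    and range_g: "range g = {s \<in> source D. curve D s \<in> range \<tau>}"
    and curve_g: "curve D (g u) = \<tau> (of_real u)"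
begin

lemma chi_eq: "\<tau> z = \<tau> w \<longleftrightarrow> z = w" using inj by (auto simp: inj_def)

lemma g_eq: "g u = g v \<longleftrightarrow> u = v"
proof
  assume "g u = g v"
  then have "\<tau> (of_real u) = \<tau> (of_real v)" using curve_g by metis
  then show "u = v" by (simp add: chi_eq)
qed simp

lemma g_source: "g u \<in> source D" using range_g by auto

text \<open>Complex conjugation fixes the real axis; inserting the kink into this chart gives the mirror image.\<close>

lemma mirror: "straight_chart D (\<tau> \<circ> cnj) g"
proof
  have "range (\<tau> \<circ> cnj) = range \<tau>"
    using surj_def[of cnj] complex_cnj_cnj by (metis image_comp surj_def)
  then show "range g = {s \<in> source D. curve D s \<in> range (\<tau> \<circ> cnj)}" using range_g by simp
  show "continuous_on UNIV (\<tau> \<circ> cnj)"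
    by (intro continuous_on_compose continuous_on_cnj continuous_on_id continuous_on_subset[OF cont]) auto
  show "inj (\<tau> \<circ> cnj)" by (rule injI) (simp add: chi_eq)
qed (use D cont_g curve_g in auto)

lemma not_crossing: "\<tau> z \<notin> crossings D"
proof
  assume "\<tau> z \<in> crossings D"
  then obtain s t where st: "s \<in> source D" "t \<in> source D" "s \<noteq> t" "curve D s = \<tau> z" "curve D t = \<tau> z"
    by (auto simp: crossings_def)
  then have "s \<in> range g" "t \<in> range g" using range_g by auto
  then obtain u v where "s = g u" "t = g v" by blast
  then show False using st curve_g chi_eq by (metis of_real_eq_iff)
qed

lemma decor_g: "decor D (g u) = Plain"
  using D not_crossing g_source curve_g unfolding virtual_link_diagram_def by metis

text \<open>
  The polygon \<open>kink\<close> is put in place of the real axis, on the parameter interval from \<open>-20\<close> to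
  \<open>20\<close>; the disk of radius \<open>20\<close> contains all of it where it differs from the axis. The crossing is virtual,
  which spares a choice of over- and under-strand.
\<close>

definition "kinked = replace_strand D (\<lambda>t. g (40 * t - 20)) (\<lambda>t. \<tau> (kink (40 * t - 20)))
   (\<lambda>t. if \<tau> (kink (40 * t - 20)) = \<tau> 1 then Virtual else Plain)"

abbreviation "strand \<equiv> (\<lambda>t. g (40 * t - 20))"
abbreviation "K \<equiv> \<tau> ` cball 0 20"

lemma K: "closed K" "frontier K = \<tau> ` sphere 0 20" "disk K"
  using frontier_chart_cball[OF open_UNIV cont inj, of 0 20] by auto

lemma param: "\<bar>u\<bar> \<le> 20 \<Longrightarrow> \<exists>t\<in>{0..1}. u = 40 * t - 20" for u :: real
  by (rule bexI[of _ "(u + 20) / 40"]) (auto simp: field_simps)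

lemma in_K: "\<tau> z \<in> K \<longleftrightarrow> norm z \<le> 20" "\<tau> z \<in> frontier K \<longleftrightarrow> norm z = 20"
  unfolding K using chi_eq by (auto simp: image_iff)

lemma arc_strand: "arc strand"
  unfolding arc_def path_def
proof
  show "continuous_on {0..1} strand"
    by (rule continuous_on_compose2[OF cont_g]) (auto intro!: continuous_intros)
  show "inj_on strand {0..1}" by (rule inj_onI) (simp add: g_eq)
qed

lemma strand_image: "path_image strand = g ` {-20..20}"
proof
  show "path_image strand \<subseteq> g ` {-20..20}" by (auto simp: path_image_def)
  show "g ` {-20..20} \<subseteq> path_image strand"
  proof
    fix s assume "s \<in> g ` {-20..20}"
    then obtain u where "u \<in> {-20..20}" and u2: "s = g u" by blast
    then have u: "\<bar>u\<bar> \<le> 20" "s = g u" by auto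
    from param[OF u(1)] obtain t where "t \<in> {0..1}" "u = 40 * t - 20" by blast
    then show "s \<in> path_image strand" using u by (auto simp: path_image_def)
  qed
qed

lemma strands_K: "strands D K 1 (\<lambda>_. strand)"
  unfolding strands_single
proof (intro conjI ballI)
  show "arc strand" by (rule arc_strand)
  show "crossings D \<inter> frontier K = {}" using K not_crossing by auto
  show "curve D (strand t) \<in> frontier K \<longleftrightarrow> t = 0 \<or> t = 1" if "t \<in> {0..1}" for t
  proof -
    have "curve D (strand t) \<in> frontier K \<longleftrightarrow> \<bar>40 * t - 20\<bar> = 20"
      unfolding curve_g in_K norm_of_real ..
    then show ?thesis using that by (auto simp: abs_if split: if_splits)
  qed
  show "path_image strand = {s \<in> source D. curve D s \<in> K}"
    unfolding strand_image
  proof (intro set_eqI iffI)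
    fix s assume "s \<in> g ` {-20..20}"
    then obtain u where "u \<in> {-20..20}" and u2: "s = g u" by blast
    then have u: "\<bar>u\<bar> \<le> 20" "s = g u" by auto
    have "curve D s \<in> K" unfolding u(2) curve_g in_K norm_of_real by (rule u(1))
    then show "s \<in> {s \<in> source D. curve D s \<in> K}" using g_source u by auto
  next
    fix s assume s: "s \<in> {s \<in> source D. curve D s \<in> K}"
    then have "s \<in> range g" using range_g by auto
    then obtain u where u: "s = g u" by blast
    then have "\<tau> (of_real u) \<in> K" using s curve_g by auto
    then have "\<bar>u\<bar> \<le> 20" unfolding in_K norm_of_real .
    then have "u \<in> {-20..20}" by auto
    then show "s \<in> g ` {-20..20}" using u by blast
  qed
qed

lemma kink_K: "\<tau> (kink u) \<in> K \<longleftrightarrow> \<bar>u\<bar> \<le> 20" "\<tau> (kink u) \<in> frontier K \<longleftrightarrow> \<bar>u\<bar> = 20"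
proof -
  have "norm (kink u) \<le> 20 \<longleftrightarrow> \<bar>u\<bar> \<le> 20" "norm (kink u) = 20 \<longleftrightarrow> \<bar>u\<bar> = 20"
    using norm_kink_less[of u] kink_far[of u] by (cases "\<bar>u\<bar> < 20"; force)+
  then show "\<tau> (kink u) \<in> K \<longleftrightarrow> \<bar>u\<bar> \<le> 20" "\<tau> (kink u) \<in> frontier K \<longleftrightarrow> \<bar>u\<bar> = 20"
    unfolding in_K by auto
qed

lemma rep: "strand_replacement D K strand (\<lambda>t. \<tau> (kink (40 * t - 20)))
   (\<lambda>t. if \<tau> (kink (40 * t - 20)) = \<tau> 1 then Virtual else Plain)"
proof
  show "path (\<lambda>t. \<tau> (kink (40 * t - 20)))" unfolding path_def
    by (intro continuous_on_compose2[OF cont] continuous_on_compose2[OF continuous_on_kink[of UNIV]] continuous_intros) auto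
  show "\<tau> (kink (40 * 0 - 20)) = curve D (g (40 * 0 - 20))"
    "\<tau> (kink (40 * 1 - 20)) = curve D (g (40 * 1 - 20))"
    by (simp_all add: curve_g kink_far)
  show "\<tau> (kink (40 * t - 20)) \<in> K" if "t \<in> {0..1}" for t
    using that by (auto simp: kink_K)
  show "\<tau> (kink (40 * t - 20)) \<in> frontier K \<longleftrightarrow> t = 0 \<or> t = 1" if "t \<in> {0..1}" for t
    using that by (auto simp: kink_K abs_if)
  show "strands D K 1 (\<lambda>_. strand)" by (rule strands_K)
qed (simp_all add: D K chi_eq kink_far)

sublocale R: strand_replacement D K strand "\<lambda>t. \<tau> (kink (40 * t - 20))"
   "\<lambda>t. if \<tau> (kink (40 * t - 20)) = \<tau> 1 then Virtual else Plain"
  by (rule rep)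

lemma source_kinked [simp]: "source kinked = source D" "ncomp kinked = ncomp D"
  by (simp_all add: kinked_def)

lemma curve_kinked: "curve kinked (g u) = \<tau> (kink u)"
proof (cases "\<bar>u\<bar> \<le> 20")
  case True
  from param[OF True] obtain t where "t \<in> {0..1}" "u = 40 * t - 20" by blast
  then show ?thesis using R.on_a(1)[of t] by (simp add: kinked_def)
next
  case False
  then have "g u \<notin> path_image strand" by (auto simp: strand_image g_eq)
  moreover have "kink u = of_real u" using False by (intro kink_far) auto
  ultimately show ?thesis by (simp add: kinked_def curve_g)
qed

lemma decor_kinked: "decor kinked (g u) = (if u = 2 \<or> u = 8 then Virtual else Plain)"
proof (cases "\<bar>u\<bar> \<le> 20")
  case True
  from param[OF True] obtain t where t: "t \<in> {0..1}" "u = 40 * t - 20" by blast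
  have "kink u = 1 \<longleftrightarrow> u = 2 \<or> u = 8"
    using kink_double_point[of u 2] kink_double_point[of 2 u] by (cases "u < 2"; cases "u = 2"; force)
  then show ?thesis using R.on_a(2)[OF t(1)] t by (simp add: kinked_def chi_eq)
next
  case False
  then have "g u \<notin> path_image strand" by (auto simp: strand_image g_eq)
  then show ?thesis using False by (auto simp add: kinked_def decor_g)
qed

lemma kinked_outside:
  assumes "s \<notin> range g"
  shows "curve kinked s = curve D s" "decor kinked s = decor D s"
proof -
  have "s \<notin> path_image strand" using assms by (auto simp: path_image_def)
  then show "curve kinked s = curve D s" "decor kinked s = decor D s" by (simp_all add: kinked_def)
qed

lemma kinked_range:
  assumes "s \<in> source D" shows "curve kinked s \<in> range \<tau> \<longleftrightarrow> s \<in> range g"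
proof (cases "s \<in> range g")
  case True
  then obtain u where "s = g u" by blast
  then show ?thesis by (simp add: curve_kinked)
next
  case False
  then have "curve D s \<notin> range \<tau>" using range_g assms by blast
  then show ?thesis using False kinked_outside(1)[OF False] by simp
qed

lemma continuous_kinked: "continuous_on (source D) (curve kinked)"
  using R.continuous_E by (simp add: kinked_def)

lemma open_g_image:
  assumes "open S" shows "openin (top_of_set (source D)) (g ` S)"
proof -
  have "open (\<tau> ` {z. Re z \<in> S})"
    by (rule chart_open_image[OF cont inj])
      (use open_vimage[OF assms continuous_on_Re[OF continuous_on_id]] in \<open>auto simp: vimage_def\<close>)
  moreover have "g ` S = {r \<in> source D. curve D r \<in> \<tau> ` {z. Re z \<in> S}}"
  proof (intro set_eqI iffI)
    fix s assume "s \<in> g ` S"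
    then show "s \<in> {r \<in> source D. curve D r \<in> \<tau> ` {z. Re z \<in> S}}" using g_source curve_g by force
  next
    fix s assume s: "s \<in> {r \<in> source D. curve D r \<in> \<tau> ` {z. Re z \<in> S}}"
    then have "s \<in> range g" using range_g by auto
    then obtain u where u: "s = g u" by blast
    then have "\<tau> (of_real u) \<in> \<tau> ` {z. Re z \<in> S}" using s curve_g by simp
    then have "u \<in> S" by (auto simp: chi_eq)
    then show "s \<in> g ` S" using u by blast
  qed
  moreover have "continuous_on (source D) (curve D)"
    using D by (auto simp: virtual_link_diagram_def generic_immersion_def)
  ultimately show ?thesis using open_vimage_curve[of D "\<tau> ` {z. Re z \<in> S}"] by simp
qed

lemma crossings_kinked: "crossings kinked \<inter> K = {\<tau> 1}"
proof -
  have "crossings kinked \<inter> K = {\<tau> (kink (40 * u - 20)) |u v. u \<in> {0..1} \<and> v \<in> {0..1} \<and> u \<noteq> v \<and>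
      \<tau> (kink (40 * u - 20)) = \<tau> (kink (40 * v - 20))}"
    using R.crossings_E_in by (simp add: kinked_def)
  also have "\<dots> = {\<tau> 1}"
  proof (intro set_eqI iffI)
    fix y assume "y \<in> {\<tau> (kink (40 * u - 20)) |u v. u \<in> {0..1} \<and> v \<in> {0..1} \<and> u \<noteq> v \<and>
      \<tau> (kink (40 * u - 20)) = \<tau> (kink (40 * v - 20))}"
    then obtain u v :: real where uv: "y = \<tau> (kink (40 * u - 20))" "u \<noteq> v"
      "kink (40 * u - 20) = kink (40 * v - 20)" by (auto simp: chi_eq)
    then have "40 * u - 20 = 2 \<or> 40 * u - 20 = 8"
      using kink_double_point[OF uv(3)] kink_double_point[OF uv(3)[symmetric]] by (cases "u < v") auto
    then have "kink (40 * u - 20) = 1" by (elim disjE) (simp_all only: kink_2_8)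
    then show "y \<in> {\<tau> 1}" using uv(1) by simp
  next
    fix y assume "y \<in> {\<tau> 1}"
    moreover have "40 * (11/20) - 20 = (2::real)" "40 * (7/10) - 20 = (8::real)" by auto
    ultimately show "y \<in> {\<tau> (kink (40 * u - 20)) |u v. u \<in> {0..1} \<and> v \<in> {0..1} \<and> u \<noteq> v \<and>
      \<tau> (kink (40 * u - 20)) = \<tau> (kink (40 * v - 20))}"
      by (intro CollectI exI[of _ "11/20"] exI[of _ "7/10"]) auto
  qed
  finally show ?thesis .
qed

text \<open>Within distance \<open>1/2\<close> of the crossing the polygon consists of two perpendicular segments.\<close>

lemma transverse_kinked: "transverse_at kinked (g 8) (g 2)"
proof -
  define W where "W = \<tau> ` ball 1 (1/2)"
  define \<psi>' where "\<psi>' z = \<tau> (1 + z / 2)" for z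
  define \<psi> where "\<psi> w = 2 * (inv \<tau> w - 1)" for w
  have inv: "inv \<tau> (\<tau> z) = z" for z using inj by simp
  have half: "norm (z / 2) < 1/2 \<longleftrightarrow> norm z < 1" for z :: complex by (simp add: norm_divide)
  have oW: "open W" unfolding W_def by (rule chart_open_image[OF cont inj]) auto
  have hom: "homeomorphism W (ball 0 1) \<psi> \<psi>'"
  proof (rule homeomorphismI)
    have "continuous_on (\<tau> ` UNIV) (inv \<tau>)"
      by (rule continuous_on_inverse_open[OF open_UNIV cont]) (use inv in auto)
    then have "continuous_on W (inv \<tau>)" by (rule continuous_on_subset) (auto simp: W_def)
    then show "continuous_on W \<psi>" unfolding \<psi>_def by (intro continuous_intros)
    show "continuous_on (ball 0 1) \<psi>'" unfolding \<psi>'_def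
      by (intro continuous_on_compose2[OF cont] continuous_intros) auto
    show "\<psi> ` W \<subseteq> ball 0 1"
    proof -
      have "norm (2 * (z - 1)) < 1" if "z \<in> ball 1 (1/2)" for z :: complex
        using that unfolding norm_mult by (simp add: dist_norm norm_minus_commute)
      then show ?thesis by (auto simp: W_def \<psi>_def inv)
    qed
    show "\<psi>' ` ball 0 1 \<subseteq> W"
      by (auto simp: W_def \<psi>'_def dist_norm norm_divide)
    have "1 + 2 * (z - 1) / 2 = z" for z :: complex by (simp add: field_simps)
    then show "\<psi>' (\<psi> x) = x" if "x \<in> W" for x using that unfolding W_def \<psi>_def \<psi>'_def by (auto simp: inv simp del: right_diff_distrib_numeral)
    show "\<psi> (\<psi>' y) = y" for y by (simp add: \<psi>_def \<psi>'_def inv)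
  qed
  have un: "{r \<in> source kinked. curve kinked r \<in> W} = g ` {15/2<..<17/2} \<union> g ` {3/2<..<5/2}"
  proof (intro set_eqI iffI)
    fix r assume r: "r \<in> {r \<in> source kinked. curve kinked r \<in> W}"
    then have "r \<in> range g" using kinked_range[of r] by (auto simp: W_def)
    then obtain u where u: "r = g u" by blast
    then have "kink u \<in> ball 1 (1/2)" using r by (auto simp: curve_kinked W_def chi_eq)
    then have "\<bar>u - 2\<bar> < 1/2 \<or> \<bar>u - 8\<bar> < 1/2"
      by (intro kink_near_crossing) (simp add: dist_norm norm_minus_commute)
    then show "r \<in> g ` {15/2<..<17/2} \<union> g ` {3/2<..<5/2}" unfolding u
      by (auto simp: abs_if split: if_splits)
  next
    fix r assume "r \<in> g ` {15/2<..<17/2} \<union> g ` {3/2<..<5/2}"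
    then obtain u where u: "r = g u" "\<bar>u - 2\<bar> < 1/2 \<or> \<bar>u - 8\<bar> < 1/2" by (force simp: abs_if)
    from u(2) have "norm (kink u - 1) < 1/2"
    proof
      assume a: "\<bar>u - 2\<bar> < 1/2"
      have "kink u - 1 = \<i> * of_real (u - 2)" using kink_at_crossing(1)[OF a] by simp
      then show ?thesis using a by (simp only: norm_mult norm_ii norm_of_real mult_1)
    next
      assume a: "\<bar>u - 8\<bar> < 1/2"
      have "kink u - 1 = of_real (u - 8)" using kink_at_crossing(2)[OF a] by simp
      then show ?thesis using a by (simp only: norm_of_real)
    qed
    then have "kink u \<in> ball 1 (1/2)" by (simp add: dist_norm norm_minus_commute)
    then show "r \<in> {r \<in> source kinked. curve kinked r \<in> W}"
      using u g_source by (auto simp: curve_kinked W_def)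
  qed
  have psi: "\<psi> (curve kinked (g u)) = 2 * (kink u - 1)" for u
    by (simp add: \<psi>_def curve_kinked inv)
  show ?thesis unfolding transverse_at_def
  proof (intro exI conjI)
    show "open W" by (rule oW)
    show "homeomorphism W (ball 0 1) \<psi> \<psi>'" by (rule hom)
    show "openin (top_of_set (source kinked)) (g ` {15/2<..<17/2})"
      "openin (top_of_set (source kinked)) (g ` {3/2<..<5/2})"
      using open_g_image by auto
    show "g 8 \<in> g ` {15/2<..<17/2}" "g 2 \<in> g ` {3/2<..<5/2}" by auto
    show "g ` {15/2<..<17/2} \<inter> g ` {3/2<..<5/2} = {}" by (auto simp: g_eq)
    show "\<psi> (curve kinked (g 8)) = 0" "\<psi> (curve kinked (g 2)) = 0" by (simp_all add: psi)
    show "\<psi> ` curve kinked ` g ` {15/2<..<17/2} = {z \<in> ball 0 1. Im z = 0}"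
    proof (intro set_eqI iffI)
      fix z assume "z \<in> \<psi> ` curve kinked ` g ` {15/2<..<17/2}"
      then obtain u where u: "z = 2 * (kink u - 1)" "\<bar>u - 8\<bar> < 1/2" by (auto simp: psi abs_if)
      then have "z = of_real (2 * (u - 8))" using kink_at_crossing(2)[OF u(2)] by simp
      moreover have "\<bar>2 * (u - 8)\<bar> < 1" using u(2) unfolding abs_less_iff by auto
      ultimately show "z \<in> {z \<in> ball 0 1. Im z = 0}"
        by (metis (mono_tags, lifting) Im_complex_of_real mem_Collect_eq mem_ball_0 norm_of_real real_norm_def)
    next
      fix z :: complex assume z: "z \<in> {z \<in> ball 0 1. Im z = 0}"
      then have zr: "z = of_real (Re z)" by (simp add: complex_eq_iff)
      then have "\<bar>Re z\<bar> < 1" using z by (metis (mono_tags, lifting) mem_Collect_eq mem_ball_0 norm_of_real real_norm_def)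
      then have u: "\<bar>(8 + Re z / 2) - 8\<bar> < 1/2" by simp
      have "\<psi> (curve kinked (g (8 + Re z / 2))) = z"
        unfolding psi kink_at_crossing(2)[OF u] using zr by simp
      moreover have "8 + Re z / 2 \<in> {15/2<..<17/2}" using u by (auto simp: abs_if split: if_splits)
      ultimately show "z \<in> \<psi> ` curve kinked ` g ` {15/2<..<17/2}" by (metis imageI)
    qed
    show "\<psi> ` curve kinked ` g ` {3/2<..<5/2} = {z \<in> ball 0 1. Re z = 0}"
    proof (intro set_eqI iffI)
      fix z assume "z \<in> \<psi> ` curve kinked ` g ` {3/2<..<5/2}"
      then obtain u where u: "z = 2 * (kink u - 1)" "\<bar>u - 2\<bar> < 1/2" by (auto simp: psi abs_if)
      then have z: "z = \<i> * of_real (2 * (u - 2))" using kink_at_crossing(1)[OF u(2)] by simp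
      have "norm z = \<bar>2 * (u - 2)\<bar>" unfolding z norm_mult norm_of_real by simp
      moreover have "\<bar>2 * (u - 2)\<bar> < 1" using u(2) unfolding abs_less_iff by auto
      moreover have "Re z = 0" unfolding z by simp
      ultimately show "z \<in> {z \<in> ball 0 1. Re z = 0}" by simp
    next
      fix z :: complex assume z: "z \<in> {z \<in> ball 0 1. Re z = 0}"
      then have zr: "z = \<i> * of_real (Im z)" by (simp add: complex_eq_iff)
      then have "norm z = \<bar>Im z\<bar>" by (metis norm_ii norm_mult mult_1 norm_of_real)
      then have "\<bar>Im z\<bar> < 1" using z by simp
      then have u: "\<bar>(2 + Im z / 2) - 2\<bar> < 1/2" by simp
      have "\<psi> (curve kinked (g (2 + Im z / 2))) = z"
        unfolding psi kink_at_crossing(1)[OF u] using zr by simp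
      moreover have "2 + Im z / 2 \<in> {3/2<..<5/2}" using u by (auto simp: abs_if split: if_splits)
      ultimately show "z \<in> \<psi> ` curve kinked ` g ` {3/2<..<5/2}" by (metis imageI)
    qed
  qed (use un in auto)
qed

lemma crossing_ok_kinked: "crossing_ok kinked (\<tau> 1)"
proof -
  have pre: "{s \<in> source kinked. curve kinked s = \<tau> 1} = {g 2, g 8}"
  proof (intro set_eqI iffI)
    fix s assume s: "s \<in> {s \<in> source kinked. curve kinked s = \<tau> 1}"
    then have "s \<in> range g" using kinked_range[of s] by auto
    then obtain u where u: "s = g u" by blast
    then have k: "kink u = kink 2" "kink 2 = kink u" using s curve_kinked chi_eq by auto
    have "u = 2 \<or> u = 8"
      using kink_double_point[OF k(1)] kink_double_point[OF k(2)] by linarith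
    then show "s \<in> {g 2, g 8}" using u by auto
  qed (use g_source curve_kinked in auto)
  have "card {s \<in> source kinked. curve kinked s = \<tau> 1} = 2" unfolding pre by (simp add: g_eq)
  moreover have "transverse_at kinked s t \<and>
      (decor kinked s, decor kinked t) \<in> {(Over, Under), (Under, Over), (Virtual, Virtual)}"
    if "s \<in> source kinked" "t \<in> source kinked" "s \<noteq> t \<and> curve kinked s = \<tau> 1 \<and> curve kinked t = \<tau> 1" for s t
  proof -
    have "s \<in> {g 2, g 8}" "t \<in> {g 2, g 8}" using that pre by auto
    then show ?thesis using that transverse_kinked transverse_at_sym[OF transverse_kinked] decor_kinked by auto
  qed
  moreover have "\<exists>U. open U \<and> s \<in> U \<and> inj_on (curve kinked) (U \<inter> source kinked)"
    if "s \<in> source kinked" "curve kinked s = \<tau> 1" for s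
  proof -
    have "s \<in> {g 2, g 8}" using that pre by auto
    then obtain c where c: "s = g c" "c = 2 \<or> c = 8" by blast
    obtain T where T: "open T" "g ` {c - 1/2<..<c + 1/2} = source D \<inter> T"
      using open_g_image[of "{c - 1/2<..<c + 1/2}"] unfolding openin_open by auto
    have "s \<in> T" using c(1) T(2) by auto
    moreover have "inj_on (curve kinked) (T \<inter> source kinked)"
    proof (rule inj_onI)
      fix a b assume ab: "a \<in> T \<inter> source kinked" "b \<in> T \<inter> source kinked" "curve kinked a = curve kinked b"
      then have "a \<in> g ` {c - 1/2<..<c + 1/2}" "b \<in> g ` {c - 1/2<..<c + 1/2}" using T(2) by auto
      then obtain u v where uv: "a = g u" "b = g v" "u \<in> {c - 1/2<..<c + 1/2}" "v \<in> {c - 1/2<..<c + 1/2}" by auto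
      then have k: "kink u = kink v" using ab by (simp add: curve_kinked chi_eq)
      have "u = v"
        using kink_double_point[OF k] kink_double_point[OF k[symmetric]] uv(3,4) c(2) by force
      then show "a = b" using uv by simp
    qed
    ultimately show ?thesis using T(1) by blast
  qed
  ultimately show ?thesis unfolding crossing_ok_def by blast
qed

lemma kinked_diagram: "virtual_link_diagram kinked"
  and kinked_move: "generalized_reidemeister_move D kinked"
proof -
  have "crossings D \<inter> K = {}" using not_crossing by auto
  note * = R.virtual_kink[OF this K(3), of "\<tau> 1"]
  have "\<tau> 1 \<notin> frontier K" by (simp add: in_K)
  then show "virtual_link_diagram kinked" "generalized_reidemeister_move D kinked"
    using * crossings_kinked crossing_ok_kinked by (auto simp: kinked_def)
qed

lemma crossings_kinked_subset: "crossings kinked \<subseteq> insert (\<tau> 1) (crossings D)"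
proof
  fix x assume x: "x \<in> crossings kinked"
  show "x \<in> insert (\<tau> 1) (crossings D)"
  proof (cases "x \<in> K")
    case True then show ?thesis using x crossings_kinked by blast
  next
    case False
    then have "x \<notin> interior K" using interior_subset by blast
    then show ?thesis using crossings_agree_outside[OF R.agree] x by (simp add: kinked_def)
  qed
qed

end

section \<open>Simulating an H(n)-move by an H(n+1)-move\<close>

lemma cis_inj_on: "inj_on cis {0..<2 * pi}"
proof (rule inj_onI)
  have *: "Arg2pi (cis x) = x" if "x \<in> {0..<2 * pi}" for x
    using Arg2pi_exp[of "\<i> * of_real x"] that unfolding cis_conv_exp by simp
  fix x y assume "x \<in> {0..<2 * pi}" "y \<in> {0..<2 * pi}" "cis x = cis y"
  then show "x = y" using *[of x] *[of y] by metis
qed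

text \<open>
  To the right of the imaginary axis the kink and its mirror image are the same sets, traversed in opposite
  directions on the bracket between \<open>-\<i>\<close> and \<open>\<i>\<close>, and in the same direction on the final ray.
\<close>

lemma cnj_kink_flip: "0 \<le> u \<Longrightarrow> u \<le> 4 \<Longrightarrow> cnj (kink (4 - u)) = kink u"
  by (rule kink_cases[of u]) (auto simp: kink_eqs complex_eq_iff)

lemma cnj_kink_far: "7 \<le> u \<Longrightarrow> cnj (kink u) = kink u"
  by (rule kink_cases[of u]) (auto simp: complex_eq_iff)

lemma Re_kink_cases:
  "Re (kink u) \<le> 0 \<longleftrightarrow> u \<le> 0 \<or> 4 \<le> u \<and> u \<le> 7"
  using Re_kink_neg[of u] Re_kink_zero[of u] by linarith

lemma strandsD:
  assumes "strands D B k \<alpha>" "i < k" "t \<in> {0..1}"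
  shows "\<alpha> i t \<in> source D" "curve D (\<alpha> i t) \<in> B"
    "curve D (\<alpha> i t) \<in> frontier B \<longleftrightarrow> t = 0 \<or> t = 1"
proof -
  have un: "(\<Union>i<k. path_image (\<alpha> i)) = {s \<in> source D. curve D s \<in> B}"
    and fr: "\<forall>i<k. \<forall>t\<in>{0..1}. curve D (\<alpha> i t) \<in> frontier B \<longleftrightarrow> t = 0 \<or> t = 1"
    using assms(1) unfolding strands_def by blast+
  have "\<alpha> i t \<in> (\<Union>i<k. path_image (\<alpha> i))"
    using assms(2,3) by (auto simp: path_image_def intro!: bexI[of _ i])
  then show "\<alpha> i t \<in> source D" "curve D (\<alpha> i t) \<in> B" unfolding un by simp_all
  show "curve D (\<alpha> i t) \<in> frontier B \<longleftrightarrow> t = 0 \<or> t = 1" using fr assms(2,3) by simp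
qed

lemma strands_permute:
  assumes "strands D B k \<alpha>" "bij_betw \<pi> {..<k} {..<k}"
  shows "strands D B k (\<alpha> \<circ> \<pi>)"
proof -
  have \<pi>: "\<pi> i < k" if "i < k" for i using assms(2) that by (auto simp: bij_betw_def)
  have inj: "\<pi> i \<noteq> \<pi> j" if "i < k" "j < k" "i \<noteq> j" for i j
    using assms(2) that by (auto simp: bij_betw_def inj_on_def)
  have "(\<Union>i<k. path_image ((\<alpha> \<circ> \<pi>) i)) = (\<Union>i\<in>\<pi> ` {..<k}. path_image (\<alpha> i))" by simp
  also have "\<pi> ` {..<k} = {..<k}" using assms(2) by (simp add: bij_betw_def)
  finally show ?thesis using assms(1) \<pi> inj unfolding strands_def by simp
qed

text \<open>The left half plane is the part of the disk \<open>B\<close> in the chart, so the diagram leaves \<open>B\<close> at \<open>\<tau> 0\<close>.\<close>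

locale disk_chart = straight_chart D \<tau> g for D \<tau> g +
  fixes B :: "complex set"
  assumes closed_B: "closed B" and side: "\<tau> z \<in> B \<longleftrightarrow> Re z \<le> 0"
    and none: "crossings D \<inter> B = {}"
begin

lemma interior_side: "\<tau> z \<in> interior B \<longleftrightarrow> Re z < 0"
proof
  assume "Re z < 0"
  have "open (\<tau> ` {z. Re z < 0})"
    by (rule chart_open_image[OF cont inj]) (auto simp: open_halfspace_Re_lt)
  moreover have "\<tau> ` {z. Re z < 0} \<subseteq> B" by (rule image_subsetI) (simp add: side)
  ultimately have "\<tau> ` {z. Re z < 0} \<subseteq> interior B" by (intro interior_maximal)
  then show "\<tau> z \<in> interior B" using \<open>Re z < 0\<close> by blast
next
  assume z: "\<tau> z \<in> interior B"
  have "open (UNIV \<inter> \<tau> -` interior B)" by (rule continuous_open_preimage[OF cont]) auto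
  then obtain r where r: "r > 0" "ball z r \<subseteq> \<tau> -` interior B"
    using z open_contains_ball[of "\<tau> -` interior B"] by (metis Int_UNIV_left vimageI)
  have "z + of_real (r / 2) \<in> ball z r" using r(1) by (simp add: dist_norm)
  then have "\<tau> (z + of_real (r / 2)) \<in> B" using r(2) interior_subset by blast
  then show "Re z < 0" using side r(1) by simp
qed

lemma frontier_side: "\<tau> z \<in> frontier B \<longleftrightarrow> Re z = 0"
  using closed_B side[of z] interior_side[of z] by (auto simp: frontier_def)

lemma crossings_kinked_B: "crossings kinked \<inter> B = {}"
  using crossings_kinked_subset none side[of 1] by auto

text \<open>
  Only the strand end at \<open>\<tau> 0\<close> moves: its parameter \<open>g 0\<close> is now where the kink leaves \<open>B\<close> for
  the first time.
\<close>

lemma kinked_frontier: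
  assumes "s \<in> source D" "curve D s \<in> frontier B"
  shows "curve kinked s = (if curve D s = \<tau> 0 then \<tau> (- \<i>) else curve D s)"
proof (cases "s \<in> range g")
  case True
  then obtain u where u: "s = g u" by blast
  then have "u = 0" using assms(2) by (simp add: curve_g frontier_side)
  then show ?thesis using u by (simp add: curve_g curve_kinked)
next
  case False
  then have "curve D s \<noteq> \<tau> 0" using range_g assms(1) by force
  then show ?thesis using kinked_outside False by simp
qed

text \<open>
  Because the kink leaves the disk for the first time at the parameter \<open>0\<close>, as the real axis did, the
  parameter arcs of the old strands remain the same. The new strand is the piece of the kink between the times
  \<open>4\<close> and \<open>7\<close>, in either direction.
\<close>

lemma strands_kinked:
  assumes st: "strands D B n \<alpha>" and e: "e = (\<lambda>t. g (7 - 3 * t)) \<or> e = (\<lambda>t. g (4 + 3 * t))"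
  shows "strands kinked B (Suc n) (\<alpha>(n := e))"
proof -
  have pre: "(\<Union>i<n. path_image (\<alpha> i)) = {s \<in> source D. curve D s \<in> B}"
    using st unfolding strands_def by blast
  note fr = strandsD(3)[OF st]
  have arc_e: "arc e"
    unfolding arc_def path_def
  proof
    show "continuous_on {0..1} e" using e
      by (elim disjE) (auto intro!: continuous_on_compose2[OF cont_g] continuous_intros)
    show "inj_on e {0..1}" using e by (auto simp: inj_on_def g_eq)
  qed
  have im_e: "path_image e = g ` {4..7}"
  proof (intro set_eqI iffI)
    fix s assume "s \<in> path_image e"
    then show "s \<in> g ` {4..7}" using e by (auto simp: path_image_def)
  next
    fix s assume "s \<in> g ` {4..7}"
    then obtain u where u: "s = g u" "4 \<le> u" "u \<le> 7" by auto
    have "7 - 3 * ((7 - u) / 3) = u" "4 + 3 * ((u - 4) / 3) = u" by (simp_all add: field_simps)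
    with u have "s = g (7 - 3 * ((7 - u) / 3))" "(7 - u) / 3 \<in> {0..1}"
      "s = g (4 + 3 * ((u - 4) / 3))" "(u - 4) / 3 \<in> {0..1}" by simp_all
    then show "s \<in> path_image e" using e unfolding path_image_def by blast
  qed
  have low: "u \<le> 0" if "g u \<in> path_image (\<alpha> i)" "i < n" for i u
  proof -
    have "g u \<in> {s \<in> source D. curve D s \<in> B}" using that pre by blast
    then show ?thesis by (simp add: curve_g side)
  qed
  have disj: "path_image (\<alpha> i) \<inter> path_image e = {}" if "i < n" for i
    unfolding im_e using low[OF _ that] by force
  have un: "{s \<in> source kinked. curve kinked s \<in> B} = {s \<in> source D. curve D s \<in> B} \<union> g ` {4..7}"
  proof (intro set_eqI)
    fix s
    show "s \<in> {s \<in> source kinked. curve kinked s \<in> B} \<longleftrightarrow>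
      s \<in> {s \<in> source D. curve D s \<in> B} \<union> g ` {4..7}"
    proof (cases "s \<in> range g")
      case True
      then obtain u where u: "s = g u" by blast
      have "g u \<in> g ` {4..7} \<longleftrightarrow> 4 \<le> u \<and> u \<le> 7" by (auto simp: g_eq)
      then show ?thesis unfolding u
        using Re_kink_cases[of u] by (simp add: g_source curve_kinked curve_g side)
    next
      case False
      then show ?thesis using kinked_outside(1)[OF False] by auto
    qed
  qed
  have fr_old: "curve kinked (\<alpha> i t) \<in> frontier B \<longleftrightarrow> t = 0 \<or> t = 1" if it: "i < n" "t \<in> {0..1}" for i t
  proof (cases "\<alpha> i t \<in> range g")
    case True
    then obtain u where u: "\<alpha> i t = g u" by blast
    have "\<alpha> i t \<in> path_image (\<alpha> i)" unfolding path_image_def using it(2) by (rule imageI)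
    then have "u \<le> 0" using low[OF _ it(1)] u by simp
    then have "Re (kink u) = 0 \<longleftrightarrow> u = 0" by (auto simp: Re_kink_zero)
    then have "curve kinked (\<alpha> i t) \<in> frontier B \<longleftrightarrow> curve D (\<alpha> i t) \<in> frontier B"
      by (simp add: u curve_kinked curve_g frontier_side)
    then show ?thesis using fr it by simp
  next
    case False
    then show ?thesis using kinked_outside(1)[OF False] fr it by simp
  qed
  have fr_new: "curve kinked (e t) \<in> frontier B \<longleftrightarrow> t = 0 \<or> t = 1" if "t \<in> {0..1}" for t
    using e that by (elim disjE) (auto simp: curve_kinked frontier_side Re_kink_zero)
  show ?thesis
    unfolding strands_def
  proof (intro conjI allI impI ballI)
    show "arc ((\<alpha>(n := e)) i)" if "i < Suc n" for i
      using st that arc_e by (auto simp: strands_def less_Suc_eq)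
    show "path_image ((\<alpha>(n := e)) i) \<inter> path_image ((\<alpha>(n := e)) j) = {}"
      if "i < Suc n" "j < Suc n" "i \<noteq> j" for i j
    proof -
      note ij = that
      have old: "path_image (\<alpha> i) \<inter> path_image (\<alpha> j) = {}" if "i < n" "j < n"
        using st that \<open>i \<noteq> j\<close> unfolding strands_def by blast
      consider "i < n" "j < n" | "i < n" "j = n" | "i = n" "j < n" using ij by linarith
      then show ?thesis
      proof cases
        case 1 then show ?thesis using old by simp
      next
        case 2 then show ?thesis using disj[of i] by simp
      next
        case 3 then show ?thesis using disj[of j] by (simp add: Int_commute)
      qed
    qed
    show "(\<Union>i<Suc n. path_image ((\<alpha>(n := e)) i)) = {s \<in> source kinked. curve kinked s \<in> B}"
      unfolding un pre[symmetric] im_e[symmetric] by (auto simp: lessThan_Suc)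
    show "curve kinked ((\<alpha>(n := e)) i t) \<in> frontier B \<longleftrightarrow> t = 0 \<or> t = 1"
      if "i < Suc n" "t \<in> {0..1}" for i t
      using that fr_old[of i t] fr_new[of t] by (cases "i = n") auto
    show "crossings kinked \<inter> frontier B = {}"
      using crossings_kinked_B closed_B by (auto simp: frontier_def)
  qed
qed

lemma outside_kinked:
  assumes "s \<in> source kinked" "curve kinked s \<notin> interior B"
  shows "curve D s \<notin> interior B"
    "(\<exists>u. s = g u \<and> 0 \<le> u \<and> u \<le> 4) \<or> (\<exists>u. s = g u \<and> 7 \<le> u) \<or> s \<notin> range g"
proof -
  have "curve D s \<notin> interior B \<and>
    ((\<exists>u. s = g u \<and> 0 \<le> u \<and> u \<le> 4) \<or> (\<exists>u. s = g u \<and> 7 \<le> u) \<or> s \<notin> range g)"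
  proof (cases "s \<in> range g")
    case True
    then obtain u where u: "s = g u" by blast
    then have "0 \<le> u \<and> u \<le> 4 \<or> 7 \<le> u"
      using assms(2) Re_kink_neg[of u] by (auto simp: curve_kinked interior_side)
    then show ?thesis unfolding u curve_g interior_side by auto
  next
    case False
    then show ?thesis using assms kinked_outside(1)[OF False] by simp
  qed
  then show "curve D s \<notin> interior B"
    "(\<exists>u. s = g u \<and> 0 \<le> u \<and> u \<le> 4) \<or> (\<exists>u. s = g u \<and> 7 \<le> u) \<or> s \<notin> range g" by auto
qed

lemma outside_kinkedI: "0 \<le> u \<and> u \<le> 4 \<or> 7 \<le> u \<Longrightarrow> curve kinked (g u) \<notin> interior B"
  using Re_kink_neg[of u] by (auto simp: curve_kinked interior_side)

end

text \<open>
  Both diagrams receive a kink, the second one the mirror image. Outside \<open>B\<close> the two kinks are the same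
  set, so the parameters are matched as before except on the bracket, which is traversed backwards.
\<close>

lemma kinked_agree_outside:
  assumes "disk_chart D \<tau> g B" "disk_chart D' (\<tau> \<circ> cnj) g' B" "agree_outside B D D'"
  shows "agree_outside B (straight_chart.kinked D \<tau> g) (straight_chart.kinked D' (\<tau> \<circ> cnj) g')"
proof -
  interpret d: disk_chart D \<tau> g B by fact
  interpret d': disk_chart D' "\<tau> \<circ> cnj" g' B by fact
  obtain h k where hk: "homeomorphism {s \<in> source D. curve D s \<notin> interior B}
      {s \<in> source D'. curve D' s \<notin> interior B} h k"
    and c: "\<forall>s\<in>source D. curve D s \<notin> interior B \<longrightarrow>
      curve D' (h s) = curve D s \<and> decor D' (h s) = decor D s"
    using assms(3) unfolding agree_outside_def by blast
  define X where "X = {s \<in> source D. curve D s \<notin> interior B}"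
  define X' where "X' = {s \<in> source D'. curve D' s \<notin> interior B}"
  define Y where "Y = {s \<in> source D. curve d.kinked s \<notin> interior B}"
  define Y' where "Y' = {s \<in> source D'. curve d'.kinked s \<notin> interior B}"
  have hX: "homeomorphism X X' h k" using hk by (simp add: X_def X'_def)
  have h: "h s \<in> X'" "k (h s) = s" "curve D' (h s) = curve D s" "decor D' (h s) = decor D s" if "s \<in> X" for s
    using homeomorphism_mem1[OF hX that] homeomorphism_apply1[OF hX that] c that by (auto simp: X_def)
  have k: "k s \<in> X" "h (k s) = s" if "s \<in> X'" for s
    using homeomorphism_mem2[OF hX that] homeomorphism_apply2[OF hX that] by auto
  have g'_curve: "curve D' (g' u) = \<tau> (of_real u)" for u using d'.curve_g[of u] by simp
  have tau_range: "range (\<tau> \<circ> cnj) = range \<tau>"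
    by (metis comp_apply complex_cnj_cnj image_comp surjI)
  have g'_range: "range g' = {s \<in> source D'. curve D' s \<in> range \<tau>}" using d'.range_g tau_range by simp
  have hg: "h (g u) = g' u" if "0 \<le> u" for u
  proof -
    have "g u \<in> X" using that by (simp add: X_def d.g_source d.curve_g d.interior_side)
    note hh = h[OF this]
    then have "h (g u) \<in> range g'" using g'_range by (simp add: X'_def d.curve_g)
    then obtain v where v: "h (g u) = g' v" by blast
    then have "\<tau> (of_real v) = \<tau> (of_real u)" using hh g'_curve d.curve_g by simp
    then show ?thesis using v by (simp add: d.chi_eq)
  qed
  have hout: "h s \<notin> range g'" if "s \<in> X" "s \<notin> range g" for s
    using h[OF that(1)] that d.range_g g'_range by (auto simp: X_def)
  have kout: "k s \<notin> range g" if s: "s \<in> X'" "s \<notin> range g'" for s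
  proof
    assume r: "k s \<in> range g"
    have "curve D' s = curve D (k s)" using h(3)[of "k s"] k[OF s(1)] by simp
    then have "s \<in> range g'" using r d.range_g g'_range s(1) by (auto simp: X'_def)
    then show False using s by blast
  qed
  \<comment> \<open>the old correspondence \<open>h\<close>, reversed on the bracket\<close>
  define f where "f s = (if s \<in> g ` {0..4} then g' (4 - Re (inv \<tau> (curve D s))) else h s)" for s
  have inv: "inv \<tau> (\<tau> z) = z" for z using d.inj by simp
  have f1: "f (g u) = g' (4 - u)" if "0 \<le> u" "u \<le> 4" for u
    using that by (simp add: f_def d.curve_g inv)
  have f2: "f (g u) = g' u" if "7 \<le> u" for u
  proof -
    have "g u \<notin> g ` {0..4}" using that by (auto simp: d.g_eq)
    then show ?thesis using hg[of u] that by (simp add: f_def)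
  qed
  have f3: "f s = h s" if "s \<notin> range g" for s using that by (auto simp: f_def)
  have YX: "Y \<subseteq> X" using d.outside_kinked(1) by (auto simp: X_def Y_def)
  have Y_cases: "(\<exists>u. s = g u \<and> 0 \<le> u \<and> u \<le> 4) \<or> (\<exists>u. s = g u \<and> 7 \<le> u) \<or> s \<notin> range g \<and> s \<in> X"
    if "s \<in> Y" for s
    using d.outside_kinked(2)[of s] that YX by (auto simp: Y_def)
  have Y'_cases: "(\<exists>u. s = g' u \<and> 0 \<le> u \<and> u \<le> 4) \<or> (\<exists>u. s = g' u \<and> 7 \<le> u) \<or> s \<notin> range g' \<and> s \<in> X'"
    if "s \<in> Y'" for s
    using d'.outside_kinked[of s] that by (auto simp: Y'_def X'_def)
  have gY: "g u \<in> Y" if "0 \<le> u \<and> u \<le> 4 \<or> 7 \<le> u" for u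
    using d.outside_kinkedI[OF that] d.g_source by (simp add: Y_def)
  have gY': "g' u \<in> Y'" if "0 \<le> u \<and> u \<le> 4 \<or> 7 \<le> u" for u
    using d'.outside_kinkedI[OF that] d'.g_source by (simp add: Y'_def)
  have vals: "f s \<in> Y' \<and> curve d'.kinked (f s) = curve d.kinked s \<and> decor d'.kinked (f s) = decor d.kinked s"
    if s: "s \<in> Y" for s
    using Y_cases[OF s]
  proof (elim disjE exE conjE)
    fix u assume u: "s = g u" "0 \<le> u" "u \<le> 4"
    show ?thesis unfolding u(1) f1[OF u(2,3)]
      using gY'[of "4 - u"] u cnj_kink_flip[OF u(2,3)]
      by (auto simp: d.curve_kinked d'.curve_kinked d.decor_kinked d'.decor_kinked)
  next
    fix u assume u: "s = g u" "7 \<le> u"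
    show ?thesis unfolding u(1) f2[OF u(2)]
      using gY'[of u] u cnj_kink_far[OF u(2)]
      by (auto simp: d.curve_kinked d'.curve_kinked d.decor_kinked d'.decor_kinked)
  next
    assume a: "s \<notin> range g" "s \<in> X"
    show ?thesis unfolding f3[OF a(1)]
      using h[OF a(2)] d.kinked_outside[OF a(1)] d'.kinked_outside[OF hout[OF a(2,1)]]
      by (auto simp: Y'_def X'_def X_def a)
  qed
  have inj_f: "inj_on f Y"
  proof (rule inj_on_inverseI)
    let ?k = "\<lambda>s. if s \<in> g' ` {0..4} then g (4 - Re (inv \<tau> (curve D' s))) else k s"
    fix s assume s: "s \<in> Y"
    from Y_cases[OF s] show "?k (f s) = s"
    proof (elim disjE exE conjE)
      fix u assume u: "s = g u" "0 \<le> u" "u \<le> 4"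
      have "g' (4 - u) \<in> g' ` {0..4}" using u by auto
      then show ?thesis unfolding u(1) f1[OF u(2,3)] by (simp only: if_True g'_curve inv) simp
    next
      fix u assume u: "s = g u" "7 \<le> u"
      have "g' u \<notin> g' ` {0..4}" using u by (auto simp: d'.g_eq)
      moreover have "g u \<in> X" using gY[of u] u YX by auto
      then have "k (g' u) = g u" using h(2)[of "g u"] hg[of u] u by simp
      ultimately show ?thesis unfolding u(1) f2[OF u(2)] by simp
    next
      assume a: "s \<notin> range g" "s \<in> X"
      have "h s \<notin> g' ` {0..4}" using hout[OF a(2,1)] by blast
      then show ?thesis unfolding f3[OF a(1)] using h(2)[OF a(2)] by simp
    qed
  qed
  have surj_f: "f ` Y = Y'"
  proof
    show "f ` Y \<subseteq> Y'" using vals by blast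
    show "Y' \<subseteq> f ` Y"
    proof
      fix s assume s: "s \<in> Y'"
      from Y'_cases[OF s] show "s \<in> f ` Y"
      proof (elim disjE exE conjE)
        fix u assume u: "s = g' u" "0 \<le> u" "u \<le> 4"
        then have "s = f (g (4 - u))" "g (4 - u) \<in> Y" using f1[of "4 - u"] gY[of "4 - u"] by auto
        then show ?thesis by blast
      next
        fix u assume u: "s = g' u" "7 \<le> u"
        then have "s = f (g u)" "g u \<in> Y" using f2[of "u"] gY[of "u"] by auto
        then show ?thesis by blast
      next
        assume a: "s \<notin> range g'" "s \<in> X'"
        note ko = kout[OF a(2,1)]
        have "curve d.kinked (k s) = curve D (k s)" using d.kinked_outside(1)[OF ko] .
        then have "k s \<in> Y" using k(1)[OF a(2)] by (auto simp: X_def Y_def)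
        moreover have "f (k s) = s" using f3[OF ko] k(2)[OF a(2)] by simp
        ultimately show ?thesis by (metis imageI)
      qed
    qed
  qed
  have compY: "compact Y"
  proof -
    have "closedin (top_of_set (source D)) Y"
      using continuous_closedin_preimage[OF d.continuous_kinked, of "- interior B"]
      by (simp add: Y_def vimage_def Int_def closed_Compl)
    then show ?thesis using compact_source closedin_compact by blast
  qed
  have cont_f: "continuous_on Y f"
  proof -
    obtain T where T: "open T" "g ` {-1<..<5} = source D \<inter> T"
      using d.open_g_image[of "{-1<..<5}"] unfolding openin_open by auto
    define A where "A = g ` {0..4}"
    define C where "C = Y - T"
    have clA: "closed A" unfolding A_def
      by (intro compact_imp_closed compact_continuous_image continuous_on_subset[OF d.cont_g]) auto
    have clC: "closed C" unfolding C_def using compY T(1) by (simp add: closed_Diff compact_imp_closed)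
    have A_Y: "A \<subseteq> Y" using gY by (auto simp: A_def)
    have un: "Y = A \<union> C"
    proof
      show "Y \<subseteq> A \<union> C"
      proof
        fix s assume s: "s \<in> Y"
        show "s \<in> A \<union> C"
        proof (cases "s \<in> T")
          case True
          then have "s \<in> g ` {-1<..<5}" using T(2) s by (auto simp: Y_def)
          then obtain u where u: "s = g u" "-1 < u" "u < 5" by auto
          have "(0 \<le> u \<and> u \<le> 4) \<or> 7 \<le> u" using Y_cases[OF s] u(1) by (auto simp: d.g_eq)
          then show ?thesis using u by (auto simp: A_def)
        qed (use s in \<open>auto simp: C_def\<close>)
      qed
    qed (use A_Y in \<open>auto simp: C_def\<close>)
    have cA: "continuous_on A f"
    proof -
      have "continuous_on (\<tau> ` UNIV) (inv \<tau>)"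
        by (rule continuous_on_inverse_open[OF open_UNIV d.cont]) (use inv in auto)
      then have ci: "continuous_on (range \<tau>) (inv \<tau>)" by simp
      have cD: "continuous_on A (curve D)"
        by (rule continuous_on_subset[of "source D"])
          (use d.D A_Y in \<open>auto simp: virtual_link_diagram_def generic_immersion_def Y_def\<close>)
      have "curve D ` A \<subseteq> range \<tau>" by (auto simp: A_def d.curve_g)
      then have "continuous_on A (\<lambda>s. inv \<tau> (curve D s))"
        by (rule continuous_on_compose2[OF ci cD])
      then have "continuous_on A (\<lambda>s. 4 - Re (inv \<tau> (curve D s)))" by (intro continuous_intros)
      then have "continuous_on A (\<lambda>s. g' (4 - Re (inv \<tau> (curve D s))))"
        by (rule continuous_on_compose2[OF d'.cont_g]) auto
      then show ?thesis by (rule continuous_on_eq) (auto simp: f_def A_def)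
    qed
    have cC: "continuous_on C f"
    proof -
      have "continuous_on C h"
        by (rule continuous_on_subset[OF homeomorphism_cont1[OF hX]]) (use YX in \<open>auto simp: C_def\<close>)
      moreover have "f s = h s" if "s \<in> C" for s
      proof -
        have "s \<notin> g ` {0..4}"
        proof
          assume "s \<in> g ` {0..4}"
          then have "s \<in> g ` {-1<..<5}" by auto
          then show False using T(2) that by (auto simp: C_def)
        qed
        then show ?thesis by (simp add: f_def)
      qed
      ultimately show ?thesis by (metis continuous_on_eq)
    qed
    show ?thesis unfolding un
      by (rule continuous_on_Un_local[OF _ _ cA cC]) (auto intro: closed_subset clA clC)
  qed
  obtain k2 where "homeomorphism Y Y' f k2"
    using homeomorphism_compact[OF compY cont_f surj_f inj_f] by blast
  then show ?thesis unfolding agree_outside_def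
    using vals by (intro exI[of _ f] exI[of _ k2]) (auto simp: Y_def Y'_def)
qed

text \<open>
  An H(n)-move together with a chart around the endpoint \<open>p (2 * n - 1)\<close>: the disk is the left half plane,
  both diagrams follow the real axis, and going up the imaginary axis means increasing the angle \<open>ang\<close> on the
  boundary of the disk. The range of \<open>ang\<close> lies beyond all other endpoints, so that new endpoints on the
  imaginary axis continue the cyclic order.
\<close>

locale extendable_H_move =
  fixes n :: nat and D D' :: vdiagram and B :: "complex set" and \<phi> \<phi>' :: "complex \<Rightarrow> complex"
    and \<theta> :: "nat \<Rightarrow> real" and \<alpha> \<alpha>' :: "nat \<Rightarrow> real \<Rightarrow> nat \<times> complex"
    and \<tau> :: "complex \<Rightarrow> complex" and ang :: "real \<Rightarrow> real" and g g' :: "real \<Rightarrow> nat \<times> complex"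
  assumes n: "n \<ge> 1"
    and disk: "homeomorphism (cball 0 1) B \<phi> \<phi>'"
    and agree: "agree_outside B D D'"
    and mono: "strict_mono_on {..<2 * n} \<theta>" and bounds: "\<And>j. j < 2 * n \<Longrightarrow> 0 \<le> \<theta> j \<and> \<theta> j < 2 * pi"
    and strands: "strands D B n \<alpha>" "strands D' B n \<alpha>'"
    and ends: "\<And>i. i < n \<Longrightarrow> curve D (\<alpha> i 0) = \<phi> (cis (\<theta> (2 * i)))"
      "\<And>i. i < n \<Longrightarrow> curve D (\<alpha> i 1) = \<phi> (cis (\<theta> (2 * i + 1)))"
      "\<And>i. i < n \<Longrightarrow> curve D' (\<alpha>' i 0) = \<phi> (cis (\<theta> (2 * i + 1)))"
      "\<And>i. i < n \<Longrightarrow> curve D' (\<alpha>' i 1) = \<phi> (cis (\<theta> ((2 * i + 2) mod (2 * n))))"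
    and ncomp: "ncomp D' = ncomp D"
    and charts: "disk_chart D \<tau> g B" "disk_chart D' \<tau> g' B"
    and ang: "strict_mono ang" "\<And>y. \<tau> (Complex 0 y) = \<phi> (cis (ang y))" "ang 0 = \<theta> (2 * n - 1)"
      "\<And>y. \<theta> (2 * n - 2) < ang y \<and> ang y < 2 * pi"
begin

lemma H_move: "H_move n D D'"
proof -
  interpret d: disk_chart D \<tau> g B by (rule charts)
  interpret d': disk_chart D' \<tau> g' B by (rule charts)
  show ?thesis unfolding H_move_def
    using d.D d'.D ncomp disk agree mono bounds strands ends d.none d'.none
    by (intro conjI exI[of _ B] exI[of _ \<phi>] exI[of _ \<phi>'] exI[of _ \<theta>] exI[of _ "\<lambda>j. \<phi> (cis (\<theta> j))"]
        exI[of _ \<alpha>] exI[of _ \<alpha>']) auto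
qed

end

text \<open>An increasing homeomorphism of the line onto the interval from \<open>-1/2\<close> to \<open>1/2\<close>, used to pass to a smaller chart.\<close>

definition squash :: "real \<Rightarrow> real" where "squash t = t / (2 * (1 + \<bar>t\<bar>))"

lemma squash_bound: "\<bar>squash t\<bar> < 1/2"
  by (simp add: squash_def abs_mult field_simps)

lemma squash_sign: "squash t \<le> 0 \<longleftrightarrow> t \<le> 0" "squash 0 = 0"
  by (auto simp: squash_def divide_le_0_iff)

lemma squash_unsquash:
  assumes "\<bar>x\<bar> < 1/2" shows "squash (2 * x / (1 - 2 * \<bar>x\<bar>)) = x"
proof -
  define d where "d = 1 - 2 * \<bar>x\<bar>"
  have d: "d > 0" "2 * \<bar>x\<bar> = 1 - d" using assms by (auto simp: d_def)
  have "1 + \<bar>2 * x / d\<bar> = 1 / d" using d by (simp add: abs_mult field_simps)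
  then have "squash (2 * x / d) = x" using d(1) by (simp add: squash_def)
  then show ?thesis by (simp add: d_def)
qed

lemma squash_mono: "strict_mono squash"
proof (rule strict_monoI)
  fix x y :: real assume "x < y"
  have "x * (1 + \<bar>y\<bar>) < y * (1 + \<bar>x\<bar>)"
  proof (cases "0 \<le> x")
    case True then show ?thesis using \<open>x < y\<close> by (simp add: algebra_simps)
  next
    case False
    show ?thesis
    proof (cases "0 \<le> y")
      case True
      then have "x * (1 + \<bar>y\<bar>) < 0" "0 \<le> y * (1 + \<bar>x\<bar>)" using False by (auto simp: mult_neg_pos)
      then show ?thesis by linarith
    next
      case neg: False
      then show ?thesis using False \<open>x < y\<close> by (simp add: algebra_simps)
    qed
  qed
  moreover have "0 < 1 + \<bar>x\<bar>" "0 < 1 + \<bar>y\<bar>" by auto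
  ultimately have "x / (1 + \<bar>x\<bar>) < y / (1 + \<bar>y\<bar>)"
    by (simp add: pos_divide_less_eq pos_less_divide_eq)
  moreover have "squash t = t / (1 + \<bar>t\<bar>) / 2" for t by (simp add: squash_def)
  ultimately show "squash x < squash y" by (simp only: divide_strict_right_mono zero_less_numeral)
qed

lemma continuous_squash: "continuous_on S squash"
  unfolding squash_def by (intro continuous_intros) (auto simp: add_nonneg_eq_0_iff)

context extendable_H_move
begin

interpretation d: disk_chart D \<tau> g B by (rule charts)
interpretation d': disk_chart D' \<tau> g' B by (rule charts)

lemma charts_mirror: "disk_chart D' (\<tau> \<circ> cnj) g' B"
proof -
  interpret m: straight_chart D' "\<tau> \<circ> cnj" g' by (rule d'.mirror)
  show ?thesis by unfold_locales (use d'.closed_B d'.side d'.none in auto)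
qed

interpretation m: disk_chart D' "\<tau> \<circ> cnj" g' B by (rule charts_mirror)

lemma ang_less: "ang x < ang y \<longleftrightarrow> x < y"
  using ang(1) by (rule strict_mono_less)

lemma points_eq:
  assumes "i < 2 * n" "j < 2 * n" "\<phi> (cis (\<theta> i)) = \<phi> (cis (\<theta> j))" shows "i = j"
proof -
  have "\<phi>' (\<phi> (cis (\<theta> k))) = cis (\<theta> k)" for k by (rule homeomorphism_apply1[OF disk]) simp
  then have "cis (\<theta> i) = cis (\<theta> j)" using assms(3) by metis
  then have "\<theta> i = \<theta> j" by (rule inj_onD[OF cis_inj_on]) (use bounds assms in auto)
  then show ?thesis using strict_mono_on_eqD[OF mono] assms by auto
qed

lemma last_point: "\<tau> 0 = \<phi> (cis (\<theta> (2 * n - 1)))"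
proof -
  have "Complex 0 0 = 0" by (simp add: complex_eq_iff)
  then show ?thesis using ang(2)[of 0] ang(3) by metis
qed

lemma ends_frontier:
  assumes "i < n" "t = 0 \<or> t = 1"
  shows "\<alpha> i t \<in> source D" "curve D (\<alpha> i t) \<in> frontier B"
    "\<alpha>' i t \<in> source D'" "curve D' (\<alpha>' i t) \<in> frontier B"
proof -
  have t: "t \<in> {0..1}" using assms by auto
  show "\<alpha> i t \<in> source D" "curve D (\<alpha> i t) \<in> frontier B"
    "\<alpha>' i t \<in> source D'" "curve D' (\<alpha>' i t) \<in> frontier B"
    using strandsD[OF strands(1) assms(1) t] strandsD[OF strands(2) assms(1) t] assms(2) by simp_all
qed

text \<open>
  The data of the H(n+1)-move. The endpoint \<open>p (2 * n - 1)\<close> at height \<open>0\<close> on the imaginary axis is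
  replaced by three endpoints at the heights \<open>-1\<close>, \<open>0\<close> and \<open>1\<close>. In the first diagram the new strand
  joins the last two of them. In the second one, with the mirrored kink, it joins the first two, and the old last
  strand starts at height \<open>1\<close>; since strands are numbered by their endpoints, these two are exchanged. The
  new chart is centred at height \<open>1\<close>, where both kinks are straight.
\<close>

definition "\<theta>2 j = (if j < 2 * n - 1 then \<theta> j else ang (real j - 2 * real n))"
definition "\<alpha>2 = \<alpha>(n := (\<lambda>t. g (7 - 3 * t)))"
definition "\<alpha>2' = \<alpha>'(n := (\<lambda>t. g' (4 + 3 * t))) \<circ> (\<lambda>i. if i = n - 1 then n else if i = n then n - 1 else i)"
definition "\<tau>2 z = \<tau> (Complex (squash (Re z)) (1 + squash (Im z)))"

lemma \<theta>2_simps: "j < 2 * n - 1 \<Longrightarrow> \<theta>2 j = \<theta> j" "\<theta>2 (2 * n - 1) = ang (-1)"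
  "\<theta>2 (2 * n) = ang 0" "\<theta>2 (2 * n + 1) = ang 1"
proof -
  have "\<not> 2 * n < 2 * n - 1" "\<not> 2 * n + 1 < 2 * n - 1" by linarith+
  then show "j < 2 * n - 1 \<Longrightarrow> \<theta>2 j = \<theta> j" "\<theta>2 (2 * n - 1) = ang (-1)"
    "\<theta>2 (2 * n) = ang 0" "\<theta>2 (2 * n + 1) = ang 1"
    using n unfolding \<theta>2_def by (simp_all add: of_nat_diff)
qed

lemma \<theta>2_points: "\<phi> (cis (\<theta>2 (2 * n - 1))) = \<tau> (- \<i>)" "\<phi> (cis (\<theta>2 (2 * n))) = \<tau> 0"
  "\<phi> (cis (\<theta>2 (2 * n + 1))) = \<tau> \<i>"
  using ang(2)[of "-1"] ang(2)[of 0] ang(2)[of 1] unfolding \<theta>2_simps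
  by (simp_all add: Complex_eq)

lemma \<theta>2_mono: "strict_mono_on {..<2 * Suc n} \<theta>2"
proof (rule strict_mono_onI)
  fix i j assume ij: "i \<in> {..<2 * Suc n}" "j \<in> {..<2 * Suc n}" "i < j"
  consider "j < 2 * n - 1" | "i < 2 * n - 1" "2 * n - 1 \<le> j" | "2 * n - 1 \<le> i" using ij(3) by linarith
  then show "\<theta>2 i < \<theta>2 j"
  proof cases
    case 1
    then show ?thesis using strict_mono_onD[OF mono, of i j] ij by (simp add: \<theta>2_def)
  next
    case 2
    have "\<theta> i \<le> \<theta> (2 * n - 2)"
      using strict_mono_on_leD[OF mono, of i "2 * n - 2"] 2 n by auto
    then show ?thesis using ang(4)[of "real j - 2 * real n"] 2 by (simp add: \<theta>2_def)
  next
    case 3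
    then show ?thesis using ij by (simp add: \<theta>2_def ang_less)
  qed
qed

lemma \<theta>2_bounds: assumes "j < 2 * Suc n" shows "0 \<le> \<theta>2 j \<and> \<theta>2 j < 2 * pi"
proof (cases "j < 2 * n - 1")
  case True
  then show ?thesis using bounds[of j] by (simp add: \<theta>2_def)
next
  case False
  have "0 \<le> \<theta> (2 * n - 2)" using bounds[of "2 * n - 2"] n by simp
  then show ?thesis using ang(4)[of "real j - 2 * real n"] False by (simp add: \<theta>2_def)
qed

lemma end_kinked:
  assumes "i < n" "t = 0 \<or> t = 1"
  shows "curve d.kinked (\<alpha> i t) = (if curve D (\<alpha> i t) = \<tau> 0 then \<tau> (- \<i>) else curve D (\<alpha> i t))"
    "curve m.kinked (\<alpha>' i t) = (if curve D' (\<alpha>' i t) = \<tau> 0 then \<tau> \<i> else curve D' (\<alpha>' i t))"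
  using d.kinked_frontier[OF ends_frontier(1,2)[OF assms]]
    m.kinked_frontier[OF ends_frontier(3,4)[OF assms]] by auto

lemma \<tau>2_range: "w \<in> range \<tau>2 \<longleftrightarrow> (\<exists>z. w = \<tau> z \<and> \<bar>Re z\<bar> < 1/2 \<and> \<bar>Im z - 1\<bar> < 1/2)"
proof
  assume "w \<in> range \<tau>2"
  then show "\<exists>z. w = \<tau> z \<and> \<bar>Re z\<bar> < 1/2 \<and> \<bar>Im z - 1\<bar> < 1/2"
    using squash_bound unfolding \<tau>2_def by fastforce
next
  assume "\<exists>z. w = \<tau> z \<and> \<bar>Re z\<bar> < 1/2 \<and> \<bar>Im z - 1\<bar> < 1/2"
  then obtain z where z: "w = \<tau> z" "\<bar>Re z\<bar> < 1/2" "\<bar>Im z - 1\<bar> < 1/2" by blast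
  obtain x y where "squash x = Re z" "squash y = Im z - 1"
    using squash_unsquash[OF z(2)] squash_unsquash[OF z(3)] by blast
  then have "w = \<tau>2 (Complex x y)" using z(1) by (simp add: \<tau>2_def complex.collapse)
  then show "w \<in> range \<tau>2" by blast
qed

lemma \<tau>2_cont: "continuous_on UNIV \<tau>2"
  unfolding \<tau>2_def Complex_eq
  by (intro continuous_on_compose2[OF d.cont] continuous_on_compose2[OF continuous_squash[of UNIV]] continuous_intros) auto

lemma \<tau>2_inj: "inj \<tau>2"
proof (rule injI)
  fix z w assume "\<tau>2 z = \<tau>2 w"
  then have "squash (Re z) = squash (Re w)" "squash (Im z) = squash (Im w)"
    by (simp_all add: \<tau>2_def d.chi_eq)
  then show "z = w" using strict_mono_eq[OF squash_mono] by (simp add: complex_eq_iff)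
qed

lemma new_chart: "disk_chart d.kinked \<tau>2 (\<lambda>v. g (4 - squash v)) B"
proof
  show "virtual_link_diagram d.kinked" by (rule d.kinked_diagram)
  show "continuous_on UNIV \<tau>2" "inj \<tau>2" by (rule \<tau>2_cont \<tau>2_inj)+
  show "continuous_on UNIV (\<lambda>v. g (4 - squash v))"
    by (intro continuous_on_compose2[OF d.cont_g] continuous_intros continuous_squash) auto
  show "range (\<lambda>v. g (4 - squash v)) = {s \<in> source d.kinked. curve d.kinked s \<in> range \<tau>2}"
  proof (intro set_eqI iffI)
    fix s assume "s \<in> range (\<lambda>v. g (4 - squash v))"
    then obtain v where v: "s = g (4 - squash v)" by blast
    have "\<bar>(4 - squash v) - 4\<bar> < 1/2" using squash_bound[of v] by simp
    then have "curve d.kinked s \<in> range \<tau>2"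
      unfolding \<tau>2_range v d.curve_kinked using kink_near_4[of "4 - squash v"] by blast
    then show "s \<in> {s \<in> source d.kinked. curve d.kinked s \<in> range \<tau>2}" using v d.g_source by simp
  next
    fix s assume s: "s \<in> {s \<in> source d.kinked. curve d.kinked s \<in> range \<tau>2}"
    then obtain z where z: "curve d.kinked s = \<tau> z" "\<bar>Re z\<bar> < 1/2" "\<bar>Im z - 1\<bar> < 1/2"
      unfolding \<tau>2_range by blast
    then have "s \<in> range g" using d.kinked_range[of s] s by simp
    then obtain u where u: "s = g u" by blast
    then have "z = kink u" using z(1) by (simp add: d.curve_kinked d.chi_eq)
    then have "\<bar>4 - u\<bar> < 1/2" using kink_near_4[of u] z by (simp add: abs_minus_commute)
    then obtain v where "squash v = 4 - u" using squash_unsquash by blast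
    then show "s \<in> range (\<lambda>v. g (4 - squash v))" using u by (intro image_eqI[of _ _ v]) auto
  qed
  show "curve d.kinked (g (4 - squash u)) = \<tau>2 (of_real u)" for u
  proof -
    have "3 \<le> 4 - squash u" "4 - squash u \<le> 5" using squash_bound[of u] by (auto simp: abs_if split: if_splits)
    then show ?thesis by (simp add: d.curve_kinked \<tau>2_def kink_eqs(6) squash_sign)
  qed
  show "\<tau>2 z \<in> B \<longleftrightarrow> Re z \<le> 0" for z by (simp add: \<tau>2_def d.side squash_sign)
qed (use d.closed_B d.crossings_kinked_B in auto)

lemma new_chart': "disk_chart m.kinked \<tau>2 (\<lambda>v. g' (squash v)) B"
proof
  show "virtual_link_diagram m.kinked" by (rule m.kinked_diagram)
  show "continuous_on UNIV \<tau>2" "inj \<tau>2" by (rule \<tau>2_cont \<tau>2_inj)+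
  show "continuous_on UNIV (\<lambda>v. g' (squash v))"
    by (intro continuous_on_compose2[OF d'.cont_g] continuous_intros continuous_squash) auto
  have near: "\<bar>Re (cnj (kink u))\<bar> < 1/2 \<and> \<bar>Im (cnj (kink u)) - 1\<bar> < 1/2 \<longleftrightarrow> \<bar>u\<bar> < 1/2" for u
  proof -
    have "\<bar>Im (cnj (kink u)) - 1\<bar> = \<bar>Im (kink u) + 1\<bar>" by (simp add: abs_if)
    then show ?thesis using kink_near_0[of u] by simp
  qed
  show "range (\<lambda>v. g' (squash v)) = {s \<in> source m.kinked. curve m.kinked s \<in> range \<tau>2}"
  proof (intro set_eqI iffI)
    fix s assume "s \<in> range (\<lambda>v. g' (squash v))"
    then obtain v where v: "s = g' (squash v)" by blast
    have "curve m.kinked s \<in> range \<tau>2"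
      unfolding \<tau>2_range v m.curve_kinked using near[of "squash v"] squash_bound[of v] by auto
    then show "s \<in> {s \<in> source m.kinked. curve m.kinked s \<in> range \<tau>2}" using v d'.g_source by simp
  next
    fix s assume s: "s \<in> {s \<in> source m.kinked. curve m.kinked s \<in> range \<tau>2}"
    then obtain z where z: "curve m.kinked s = \<tau> z" "\<bar>Re z\<bar> < 1/2" "\<bar>Im z - 1\<bar> < 1/2"
      unfolding \<tau>2_range by blast
    have "\<tau> z = (\<tau> \<circ> cnj) (cnj z)" by simp
    then have "s \<in> range g'" using m.kinked_range[of s] s z(1) by (metis (no_types, lifting) m.source_kinked(1) mem_Collect_eq rangeI)
    then obtain u where u: "s = g' u" by blast
    then have "z = cnj (kink u)" using z(1) by (simp add: m.curve_kinked d.chi_eq)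
    then have "\<bar>u\<bar> < 1/2" using near[of u] z by simp
    then obtain v where "squash v = u" using squash_unsquash by blast
    then show "s \<in> range (\<lambda>v. g' (squash v))" using u by (intro image_eqI[of _ _ v]) auto
  qed
  show "curve m.kinked (g' (squash u)) = \<tau>2 (of_real u)" for u
  proof -
    have "-3 \<le> squash u" "squash u \<le> 1" using squash_bound[of u] by (auto simp: abs_if split: if_splits)
    then show ?thesis by (simp add: m.curve_kinked \<tau>2_def kink_eqs(4) squash_sign complex_cnj)
  qed
  show "\<tau>2 z \<in> B \<longleftrightarrow> Re z \<le> 0" for z by (simp add: \<tau>2_def d.side squash_sign)
qed (use d'.closed_B m.crossings_kinked_B in auto)

lemma \<alpha>2'_simps: "i < n - 1 \<Longrightarrow> \<alpha>2' i = \<alpha>' i" "\<alpha>2' (n - 1) = (\<lambda>t. g' (4 + 3 * t))" "\<alpha>2' n = \<alpha>' (n - 1)"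
proof -
  have "n - 1 \<noteq> n" using n by linarith
  then show "i < n - 1 \<Longrightarrow> \<alpha>2' i = \<alpha>' i" "\<alpha>2' (n - 1) = (\<lambda>t. g' (4 + 3 * t))" "\<alpha>2' n = \<alpha>' (n - 1)"
    by (auto simp: \<alpha>2'_def)
qed

text \<open>
  At the endpoints, every strand end keeps its place except the one that was at \<open>\<tau> 0\<close>: it is now at height
  \<open>-1\<close> before the move and at height \<open>1\<close> after it.
\<close>

lemma extend: "extendable_H_move (Suc n) d.kinked m.kinked B \<phi> \<phi>' \<theta>2 \<alpha>2 \<alpha>2' \<tau>2
   (\<lambda>y. ang (1 + squash y)) (\<lambda>v. g (4 - squash v)) (\<lambda>v. g' (squash v))"
proof (rule extendable_H_move.intro)
  show "homeomorphism (cball 0 1) B \<phi> \<phi>'" by (rule disk)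
  show "agree_outside B d.kinked m.kinked"
    by (rule kinked_agree_outside[OF charts(1) charts_mirror agree])
  show "strict_mono_on {..<2 * Suc n} \<theta>2" by (rule \<theta>2_mono)
  show "0 \<le> \<theta>2 j \<and> \<theta>2 j < 2 * pi" if "j < 2 * Suc n" for j by (rule \<theta>2_bounds[OF that])
  show "strands d.kinked B (Suc n) \<alpha>2" unfolding \<alpha>2_def
    by (rule d.strands_kinked[OF strands(1)]) simp
  show "strands m.kinked B (Suc n) \<alpha>2'" unfolding \<alpha>2'_def
  proof (rule strands_permute[OF m.strands_kinked[OF strands(2)]])
    show "bij_betw (\<lambda>i. if i = n - 1 then n else if i = n then n - 1 else i) {..<Suc n} {..<Suc n}"
      by (rule bij_betw_byWitness[where f' = "\<lambda>i. if i = n - 1 then n else if i = n then n - 1 else i"])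
        (use n in auto)
  qed simp
  show "curve d.kinked (\<alpha>2 i 0) = \<phi> (cis (\<theta>2 (2 * i)))" if "i < Suc n" for i
  proof (cases "i = n")
    case True
    then show ?thesis by (simp add: \<alpha>2_def d.curve_kinked \<theta>2_points)
  next
    case False
    then have i: "i < n" using that by simp
    then have "curve D (\<alpha> i 0) \<noteq> \<tau> 0"
    proof -
      have "2 * i \<noteq> 2 * n - 1" using i by presburger
      then show ?thesis
        unfolding ends(1)[OF i] last_point using points_eq[of "2 * i" "2 * n - 1"] i by auto
    qed
    then show ?thesis using end_kinked(1)[OF i, of 0] ends(1)[OF i] i False by (simp add: \<alpha>2_def \<theta>2_simps)
  qed
  show "curve d.kinked (\<alpha>2 i 1) = \<phi> (cis (\<theta>2 (2 * i + 1)))" if "i < Suc n" for i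
  proof -
    consider "i = n" | "i = n - 1" "i < n" | "i < n - 1" using \<open>i < Suc n\<close> by linarith
    then show ?thesis
    proof cases
      case 1
      then show ?thesis using \<theta>2_points(3) by (simp add: \<alpha>2_def d.curve_kinked)
    next
      case 2
      then have "2 * i + 1 = 2 * n - 1" "i \<noteq> n" by simp_all
      then show ?thesis using end_kinked(1)[OF 2(2), of 1] ends(2)[OF 2(2)] last_point \<theta>2_points(1)
        by (simp add: \<alpha>2_def)
    next
      case 3
      then have i: "i < n" "i \<noteq> n" by simp_all
      then have "curve D (\<alpha> i 1) \<noteq> \<tau> 0"
        unfolding ends(2)[OF i(1)] last_point using points_eq[of "2 * i + 1" "2 * n - 1"] 3 by auto
      then show ?thesis using end_kinked(1)[OF i(1), of 1] ends(2)[OF i(1)] 3 i(2) by (simp add: \<alpha>2_def \<theta>2_simps)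
    qed
  qed
  show "curve m.kinked (\<alpha>2' i 0) = \<phi> (cis (\<theta>2 (2 * i + 1)))" if "i < Suc n" for i
  proof -
    consider "i = n" | "i = n - 1" "i < n" | "i < n - 1" using \<open>i < Suc n\<close> by linarith
    then show ?thesis
    proof cases
      case 1
      have l: "n - 1 < n" "2 * (n - 1) + 1 = 2 * n - 1" using n by auto
      then have "curve D' (\<alpha>' (n - 1) 0) = \<tau> 0" using ends(3)[OF l(1)] last_point by simp
      then show ?thesis using end_kinked(2)[OF l(1), of 0] 1 \<theta>2_points(3) by (simp add: \<alpha>2'_simps)
    next
      case 2
      then have "2 * i + 1 = 2 * n - 1" by simp
      moreover have "\<alpha>2' i = (\<lambda>t. g' (4 + 3 * t))" using \<alpha>2'_simps(2) 2(1) by metis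
      ultimately show ?thesis using \<theta>2_points(1) by (simp add: m.curve_kinked)
    next
      case 3
      then have i: "i < n" by simp
      then have "curve D' (\<alpha>' i 0) \<noteq> \<tau> 0"
        unfolding ends(3)[OF i] last_point using points_eq[of "2 * i + 1" "2 * n - 1"] 3 by auto
      then show ?thesis using end_kinked(2)[OF i, of 0] ends(3)[OF i] 3 by (simp add: \<alpha>2'_simps \<theta>2_simps)
    qed
  qed
  show "curve m.kinked (\<alpha>2' i 1) = \<phi> (cis (\<theta>2 ((2 * i + 2) mod (2 * Suc n))))" if "i < Suc n" for i
  proof -
    consider "i = n" | "i = n - 1" "i < n" | "i < n - 1" using \<open>i < Suc n\<close> by linarith
    then show ?thesis
    proof cases
      case 1
      have l: "n - 1 < n" "2 * (n - 1) + 2 = 2 * n" using n by auto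
      then have e: "curve D' (\<alpha>' (n - 1) 1) = \<phi> (cis (\<theta> 0))" using ends(4)[OF l(1)] by simp
      moreover have "\<phi> (cis (\<theta> 0)) \<noteq> \<tau> 0"
        unfolding last_point using points_eq[of 0 "2 * n - 1"] n by auto
      ultimately show ?thesis using end_kinked(2)[OF l(1), of 1] 1 n by (simp add: \<alpha>2'_simps \<theta>2_simps)
    next
      case 2
      then have "2 * i + 2 = 2 * n" by simp
      moreover have "\<alpha>2' i = (\<lambda>t. g' (4 + 3 * t))" using \<alpha>2'_simps(2) 2(1) by metis
      ultimately show ?thesis using \<theta>2_points(2) by (simp add: m.curve_kinked)
    next
      case 3
      then have i: "i < n" by simp
      have e: "curve D' (\<alpha>' i 1) = \<phi> (cis (\<theta> (2 * i + 2)))" using ends(4)[OF i] 3 by simp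
      have "2 * i + 2 = 2 * n - 1 \<Longrightarrow> False" using n by presburger
      then have "curve D' (\<alpha>' i 1) \<noteq> \<tau> 0"
        unfolding e last_point using points_eq[of "2 * i + 2" "2 * n - 1"] 3 by auto
      then show ?thesis using end_kinked(2)[OF i, of 1] e 3 by (simp add: \<alpha>2'_simps \<theta>2_simps)
    qed
  qed
  show "ncomp m.kinked = ncomp d.kinked" using ncomp by simp
  show "disk_chart d.kinked \<tau>2 (\<lambda>v. g (4 - squash v)) B" by (rule new_chart)
  show "disk_chart m.kinked \<tau>2 (\<lambda>v. g' (squash v)) B" by (rule new_chart')
  show "strict_mono (\<lambda>y. ang (1 + squash y))"
    using squash_mono by (auto simp: strict_mono_def ang_less)
  show "\<tau>2 (Complex 0 y) = \<phi> (cis (ang (1 + squash y)))" for y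
    using ang(2)[of "1 + squash y"] by (simp add: \<tau>2_def squash_sign)
  show "ang (1 + squash 0) = \<theta>2 (2 * Suc n - 1)" using \<theta>2_simps(4) by (simp add: squash_sign)
  show "\<theta>2 (2 * Suc n - 2) < ang (1 + squash y) \<and> ang (1 + squash y) < 2 * pi" for y
    using ang(4)[of "1 + squash y"] squash_bound[of y] \<theta>2_simps(3)
    by (auto simp: ang_less abs_if split: if_splits)
qed simp

text \<open>The simulation: kink, H(n+1)-move, and removal of the mirrored kink.\<close>

lemma simulate:
  "\<exists>E E' \<theta>2 \<alpha>2 \<alpha>2' \<tau>2 ang2 g2 g2'. generalized_reidemeister_move D E \<and>
     extendable_H_move (Suc n) E E' B \<phi> \<phi>' \<theta>2 \<alpha>2 \<alpha>2' \<tau>2 ang2 g2 g2' \<and>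
     generalized_reidemeister_move E' D'"
proof -
  have "generalized_reidemeister_move m.kinked D'"
    using m.kinked_move unfolding generalized_reidemeister_move_def by blast
  then show ?thesis using d.kinked_move extend by blast
qed

end

theorem extendable_H_move_transformable:
  assumes "extendable_H_move n D D' B \<phi> \<phi>' \<theta> \<alpha> \<alpha>' \<tau> ang g g'"
  shows "H_transformable (n + k) D D'"
  using assms
proof (induction k arbitrary: n D D' \<theta> \<alpha> \<alpha>' \<tau> ang g g')
  case 0
  then have "H_move n D D'" by (rule extendable_H_move.H_move)
  then show ?case unfolding H_transformable_def by (intro r_into_rtranclp) simp
next
  case (Suc k)
  obtain E E' \<theta>2 \<alpha>2 \<alpha>2' \<tau>2 ang2 g2 g2' where E: "generalized_reidemeister_move D E"
    "extendable_H_move (Suc n) E E' B \<phi> \<phi>' \<theta>2 \<alpha>2 \<alpha>2' \<tau>2 ang2 g2 g2'"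
    "generalized_reidemeister_move E' D'"
    using extendable_H_move.simulate[OF Suc.prems] by blast
  have "H_transformable (Suc n + k) E E'" by (rule Suc.IH[OF E(2)])
  moreover have "H_transformable m X Y" if "generalized_reidemeister_move X Y" for m X Y
    unfolding H_transformable_def using that by (intro r_into_rtranclp) simp
  ultimately have "H_transformable (n + Suc k) D E" "H_transformable (n + Suc k) E E'"
    "H_transformable (n + Suc k) E' D'" using E by auto
  then show ?case unfolding H_transformable_def by (meson rtranclp_trans)
qed

section \<open>Normal form around a crossing\<close>

text \<open>
  Coordinates at a crossing \<open>x\<close>: in the chart \<open>\<Phi>\<close> the knot consists of the two axes, and the points \<open>u\<close>
  and \<open>\<i> * u\<close> of the axes are passed at the angles \<open>e u\<close> and \<open>n u\<close>, counted from a base point \<open>q\<close> of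
  the parametrising circle that lies outside the relevant part of the chart. The radii are only large enough
  for the disks that are used below.
\<close>

definition frame :: "vdiagram \<Rightarrow> complex \<Rightarrow> complex \<Rightarrow> (complex \<Rightarrow> complex) \<Rightarrow> (real \<Rightarrow> real) \<Rightarrow> (real \<Rightarrow> real) \<Rightarrow> bool" where
  "frame D x q \<Phi> e n \<longleftrightarrow>
     norm q = 1 \<and> continuous_on (ball 0 50) \<Phi> \<and> inj_on \<Phi> (ball 0 50) \<and> \<Phi> 0 = x \<and>
     continuous_on {-40..40} e \<and> continuous_on {-40..40} n \<and>
     (\<forall>u\<in>{-40..40}. 0 < e u \<and> e u < 2 * pi) \<and> (\<forall>u\<in>{-40..40}. 0 < n u \<and> n u < 2 * pi) \<and>
     (\<forall>u\<in>{-40..40}. curve D (0, q * cis (e u)) = \<Phi> (of_real u)) \<and>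
     (\<forall>u\<in>{-40..40}. curve D (0, q * cis (n u)) = \<Phi> (\<i> * of_real u)) \<and>
     e 0 \<noteq> n 0 \<and>
     (\<forall>t z. 0 \<le> t \<and> t < 2 * pi \<and> norm z \<le> 40 \<and> curve D (0, q * cis t) = \<Phi> z \<longrightarrow>
        (\<exists>u\<in>{-40..40}. t = e u \<and> z = of_real u) \<or> (\<exists>u\<in>{-40..40}. t = n u \<and> z = \<i> * of_real u))"

lemma frameI:
  assumes "norm q = 1" "continuous_on (ball 0 50) \<Phi>" "inj_on \<Phi> (ball 0 50)" "\<Phi> 0 = x"
    "continuous_on {-40..40} e" "continuous_on {-40..40} n"
    "\<And>u. u \<in> {-40..40} \<Longrightarrow> 0 < e u \<and> e u < 2 * pi" "\<And>u. u \<in> {-40..40} \<Longrightarrow> 0 < n u \<and> n u < 2 * pi"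
    "\<And>u. u \<in> {-40..40} \<Longrightarrow> curve D (0, q * cis (e u)) = \<Phi> (of_real u)"
    "\<And>u. u \<in> {-40..40} \<Longrightarrow> curve D (0, q * cis (n u)) = \<Phi> (\<i> * of_real u)"
    "e 0 \<noteq> n 0"
    "\<And>t z. 0 \<le> t \<Longrightarrow> t < 2 * pi \<Longrightarrow> norm z \<le> 40 \<Longrightarrow> curve D (0, q * cis t) = \<Phi> z \<Longrightarrow>
        (\<exists>u\<in>{-40..40}. t = e u \<and> z = of_real u) \<or> (\<exists>u\<in>{-40..40}. t = n u \<and> z = \<i> * of_real u)"
  shows "frame D x q \<Phi> e n"
  unfolding frame_def using assms by blast

lemma frameD:
  assumes "frame D x q \<Phi> e n"
  shows "norm q = 1" "continuous_on (ball 0 50) \<Phi>" "inj_on \<Phi> (ball 0 50)" "\<Phi> 0 = x"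
    "continuous_on {-40..40} e" "continuous_on {-40..40} n"
    "\<And>u. u \<in> {-40..40} \<Longrightarrow> 0 < e u \<and> e u < 2 * pi" "\<And>u. u \<in> {-40..40} \<Longrightarrow> 0 < n u \<and> n u < 2 * pi"
    "\<And>u. u \<in> {-40..40} \<Longrightarrow> curve D (0, q * cis (e u)) = \<Phi> (of_real u)"
    "\<And>u. u \<in> {-40..40} \<Longrightarrow> curve D (0, q * cis (n u)) = \<Phi> (\<i> * of_real u)"
    "e 0 \<noteq> n 0"
    "\<And>t z. 0 \<le> t \<Longrightarrow> t < 2 * pi \<Longrightarrow> norm z \<le> 40 \<Longrightarrow> curve D (0, q * cis t) = \<Phi> z \<Longrightarrow>
        (\<exists>u\<in>{-40..40}. t = e u \<and> z = of_real u) \<or> (\<exists>u\<in>{-40..40}. t = n u \<and> z = \<i> * of_real u)"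
  using assms unfolding frame_def by blast+

lemma frame_chart_comp:
  fixes f :: "complex \<Rightarrow> complex"
  assumes "frame D x q \<Phi> e n" "continuous_on UNIV f" "\<And>z. norm (f z) = norm z" "inj f"
  shows "continuous_on (ball 0 50) (\<lambda>z. \<Phi> (f z))" "inj_on (\<lambda>z. \<Phi> (f z)) (ball 0 50)" "\<Phi> (f 0) = x"
proof -
  note F = frameD[OF assms(1)]
  show "continuous_on (ball 0 50) (\<lambda>z. \<Phi> (f z))"
    by (rule continuous_on_compose2[OF F(2) continuous_on_subset[OF assms(2)]]) (auto simp: assms(3))
  show "inj_on (\<lambda>z. \<Phi> (f z)) (ball 0 50)"
  proof (rule inj_onI)
    fix z w :: complex assume zw: "z \<in> ball 0 50" "w \<in> ball 0 50" "\<Phi> (f z) = \<Phi> (f w)"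
    have "f z = f w" by (rule inj_onD[OF F(3) zw(3)]) (use zw in \<open>auto simp: assms(3)\<close>)
    then show "z = w" using assms(4) by (simp add: inj_def)
  qed
  have "f 0 = 0" using assms(3)[of 0] by simp
  then show "\<Phi> (f 0) = x" using F(4) by simp
qed

lemma frame_swap:
  assumes "frame D x q \<Phi> e n"
  shows "frame D x q (\<lambda>z. \<Phi> (\<i> * cnj z)) n e"
proof -
  note F = frameD[OF assms]
  note C = frame_chart_comp[OF assms, of "\<lambda>z. \<i> * cnj z"]
  have f: "continuous_on UNIV (\<lambda>z. \<i> * cnj z)" "norm (\<i> * cnj z) = norm z" "inj (\<lambda>z. \<i> * cnj z)" for z
    by (auto intro!: continuous_intros simp: norm_mult inj_def)
  show ?thesis
  proof (rule frameI)
    show "continuous_on (ball 0 50) (\<lambda>z. \<Phi> (\<i> * cnj z))" "inj_on (\<lambda>z. \<Phi> (\<i> * cnj z)) (ball 0 50)"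
      "\<Phi> (\<i> * cnj 0) = x" using C[OF f] by auto
    show "curve D (0, q * cis (n u)) = \<Phi> (\<i> * cnj (of_real u))" if "u \<in> {-40..40}" for u
      using F(10)[OF that] by simp
    show "curve D (0, q * cis (e u)) = \<Phi> (\<i> * cnj (\<i> * of_real u))" if "u \<in> {-40..40}" for u
    proof -
      have "\<i> * cnj (\<i> * of_real u) = of_real u" by (simp add: complex_eq_iff)
      then show ?thesis using F(9)[OF that] by metis
    qed
    show "(\<exists>u\<in>{-40..40}. t = n u \<and> z = of_real u) \<or> (\<exists>u\<in>{-40..40}. t = e u \<and> z = \<i> * of_real u)"
      if t: "0 \<le> t" "t < 2 * pi" "norm z \<le> 40" "curve D (0, q * cis t) = \<Phi> (\<i> * cnj z)" for t z
    proof -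
      have "norm (\<i> * cnj z) \<le> 40" using t(3) by (simp add: norm_mult)
      from F(12)[OF t(1,2) this t(4)] show ?thesis
      proof (elim disjE bexE conjE)
        fix u assume u: "u \<in> {-40..40}" "t = e u" "\<i> * cnj z = complex_of_real u"
        have "z = \<i> * of_real u" using u(3) by (auto simp: complex_eq_iff)
        then show ?thesis using u by blast
      next
        fix u assume u: "u \<in> {-40..40}" "t = n u" "\<i> * cnj z = \<i> * complex_of_real u"
        have "z = of_real u" using u(3) by (auto simp: complex_eq_iff)
        then show ?thesis using u by blast
      qed
    qed
  qed (use F in auto)
qed

lemma frame_reflect:
  assumes "frame D x q \<Phi> e n"
  shows "frame D x q (\<lambda>z. \<Phi> (- cnj z)) (\<lambda>u. e (- u)) n"
proof -
  note F = frameD[OF assms]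
  note C = frame_chart_comp[OF assms, of "\<lambda>z. - cnj z"]
  have f: "continuous_on UNIV (\<lambda>z. - cnj z)" "norm (- cnj z) = norm z" "inj (\<lambda>z. - cnj z)" for z
    by (auto intro!: continuous_intros simp: inj_def)
  show ?thesis
  proof (rule frameI)
    show "continuous_on (ball 0 50) (\<lambda>z. \<Phi> (- cnj z))" "inj_on (\<lambda>z. \<Phi> (- cnj z)) (ball 0 50)"
      "\<Phi> (- cnj 0) = x" using C[OF f] by auto
    show "continuous_on {-40..40} (\<lambda>u. e (- u))"
      by (rule continuous_on_compose2[OF F(5)]) (auto intro!: continuous_intros)
    show "0 < e (- u) \<and> e (- u) < 2 * pi" if "u \<in> {-40..40}" for u
      using F(7)[of "- u"] that by simp
    show "curve D (0, q * cis (e (- u))) = \<Phi> (- cnj (of_real u))" if "u \<in> {-40..40}" for u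
      using F(9)[of "- u"] that by simp
    show "curve D (0, q * cis (n u)) = \<Phi> (- cnj (\<i> * of_real u))" if "u \<in> {-40..40}" for u
      using F(10)[OF that] by simp
    show "(\<exists>u\<in>{-40..40}. t = e (- u) \<and> z = of_real u) \<or> (\<exists>u\<in>{-40..40}. t = n u \<and> z = \<i> * of_real u)"
      if t: "0 \<le> t" "t < 2 * pi" "norm z \<le> 40" "curve D (0, q * cis t) = \<Phi> (- cnj z)" for t z
    proof -
      have "norm (- cnj z) \<le> 40" using t(3) by simp
      from F(12)[OF t(1,2) this t(4)] show ?thesis
      proof (elim disjE bexE conjE)
        fix u assume u: "u \<in> {-40..40}" "t = e u" "- cnj z = complex_of_real u"
        have "z = of_real (- u)" using u(3) by (auto simp: complex_eq_iff)
        then show ?thesis using u by (intro disjI1 bexI[of _ "- u"]) auto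
      next
        fix u assume u: "u \<in> {-40..40}" "t = n u" "- cnj z = \<i> * complex_of_real u"
        have "z = \<i> * of_real u" using u(3) by (auto simp: complex_eq_iff)
        then show ?thesis using u by blast
      qed
    qed
  qed (use F in auto)
qed

lemma frame_inj:
  assumes "frame D x q \<Phi> e n"
  shows "inj_on e {-40..40}" "\<And>u v. u \<in> {-40..40} \<Longrightarrow> v \<in> {-40..40} \<Longrightarrow> e u \<noteq> n v"
proof -
  note F = frameD[OF assms]
  have small: "of_real u \<in> ball (0::complex) 50" "\<i> * of_real u \<in> ball (0::complex) 50" if "u \<in> {-40..40}" for u
    using that by (auto simp: norm_mult)
  show "inj_on e {-40..40}"
  proof (rule inj_onI)
    fix u v :: real assume uv: "u \<in> {-40..40}" "v \<in> {-40..40}" "e u = e v"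
    then have "\<Phi> (of_real u) = \<Phi> (of_real v)" using F(9) by metis
    from inj_onD[OF F(3) this] small uv show "u = v" by auto
  qed
  show "e u \<noteq> n v" if uv: "u \<in> {-40..40}" "v \<in> {-40..40}" for u v
  proof
    assume eq: "e u = n v"
    then have "\<Phi> (of_real u) = \<Phi> (\<i> * of_real v)" using F(9,10) uv by metis
    from inj_onD[OF F(3) this] small uv have "of_real u = \<i> * of_real v" by auto
    then have "u = 0" "v = 0" by (auto simp: complex_eq_iff)
    then show False using eq F(11) by simp
  qed
qed

lemma frame_mono_first:
  assumes "frame D x q \<Phi> e n"
  shows "\<exists>\<Phi>' e'. frame D x q \<Phi>' e' n \<and> strict_mono_on {-40..40} e'"
proof -
  have "strict_mono_on {-40..40} e \<or> strict_antimono_on {-40..40} e"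
    using injective_eq_monotone_map[OF is_interval_cc frameD(5)[OF assms]] frame_inj(1)[OF assms] by blast
  then show ?thesis
  proof
    assume "strict_antimono_on {-40..40} e"
    then have "strict_mono_on {-40..40} (\<lambda>u. e (- u))" by (auto simp: monotone_on_def)
    then show ?thesis using frame_reflect[OF assms] by blast
  qed (use assms in blast)
qed

text \<open>
  Reflections of the chart in the axes and the exchange of the axes give coordinates in which both axes
  are passed in the positive direction, the real axis first. In other words, leaving the crossing along the
  positive real axis, the knot returns to it along the negative imaginary axis. This makes the first quadrant the
  right place for a band that preserves the number of components.
\<close>

lemma frame_ordered:
  assumes "frame D x q \<Phi> e n"
  shows "\<exists>\<Phi> e n. frame D x q \<Phi> e n \<and> strict_mono_on {-40..40} e \<and> strict_mono_on {-40..40} n \<and> e 40 < n (-40)"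
proof -
  obtain \<Phi>1 e1 where 1: "frame D x q \<Phi>1 e1 n" "strict_mono_on {-40..40} e1"
    using frame_mono_first[OF assms] by blast
  obtain \<Phi>2 n2 where 2: "frame D x q \<Phi>2 n2 e1" "strict_mono_on {-40..40} n2"
    using frame_mono_first[OF frame_swap[OF 1(1)]] by blast
  have ne: "n2 u \<noteq> e1 v" if "u \<in> {-40..40}" "v \<in> {-40..40}" for u v
    using frame_inj(2)[OF 2(1)] that by blast
  have le: "e1 (-40) \<le> e1 40" "n2 (-40) \<le> n2 40"
    using strict_mono_onD[OF 1(2), of "-40" 40] strict_mono_onD[OF 2(2), of "-40" 40] by auto
  have "e1 40 < n2 (-40) \<or> n2 40 < e1 (-40)"
  proof (rule ccontr)
    assume "\<not> (e1 40 < n2 (-40) \<or> n2 40 < e1 (-40))"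
    then have m: "n2 (-40) \<le> e1 40" "e1 (-40) \<le> n2 40" by auto
    \<comment> \<open>two intervals of angles that overlap have a common point, which would be passed by both axes\<close>
    define y where "y = max (e1 (-40)) (n2 (-40))"
    have "\<exists>u. -40 \<le> u \<and> u \<le> 40 \<and> e1 u = y"
      by (rule IVT') (use m le frameD(6)[OF 2(1)] in \<open>auto simp: y_def\<close>)
    moreover have "\<exists>v. -40 \<le> v \<and> v \<le> 40 \<and> n2 v = y"
      by (rule IVT') (use m le frameD(5)[OF 2(1)] in \<open>auto simp: y_def\<close>)
    ultimately obtain u v where "u \<in> {-40..40}" "v \<in> {-40..40}" "e1 u = n2 v" by auto
    then show False using ne by metis
  qed
  then show ?thesis using 2 1(2) frame_swap[OF 2(1)] by blast
qed

lemma knot_source: "virtual_knot_diagram D \<Longrightarrow> source D = {0} \<times> sphere 0 1"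
  by (auto simp: virtual_knot_diagram_def source_def)

text \<open>
  The chart that witnesses transversality is shrunk until the crossing is the only one in it. Then the curve is
  injective on each branch, and compactness makes its inverse continuous. The base point is a point of the imaginary
  axis at height \<open>90\<close>, so angles do not jump on the part of the axes up to \<open>40\<close>.
\<close>

lemma frame_exists:
  assumes D: "virtual_knot_diagram D" and x: "x \<in> crossings D"
  shows "\<exists>q \<Phi> e n. frame D x q \<Phi> e n"
proof -
  have vl: "virtual_link_diagram D" using D by (simp add: virtual_knot_diagram_def)
  have cD: "continuous_on (source D) (curve D)" and fin: "finite (crossings D)"
    using vl by (auto simp: virtual_link_diagram_def generic_immersion_def)
  note src = knot_source[OF D]
  obtain s t where st: "s \<in> source D" "t \<in> source D" "s \<noteq> t" "curve D s = x" "curve D t = x"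
    using x by (auto simp: crossings_def)
  have ok: "crossing_ok D x" by (rule crossing_ok_diagram[OF vl x])
  then have card2: "card {p \<in> source D. curve D p = x} = 2" by (simp add: crossing_ok_def)
  have two: "{p \<in> source D. curve D p = x} = {s, t}"
    by (rule card_subset_eq[symmetric]) (use st card2 in \<open>auto intro: card_ge_0_finite\<close>)
  have "transverse_at D s t" using ok st unfolding crossing_ok_def by blast
  then obtain W \<psi> \<psi>' U V where W: "open W" "homeomorphism W (ball 0 1) \<psi> \<psi>'"
      and op: "openin (top_of_set (source D)) U" "openin (top_of_set (source D)) V"
      and mem: "s \<in> U" "t \<in> V" "U \<inter> V = {}"
      and UV: "{r \<in> source D. curve D r \<in> W} = U \<union> V"
      and z: "\<psi> (curve D s) = 0" "\<psi> (curve D t) = 0"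
      and U: "\<psi> ` curve D ` U = {z \<in> ball 0 1. Im z = 0}"
      and V: "\<psi> ` curve D ` V = {z \<in> ball 0 1. Re z = 0}"
    by (rule transverse_atE)
  have xW: "x \<in> W" using UV mem st by blast
  have \<psi>1: "\<psi>' (\<psi> w) = w" "\<psi> w \<in> ball 0 1" if "w \<in> W" for w
    using homeomorphism_apply1[OF W(2) that] homeomorphism_mem1[OF W(2) that] by auto
  have \<psi>2: "\<psi> (\<psi>' w) = w" "\<psi>' w \<in> W" if "norm w < 1" for w
    using homeomorphism_apply2[OF W(2), of w] homeomorphism_mem2[OF W(2), of w] that by auto
  have \<psi>0: "\<psi>' 0 = x" using \<psi>1(1)[OF xW] z(1) st(4) by simp
  have op': "open (ball 0 1 \<inter> \<psi>' -` (- (crossings D - {x})))"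
    by (intro continuous_open_preimage homeomorphism_cont2[OF W(2)] open_ball open_Compl finite_imp_closed
        finite_Diff fin)
  have "0 \<in> ball 0 1 \<inter> \<psi>' -` (- (crossings D - {x}))" using \<psi>0 by simp
  then obtain r where r: "r > 0" "ball 0 r \<subseteq> ball 0 1 \<inter> \<psi>' -` (- (crossings D - {x}))"
    using op' open_contains_ball by blast
  have r1: "norm w < 1" "\<psi>' w \<in> crossings D \<Longrightarrow> \<psi>' w = x" if "norm w < r" for w using r that by auto
  \<comment> \<open>the disk of radius 100 corresponds to the disk of radius \<open>r\<close> in the given chart\<close>
  define \<Phi> where "\<Phi> w = \<psi>' (of_real (r / 100) * w)" for w
  have sc: "norm (of_real (r / 100) * w) < r" if "norm w < 100" for w :: complex
    using that r(1) unfolding norm_mult by (simp add: field_simps)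
  have \<Phi>W: "\<Phi> w \<in> W" "\<psi> (\<Phi> w) = of_real (r / 100) * w" "\<Phi> w \<in> crossings D \<Longrightarrow> \<Phi> w = x" if "norm w < 100" for w
    using \<psi>2[OF r1(1)[OF sc[OF that]]] r1(2)[OF sc[OF that]] by (auto simp: \<Phi>_def)
  have \<Phi>inj: "w = w'" if "norm w < 100" "norm w' < 100" "\<Phi> w = \<Phi> w'" for w w'
  proof -
    have "of_real (r / 100) * w = of_real (r / 100) * w'"
      using \<Phi>W(2)[OF that(1)] \<Phi>W(2)[OF that(2)] that(3) by metis
    then show ?thesis using r(1) by simp
  qed
  have \<Phi>cont: "continuous_on (ball 0 100) \<Phi>" unfolding \<Phi>_def
    by (rule continuous_on_compose2[OF homeomorphism_cont2[OF W(2)]])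
      (use r1(1)[OF sc] in \<open>auto intro!: continuous_intros\<close>)
  have \<Phi>0: "\<Phi> 0 = x" using \<psi>0 by (simp add: \<Phi>_def)
  define P where "P = {p \<in> source D. curve D p \<in> \<Phi> ` cball 0 90}"
  have clP: "compact P"
  proof -
    have "closed (\<Phi> ` cball 0 90)"
      by (intro compact_imp_closed compact_continuous_image continuous_on_subset[OF \<Phi>cont]) auto
    then have "closedin (top_of_set (source D)) P"
      using continuous_closedin_preimage[OF cD] by (simp add: P_def vimage_def Int_def)
    then show ?thesis using compact_source closedin_compact by blast
  qed
  have PUV: "P \<subseteq> U \<union> V" using UV \<Phi>W(1) by (force simp: P_def)
  have branch: "\<exists>h. continuous_on {-90..90} h \<and>
      (\<forall>u\<in>{-90..90}. h u \<in> X \<and> h u \<in> source D \<and> curve D (h u) = \<Phi> (\<kappa> * of_real u)) \<and>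
      (\<forall>p\<in>X. \<forall>z. curve D p = \<Phi> z \<and> norm z \<le> 90 \<longrightarrow> (\<exists>u\<in>{-90..90}. p = h u \<and> z = \<kappa> * of_real u))"
    if X: "X \<subseteq> source D" "X \<union> Y = U \<union> V" "X \<inter> Y = {}" "openin (top_of_set (source D)) Y"
      and im: "\<psi> ` curve D ` X = {z \<in> ball 0 1. Q z}" 
      and Q: "\<And>z. Q z \<longleftrightarrow> (\<exists>u. z = \<kappa> * of_real u)" and \<kappa>: "norm \<kappa> = 1"
      and one: "\<And>a b. a \<in> X \<Longrightarrow> b \<in> X \<Longrightarrow> curve D a = x \<Longrightarrow> curve D b = x \<Longrightarrow> a = b" 
    for X Y Q and \<kappa> :: complex
  proof -
    have XW: "curve D p \<in> W" if "p \<in> X" for p using UV X that by blast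
    define PX where "PX = P \<inter> X"
    have "\<exists>T. open T \<and> Y = source D \<inter> T" using X(4) unfolding openin_open by blast
    then obtain T where T: "open T" "Y = source D \<inter> T" by blast
    have "PX = P - T" using PUV X T by (auto simp: PX_def P_def)
    then have cPX: "compact PX" using clP T(1) by (simp add: compact_diff)
    have inj: "inj_on (curve D) PX"
    proof (rule inj_onI)
      fix a b assume ab: "a \<in> PX" "b \<in> PX" "curve D a = curve D b"
      show "a = b"
      proof (rule ccontr)
        assume ne: "a \<noteq> b"
        then have "curve D a \<in> crossings D" using ab by (intro crossingsI[of a D b]) (auto simp: PX_def P_def)
        moreover obtain w where "curve D a = \<Phi> w" "norm w \<le> 90" using ab by (auto simp: PX_def P_def)
        ultimately have "curve D a = x" using \<Phi>W(3)[of w] by simp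
        then show False using one[of a b] ab ne by (auto simp: PX_def)
      qed
    qed
    have cPXc: "continuous_on PX (curve D)" by (rule continuous_on_subset[OF cD]) (auto simp: PX_def P_def)
    obtain h where h: "homeomorphism PX (curve D ` PX) (curve D) h"
      using homeomorphism_compact[OF cPX cPXc refl inj] by blast
    have line: "\<Phi> (\<kappa> * of_real u) \<in> curve D ` PX" if u: "u \<in> {-90..90}" for u
    proof -
      have nu: "norm (\<kappa> * of_real u) \<le> 90" using u \<kappa> by (auto simp: norm_mult)
      have "\<psi> (\<Phi> (\<kappa> * of_real u)) = \<kappa> * of_real (r / 100 * u)" using \<Phi>W(2)[of "\<kappa> * of_real u"] nu by simp
      then have "Q (\<psi> (\<Phi> (\<kappa> * of_real u)))" using Q by blast
      moreover have "\<psi> (\<Phi> (\<kappa> * of_real u)) \<in> ball 0 1" using \<psi>1(2) \<Phi>W(1) nu by simp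
      ultimately have "\<psi> (\<Phi> (\<kappa> * of_real u)) \<in> \<psi> ` curve D ` X" using im by simp
      then obtain p where p: "p \<in> X" "\<psi> (curve D p) = \<psi> (\<Phi> (\<kappa> * of_real u))" by auto
      have "curve D p = \<Phi> (\<kappa> * of_real u)"
      proof -
        have "norm (\<kappa> * of_real u) < 100" using nu by simp
        then show ?thesis
          using p(2) \<psi>1(1)[OF XW[OF p(1)]] \<psi>1(1)[OF \<Phi>W(1)] by metis
      qed
      moreover have "p \<in> PX"
      proof -
        have "curve D p \<in> \<Phi> ` cball 0 90" unfolding calculation using nu by (intro imageI) simp
        then show ?thesis using p(1) X(1) by (auto simp: PX_def P_def)
      qed
      ultimately show ?thesis by (metis imageI)
    qed
    show ?thesis
    proof (intro exI[of _ "\<lambda>u. h (\<Phi> (\<kappa> * of_real u))"] conjI ballI allI impI)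
      have "continuous_on {-90..90} (\<lambda>u. \<Phi> (\<kappa> * of_real u))"
        by (rule continuous_on_compose2[OF \<Phi>cont]) (use \<kappa> in \<open>auto intro!: continuous_intros simp: norm_mult\<close>)
      then show "continuous_on {-90..90} (\<lambda>u. h (\<Phi> (\<kappa> * of_real u)))"
        by (rule continuous_on_compose2[OF homeomorphism_cont2[OF h]]) (use line in blast)
      fix u :: real assume u: "u \<in> {-90..90}"
      have "h (\<Phi> (\<kappa> * of_real u)) \<in> PX" by (rule homeomorphism_mem2[OF h line[OF u]])
      then show "h (\<Phi> (\<kappa> * of_real u)) \<in> X" "h (\<Phi> (\<kappa> * of_real u)) \<in> source D" by (auto simp: PX_def P_def)
      show "curve D (h (\<Phi> (\<kappa> * of_real u))) = \<Phi> (\<kappa> * of_real u)" by (rule homeomorphism_apply2[OF h line[OF u]])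
    next
      fix p z assume p: "p \<in> X" "curve D p = \<Phi> z \<and> norm z \<le> 90"
      then have nz: "norm z < 100" by simp
      have "\<psi> (curve D p) \<in> {z \<in> ball 0 1. Q z}" using im p(1) by blast
      then have "Q (of_real (r / 100) * z)" using \<Phi>W(2)[OF nz] p(2) by simp
      then obtain v where v: "of_real (r / 100) * z = \<kappa> * of_real v" using Q by blast
      then have "z = \<kappa> * of_real (v / (r / 100))" using r(1) by (simp add: field_simps)
      then obtain u where u: "z = \<kappa> * of_real u" by blast
      then have "\<bar>u\<bar> \<le> 90" using p(2) \<kappa> by (simp add: norm_mult)
      moreover have "p \<in> PX" using p X(1) by (auto simp: PX_def P_def)
      then have "h (curve D p) = p" by (rule homeomorphism_apply1[OF h])
      ultimately show "\<exists>u\<in>{-90..90}. p = h (\<Phi> (\<kappa> * of_real u)) \<and> z = \<kappa> * of_real u"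
        using p(2) u by (intro bexI[of _ u]) auto
    qed
  qed
  have Usrc: "U \<subseteq> source D" "V \<subseteq> source D" using op openin_imp_subset by blast+
  have oneU: "a = b" if "a \<in> U" "b \<in> U" "curve D a = x" "curve D b = x" for a b
  proof -
    have "a \<in> {s, t}" "b \<in> {s, t}" unfolding two[symmetric] using that Usrc(1) by auto
    moreover have "s \<notin> V" "t \<notin> U" using mem by blast+
    ultimately show ?thesis using that by auto
  qed
  have oneV: "a = b" if "a \<in> V" "b \<in> V" "curve D a = x" "curve D b = x" for a b
  proof -
    have "a \<in> {s, t}" "b \<in> {s, t}" unfolding two[symmetric] using that Usrc(2) by auto
    moreover have "s \<notin> V" "t \<notin> U" using mem by blast+
    ultimately show ?thesis using that by auto
  qed
  have QU: "Im z = 0 \<longleftrightarrow> (\<exists>u. z = 1 * of_real u)" for z by (auto simp: complex_eq_iff)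
  have QV: "Re z = 0 \<longleftrightarrow> (\<exists>u. z = \<i> * of_real u)" for z by (auto simp: complex_eq_iff)
  obtain gU where gU0: "continuous_on {-90..90} gU \<and>
      (\<forall>u\<in>{-90..90}. gU u \<in> U \<and> gU u \<in> source D \<and> curve D (gU u) = \<Phi> (1 * of_real u)) \<and>
      (\<forall>p\<in>U. \<forall>z. curve D p = \<Phi> z \<and> norm z \<le> 90 \<longrightarrow> (\<exists>u\<in>{-90..90}. p = gU u \<and> z = 1 * of_real u))"
    by (rule exE[OF branch[OF Usrc(1) refl mem(3) op(2) U QU norm_one oneU]])
  have gU: "continuous_on {-90..90} gU"
      "\<And>u. u \<in> {-90..90} \<Longrightarrow> gU u \<in> U \<and> gU u \<in> source D \<and> curve D (gU u) = \<Phi> (1 * of_real u)"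
      "\<And>p z. p \<in> U \<Longrightarrow> curve D p = \<Phi> z \<Longrightarrow> norm z \<le> 90 \<Longrightarrow> (\<exists>u\<in>{-90..90}. p = gU u \<and> z = 1 * of_real u)"
    using gU0 by blast+
  have VU: "V \<inter> U = {}" using mem(3) by blast
  obtain gV where gV0: "continuous_on {-90..90} gV \<and>
      (\<forall>u\<in>{-90..90}. gV u \<in> V \<and> gV u \<in> source D \<and> curve D (gV u) = \<Phi> (\<i> * of_real u)) \<and>
      (\<forall>p\<in>V. \<forall>z. curve D p = \<Phi> z \<and> norm z \<le> 90 \<longrightarrow> (\<exists>u\<in>{-90..90}. p = gV u \<and> z = \<i> * of_real u))"
    by (rule exE[OF branch[OF Usrc(2) Un_commute VU op(1) V QV norm_ii oneV]])
  have gV: "continuous_on {-90..90} gV"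
      "\<And>u. u \<in> {-90..90} \<Longrightarrow> gV u \<in> V \<and> gV u \<in> source D \<and> curve D (gV u) = \<Phi> (\<i> * of_real u)"
      "\<And>p z. p \<in> V \<Longrightarrow> curve D p = \<Phi> z \<Longrightarrow> norm z \<le> 90 \<Longrightarrow> (\<exists>u\<in>{-90..90}. p = gV u \<and> z = \<i> * of_real u)"
    using gV0 by blast+
  define q where "q = snd (gV 90)"
  have srcD: "p = (0, snd p)" "norm (snd p) = 1" if "p \<in> source D" for p
    using that unfolding src by (cases p; simp)+
  have "gV 90 \<in> source D" by (rule conjunct1[OF conjunct2[OF gV(2)]]) simp
  then have q: "norm q = 1" "gV 90 = (0, q)" using srcD[of "gV 90"] unfolding q_def by simp_all
  have q0: "q \<noteq> 0" using q(1) by auto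
  have angle: "continuous_on {-40..40} (\<lambda>u. Arg2pi (snd (h u) / q)) \<and>
      (\<forall>u\<in>{-40..40}. 0 < Arg2pi (snd (h u) / q) \<and> Arg2pi (snd (h u) / q) < 2 * pi \<and>
          (0, q * cis (Arg2pi (snd (h u) / q))) = h u)"
    if h: "continuous_on {-90..90} h" "\<And>u. u \<in> {-90..90} \<Longrightarrow> h u \<in> source D"
      "\<And>u. u \<in> {-40..40} \<Longrightarrow> h u \<noteq> gV 90" for h :: "real \<Rightarrow> nat \<times> complex"
  proof -
    have hs: "h u = (0, snd (h u))" "norm (snd (h u)) = 1" if "u \<in> {-40..40}" for u
      using srcD[OF h(2)[of u]] that by simp_all
    have nr: "snd (h u) / q \<notin> \<real>\<^sub>\<ge>\<^sub>0" if u: "u \<in> {-40..40}" for u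
    proof
      assume "snd (h u) / q \<in> \<real>\<^sub>\<ge>\<^sub>0"
      then obtain c where c: "c \<ge> 0" "snd (h u) / q = of_real c" by (auto elim: nonneg_Reals_cases)
      moreover have "norm (snd (h u) / q) = 1" using hs(2)[OF u] q(1) by (simp add: norm_divide)
      ultimately have "c = 1" by simp
      then have "snd (h u) = q" using c q0 by (simp add: field_simps)
      then show False using h(3)[OF u] hs(1)[OF u] q(2) by simp
    qed
    have "continuous_on {-40..40} (\<lambda>u. Arg2pi (snd (h u) / q))"
    proof (rule continuous_on_compose2[where t = "- \<real>\<^sub>\<ge>\<^sub>0" and g = Arg2pi])
      show "continuous_on (- \<real>\<^sub>\<ge>\<^sub>0) Arg2pi"
        by (intro continuous_at_imp_continuous_on ballI continuous_at_Arg2pi) auto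
      show "continuous_on {-40..40} (\<lambda>u. snd (h u) / q)"
        by (intro continuous_intros continuous_on_snd continuous_on_subset[OF h(1)]) (use q0 in auto)
    qed (use nr in auto)
    moreover have "0 < Arg2pi (snd (h u) / q) \<and> Arg2pi (snd (h u) / q) < 2 * pi \<and>
          (0, q * cis (Arg2pi (snd (h u) / q))) = h u" if u: "u \<in> {-40..40}" for u
    proof -
      have "Arg2pi (snd (h u) / q) \<noteq> 0"
        using nr[OF u] by (auto simp: Arg2pi_eq_0 complex_nonneg_Reals_iff complex_is_Real_iff)
      moreover have "cis (Arg2pi (snd (h u) / q)) = snd (h u) / q"
        using complex_norm_eq_1_exp[of "snd (h u) / q"] hs(2)[OF u] q(1)
        by (simp add: cis_conv_exp norm_divide)
      ultimately show ?thesis using Arg2pi_ge_0[of "snd (h u) / q"] Arg2pi_lt_2pi[of "snd (h u) / q"] hs(1)[OF u] q0 by auto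
    qed
    ultimately show ?thesis by blast
  qed
  have n90: "gV u \<noteq> gV 90" if "u \<in> {-40..40}" for u
  proof
    assume "gV u = gV 90"
    then have "\<Phi> (\<i> * of_real u) = \<Phi> (\<i> * of_real 90)" using gV(2)[of u] gV(2)[of 90] that by auto
    then have "\<i> * of_real u = \<i> * complex_of_real 90" by (rule \<Phi>inj[rotated 2]) (use that in \<open>auto simp: norm_mult\<close>)
    then show False using that by (simp add: complex_eq_iff)
  qed
  have e90: "gU u \<noteq> gV 90" if "u \<in> {-40..40}" for u
    using gU(2)[of u] gV(2)[of 90] that mem(3) by auto
  define e where "e u = Arg2pi (snd (gU u) / q)" for u
  define n where "n u = Arg2pi (snd (gV u) / q)" for u
  have A: "continuous_on {-40..40} e" "\<And>u. u \<in> {-40..40} \<Longrightarrow> 0 < e u \<and> e u < 2 * pi"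
      "\<And>u. u \<in> {-40..40} \<Longrightarrow> (0, q * cis (e u)) = gU u"
    using angle[OF gU(1) _ e90] gU(2) by (auto simp: e_def)
  have N: "continuous_on {-40..40} n" "\<And>u. u \<in> {-40..40} \<Longrightarrow> 0 < n u \<and> n u < 2 * pi"
      "\<And>u. u \<in> {-40..40} \<Longrightarrow> (0, q * cis (n u)) = gV u"
    using angle[OF gV(1) _ n90] gV(2) by (auto simp: n_def)
  have cis_inj: "a = b" if "q * cis a = q * cis b" "0 \<le> a" "a < 2 * pi" "0 \<le> b" "b < 2 * pi" for a b
    by (rule inj_onD[OF cis_inj_on]) (use that q0 in auto)
  have "frame D x q \<Phi> e n"
  proof (rule frameI)
    show "norm q = 1" "\<Phi> 0 = x" by (rule q(1)) (rule \<Phi>0)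
    show "continuous_on (ball 0 50) \<Phi>" by (rule continuous_on_subset[OF \<Phi>cont]) auto
    show "inj_on \<Phi> (ball 0 50)" by (rule inj_onI) (auto intro: \<Phi>inj)
    show "curve D (0, q * cis (e u)) = \<Phi> (of_real u)" if "u \<in> {-40..40}" for u
      using A(3)[OF that] gU(2)[of u] that by simp
    show "curve D (0, q * cis (n u)) = \<Phi> (\<i> * of_real u)" if "u \<in> {-40..40}" for u
      using N(3)[OF that] gV(2)[of u] that by simp
    show "e 0 \<noteq> n 0"
    proof
      assume "e 0 = n 0"
      then have "gU 0 = gV 0" using A(3)[of 0] N(3)[of 0] by simp
      then show False using gU(2)[of 0] gV(2)[of 0] mem(3) by auto
    qed
    fix t z assume t: "0 \<le> t" "t < 2 * pi" "norm z \<le> 40" "curve D (0, q * cis t) = \<Phi> z"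
    have "(0, q * cis t) \<in> source D" using src q(1) by (simp add: norm_mult)
    moreover have "\<Phi> z \<in> W" using \<Phi>W(1)[of z] t(3) by simp
    ultimately have "(0, q * cis t) \<in> {r \<in> source D. curve D r \<in> W}" using t(4) by simp
    then have "(0, q * cis t) \<in> U \<union> V" unfolding UV .
    then show "(\<exists>u\<in>{-40..40}. t = e u \<and> z = of_real u) \<or> (\<exists>u\<in>{-40..40}. t = n u \<and> z = \<i> * of_real u)"
    proof
      assume "(0, q * cis t) \<in> U"
      then obtain u where u: "(0, q * cis t) = gU u" "z = of_real u" using gU(3)[OF _ t(4)] t(3) by auto
      then have u40: "u \<in> {-40..40}" using t(3) by auto
      have "q * cis t = q * cis (e u)" using A(3)[OF u40] u(1) by (metis prod.inject)
      then have "t = e u" by (rule cis_inj) (use A(2)[OF u40] t(1,2) in simp_all)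
      then show ?thesis using u u40 by blast
    next
      assume "(0, q * cis t) \<in> V"
      then obtain u where u: "(0, q * cis t) = gV u" "z = \<i> * of_real u" using gV(3)[OF _ t(4)] t(3) by auto
      then have u40: "u \<in> {-40..40}" using t(3) by (auto simp: norm_mult)
      have "q * cis t = q * cis (n u)" using N(3)[OF u40] u(1) by (metis prod.inject)
      then have "t = n u" by (rule cis_inj) (use N(2)[OF u40] t(1,2) in simp_all)
      then show ?thesis using u u40 by blast
    qed
  qed (use A N in auto)
  then show ?thesis by blast
qed

section \<open>Smoothing a crossing\<close>

lemma dist_Complex: "dist (Complex a b) z = sqrt ((Re z - a)\<^sup>2 + (Im z - b)\<^sup>2)"
  by (simp add: dist_norm cmod_def power2_commute)

lemma in_disk_iff:
  assumes "r > 0"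
  shows "z \<in> cball (Complex a b) r \<longleftrightarrow> (Re z - a)\<^sup>2 + (Im z - b)\<^sup>2 \<le> r\<^sup>2"
    "z \<in> sphere (Complex a b) r \<longleftrightarrow> (Re z - a)\<^sup>2 + (Im z - b)\<^sup>2 = r\<^sup>2"
proof -
  have "sqrt Y \<le> r \<longleftrightarrow> Y \<le> r\<^sup>2" "sqrt Y = r \<longleftrightarrow> Y = r\<^sup>2" if "Y \<ge> 0" for Y
    using real_sqrt_le_iff[of Y "r\<^sup>2"] real_sqrt_eq_iff[of Y "r\<^sup>2"] assms by simp_all
  then show "z \<in> cball (Complex a b) r \<longleftrightarrow> (Re z - a)\<^sup>2 + (Im z - b)\<^sup>2 \<le> r\<^sup>2"
    "z \<in> sphere (Complex a b) r \<longleftrightarrow> (Re z - a)\<^sup>2 + (Im z - b)\<^sup>2 = r\<^sup>2"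
    by (simp_all add: dist_Complex)
qed

text \<open>
  A closed path induces a continuous map on the circle although the angle jumps at \<open>1\<close>: preimages of closed sets
  are images under \<open>cis\<close> of compact sets.
\<close>

lemma continuous_on_circle_angle:
  fixes c :: "real \<Rightarrow> complex"
  assumes c: "continuous_on {0..2 * pi} c" and per: "c 0 = c (2 * pi)"
  shows "continuous_on (sphere 0 1) (\<lambda>z. c (Arg2pi z))"
proof (rule continuous_on_closed_invariant[THEN iffD2, rule_format], goal_cases)
  case (1 C)
  define S where "S = cis ` ({0..2 * pi} \<inter> c -` C)"
  have "closed ({0..2 * pi} \<inter> c -` C)"
    by (rule continuous_closed_preimage[OF c _ 1]) simp
  then have "compact ({0..2 * pi} \<inter> c -` C)" by (metis compact_Int_closed compact_Icc inf.idem inf_assoc)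
  then have "compact S" unfolding S_def
    by (intro compact_continuous_image continuous_intros) 
  moreover have "(\<lambda>z. c (Arg2pi z)) -` C \<inter> sphere 0 1 = S \<inter> sphere 0 1"
  proof (intro set_eqI iffI)
    fix z assume z: "z \<in> (\<lambda>z. c (Arg2pi z)) -` C \<inter> sphere 0 1"
    then have "z = cis (Arg2pi z)" using complex_norm_eq_1_exp[of z] by (simp add: cis_conv_exp)
    moreover have "Arg2pi z \<in> {0..2 * pi} \<inter> c -` C"
      using z Arg2pi_ge_0[of z] Arg2pi_lt_2pi[of z] by simp
    ultimately show "z \<in> S \<inter> sphere 0 1" using z unfolding S_def by blast
  next
    fix z assume z: "z \<in> S \<inter> sphere 0 1"
    then obtain t where t: "0 \<le> t" "t \<le> 2 * pi" "c t \<in> C" "z = cis t" by (auto simp: S_def)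
    have "c (Arg2pi z) = c t"
    proof (cases "t = 2 * pi")
      case True
      then have "Arg2pi z = 0" using t(4) Arg2pi_of_real[of 1] by simp
      then show ?thesis using True per by simp
    next
      case False
      then have "Arg2pi (cis t) = t" using t Arg2pi_exp[of "\<i> * of_real t"] unfolding cis_conv_exp by simp
      then show ?thesis using t(4) by simp
    qed
    then show "z \<in> (\<lambda>z. c (Arg2pi z)) -` C \<inter> sphere 0 1" using z t by simp
  qed
  ultimately show ?case by (metis compact_imp_closed)
qed

lemma Arg2pi_cis: "0 \<le> t \<Longrightarrow> t < 2 * pi \<Longrightarrow> Arg2pi (cis t) = t"
  using Arg2pi_exp[of "\<i> * of_real t"] unfolding cis_conv_exp by simp

lemma circle_angle:
  assumes "norm z = 1" shows "\<exists>t. 0 \<le> t \<and> t < 2 * pi \<and> z = cis t"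
  using complex_norm_eq_1_exp[of z] Arg2pi_ge_0[of z] Arg2pi_lt_2pi[of z] assms
  by (intro exI[of _ "Arg2pi z"]) (simp add: cis_conv_exp)

text \<open>
  The arcs that an H(2)-move puts into the disk of radius \<open>5\<close> around \<open>4+4\<i>\<close>. The axes meet this disk in the
  segments from \<open>1\<close> to \<open>7\<close> and from \<open>\<i>\<close> to \<open>7\<i>\<close>. The inner arc is the segment from \<open>1\<close> to
  \<open>\<i>\<close>; the outer one runs from \<open>7\<close> through \<open>6\<close> and \<open>6\<i>\<close> to \<open>7\<i>\<close>, so that near the endpoint
  \<open>7\<close> the curve follows the real axis before and after the move.
\<close>

definition inner_cap :: "real \<Rightarrow> complex" where "inner_cap l = Complex (1 - l) l"

definition outer_cap :: "real \<Rightarrow> complex" where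
  "outer_cap s = Complex (7 - ramp 0 1 s - 6 * ramp 1 2 s) (6 * ramp 1 2 s + ramp 2 3 s)"

lemma outer_cap_cases:
  assumes "0 \<le> s" "s \<le> 3"
  obtains "s \<le> 1" "outer_cap s = Complex (7 - s) 0"
  | "1 < s" "s \<le> 2" "outer_cap s = Complex (6 - 6 * (s - 1)) (6 * (s - 1))"
  | "2 < s" "outer_cap s = Complex 0 (s + 4)"
proof -
  consider "s \<le> 1" | "1 < s" "s \<le> 2" | "2 < s" by linarith
  then show thesis
  proof cases
    case 1 then show thesis using that(1) assms by (simp add: outer_cap_def ramp_def)
  next
    case 2 then show thesis using that(2) assms by (simp add: outer_cap_def ramp_def)
  next
    case 3 then show thesis using that(3) assms by (simp add: outer_cap_def ramp_def)
  qed
qed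

lemma outer_cap_ends: "outer_cap 0 = 7" "outer_cap 3 = 7 * \<i>"
  by (simp_all add: outer_cap_def ramp_def complex_eq_iff)

lemma inner_cap_ends: "inner_cap 0 = 1" "inner_cap 1 = \<i>"
  by (simp_all add: inner_cap_def complex_eq_iff)

text \<open>
  The centres of the two disks: the disk of the H(2)-move, and the disk of radius \<open>20\<close> that contains
  the kink around the origin but avoids the outer arc. The radii and centres are chosen such that the circles meet
  the axes in the integer points \<open>1\<close>, \<open>7\<close> and \<open>-28\<close>, \<open>4\<close>.
\<close>

abbreviation "band_centre \<equiv> Complex 4 4"
abbreviation "kink_centre \<equiv> Complex (-12) (-12)"

lemma inner_cap_disk:
  assumes "0 \<le> l" "l \<le> 1"
  shows "inner_cap l \<in> cball band_centre 5" "inner_cap l \<in> sphere band_centre 5 \<longleftrightarrow> l = 0 \<or> l = 1"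
    "inner_cap l \<in> cball kink_centre 20" "inner_cap l \<notin> sphere kink_centre 20"
proof -
  have 1: "(1 - l - 4)\<^sup>2 + (l - 4)\<^sup>2 = 25 - 2 * (l * (1 - l))" by (simp add: power2_eq_square algebra_simps)
  have 2: "(1 - l + 12)\<^sup>2 + (l + 12)\<^sup>2 = 313 - 2 * (l * (1 - l))" by (simp add: power2_eq_square algebra_simps)
  have 3: "0 \<le> l * (1 - l)" using assms by simp
  show "inner_cap l \<in> cball band_centre 5" "inner_cap l \<in> sphere band_centre 5 \<longleftrightarrow> l = 0 \<or> l = 1"
    "inner_cap l \<in> cball kink_centre 20" "inner_cap l \<notin> sphere kink_centre 20"
    unfolding in_disk_iff[OF zero_less_numeral] inner_cap_def complex.sel
    using 1 2 3 by auto
qed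

lemma outer_cap_disk:
  assumes "0 \<le> s" "s \<le> 3"
  shows "outer_cap s \<in> cball band_centre 5" "outer_cap s \<in> sphere band_centre 5 \<longleftrightarrow> s = 0 \<or> s = 3"
    "outer_cap s \<notin> cball kink_centre 20"
proof -
  have *: "outer_cap s \<in> cball band_centre 5 \<and> (outer_cap s \<in> sphere band_centre 5 \<longleftrightarrow> s = 0 \<or> s = 3)"
    using assms
  proof (cases rule: outer_cap_cases)
    case 1
    have "(7 - s - 4)\<^sup>2 + (0 - 4)\<^sup>2 = 25 - s * (6 - s)" by (simp add: power2_eq_square algebra_simps)
    moreover have "0 \<le> s * (6 - s)" using assms by simp
    ultimately show ?thesis unfolding in_disk_iff[OF zero_less_numeral] 1(2) using 1(1) by auto
  next
    case 2
    define w where "w = s - 1"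
    have "(6 - 6 * w - 4)\<^sup>2 + (6 * w - 4)\<^sup>2 = 20 - 72 * (w * (1 - w))" by (simp add: power2_eq_square algebra_simps)
    moreover have "0 \<le> w * (1 - w)" using 2 by (simp add: w_def)
    ultimately show ?thesis unfolding in_disk_iff[OF zero_less_numeral] 2(3) w_def[symmetric] using 2 by auto
  next
    case 3
    define v where "v = 3 - s"
    have "(0 - 4)\<^sup>2 + (7 - v - 4)\<^sup>2 = 25 - v * (6 - v)" by (simp add: power2_eq_square algebra_simps)
    moreover have "0 \<le> v * (6 - v)" using assms by (simp add: v_def)
    moreover have "s + 4 = 7 - v" "s = 3 \<longleftrightarrow> v = 0" "v < 1" "s \<noteq> 0" using 3(1) by (auto simp: v_def)
    ultimately show ?thesis unfolding in_disk_iff[OF zero_less_numeral] 3(2) by auto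
  qed
  then show "outer_cap s \<in> cball band_centre 5" "outer_cap s \<in> sphere band_centre 5 \<longleftrightarrow> s = 0 \<or> s = 3" by auto
  have "0 \<le> Re (outer_cap s) \<and> 0 \<le> Im (outer_cap s) \<and> 6 \<le> Re (outer_cap s) + Im (outer_cap s)"
    using assms by (cases rule: outer_cap_cases) auto
  moreover have "400 < (a + 12)\<^sup>2 + (b + 12)\<^sup>2" if "0 \<le> a" "0 \<le> b" "6 \<le> a + b" for a b :: real
  proof -
    have "(a + 12)\<^sup>2 + (b + 12)\<^sup>2 = a\<^sup>2 + b\<^sup>2 + 24 * (a + b) + 288" by (simp add: power2_eq_square algebra_simps)
    moreover have "400 < a\<^sup>2 + b\<^sup>2 + 24 * (a + b) + 288"
    proof -
      have "24 * 6 \<le> 24 * (a + b)" using that(3) by (intro mult_left_mono) auto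
      then have "0 + 24 * 6 + 288 \<le> a\<^sup>2 + b\<^sup>2 + 24 * (a + b) + 288"
        by (intro add_mono) auto
      then show ?thesis by (rule less_le_trans[rotated]) simp
    qed
    ultimately show ?thesis by simp
  qed
  ultimately have "400 < (Re (outer_cap s) + 12)\<^sup>2 + (Im (outer_cap s) + 12)\<^sup>2" by blast
  then show "outer_cap s \<notin> cball kink_centre 20" unfolding in_disk_iff[OF zero_less_numeral] by simp
qed

lemma outer_cap_inj: "inj_on outer_cap {0..3}"
proof (rule inj_onI)
  fix s t assume "s \<in> {0..3}" "t \<in> {0..3}" and eq: "outer_cap s = outer_cap t"
  then have b: "0 \<le> s" "s \<le> 3" "0 \<le> t" "t \<le> 3" by auto
  show "s = t"
    by (rule outer_cap_cases[OF b(1,2)]; rule outer_cap_cases[OF b(3,4)];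
        use arg_cong[OF eq, of Re] arg_cong[OF eq, of Im] in simp)
qed

lemma caps_disjoint: "0 \<le> s \<Longrightarrow> s \<le> 3 \<Longrightarrow> inner_cap l \<noteq> outer_cap s"
  by (cases rule: outer_cap_cases) (auto simp: inner_cap_def complex_eq_iff)

lemma real_axis_disk:
  "of_real u \<in> cball band_centre 5 \<longleftrightarrow> 1 \<le> u \<and> u \<le> 7"
  "of_real u \<in> sphere band_centre 5 \<longleftrightarrow> u = 1 \<or> u = 7"
  "of_real u \<in> cball kink_centre 20 \<longleftrightarrow> -28 \<le> u \<and> u \<le> 4"
  "of_real u \<in> sphere kink_centre 20 \<longleftrightarrow> u = -28 \<or> u = 4"
proof -
  have 1: "(u - 4)\<^sup>2 + (0 - 4)\<^sup>2 = 25 + (u - 1) * (u - 7)" by (simp add: power2_eq_square algebra_simps)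
  have 2: "(u + 12)\<^sup>2 + (0 + 12)\<^sup>2 = 400 + (u + 28) * (u - 4)" by (simp add: power2_eq_square algebra_simps)
  show "of_real u \<in> cball band_centre 5 \<longleftrightarrow> 1 \<le> u \<and> u \<le> 7"
    "of_real u \<in> sphere band_centre 5 \<longleftrightarrow> u = 1 \<or> u = 7"
    "of_real u \<in> cball kink_centre 20 \<longleftrightarrow> -28 \<le> u \<and> u \<le> 4"
    "of_real u \<in> sphere kink_centre 20 \<longleftrightarrow> u = -28 \<or> u = 4"
    unfolding in_disk_iff[OF zero_less_numeral] using 1 2 by (auto simp: mult_le_0_iff)
qed

lemma imag_axis_disk:
  assumes "c = band_centre \<or> c = kink_centre" "r = 5 \<or> r = 20"
  shows "\<i> * of_real u \<in> cball c r \<longleftrightarrow> of_real u \<in> cball c r"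
    "\<i> * of_real u \<in> sphere c r \<longleftrightarrow> of_real u \<in> sphere c r"
proof -
  have "r > 0" using assms(2) by auto
  then show "\<i> * of_real u \<in> cball c r \<longleftrightarrow> of_real u \<in> cball c r"
    "\<i> * of_real u \<in> sphere c r \<longleftrightarrow> of_real u \<in> sphere c r"
    using assms(1) by (auto simp only: in_disk_iff) (simp_all add: add.commute)
qed

lemma norm_bound_disks:
  "cball band_centre 5 \<subseteq> cball 0 40" "cball kink_centre 20 \<subseteq> cball 0 40"
proof -
  have "norm band_centre \<le> 17" "norm kink_centre \<le> 17"
    unfolding cmod_def by (rule real_le_lsqrt; simp)+
  then show "cball band_centre 5 \<subseteq> cball 0 40" "cball kink_centre 20 \<subseteq> cball 0 40"
    by (auto simp: subset_iff) (smt (verit) dist_norm norm_minus_commute norm_triangle_sub)+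
qed

text \<open>
  The knot passes \<open>-28, 1, 7\<close> on the real axis and then \<open>-28, 1, 7\<close> on the imaginary axis, in this order
  (lemma \<open>order\<close>). The H(2)-move cuts the stretches between \<open>1\<close> and \<open>7\<close> on both axes and puts the
  two caps in their place; the part of the knot between them is reversed.
\<close>

locale crossing_frame =
  fixes D :: vdiagram and x q :: complex and \<Phi> :: "complex \<Rightarrow> complex" and e n :: "real \<Rightarrow> real"
  assumes knot: "virtual_knot_diagram D" and frame_D: "frame D x q \<Phi> e n"
    and mono_e: "strict_mono_on {-40..40} e" and mono_n: "strict_mono_on {-40..40} n"
    and below: "e 40 < n (-40)"
begin

lemmas F = frameD[OF frame_D]
lemmas source_D = knot_source[OF knot]

lemma diagram_D: "virtual_link_diagram D" using knot by (simp add: virtual_knot_diagram_def)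

lemma curve_cont: "continuous_on (source D) (curve D)"
  using diagram_D by (auto simp: virtual_link_diagram_def generic_immersion_def)

lemma q0: "q \<noteq> 0" using F(1) by auto

lemma e_less: "u \<in> {-40..40} \<Longrightarrow> v \<in> {-40..40} \<Longrightarrow> e u < e v \<longleftrightarrow> u < v"
  using strict_mono_on_less[OF mono_e] by blast

lemma n_less: "u \<in> {-40..40} \<Longrightarrow> v \<in> {-40..40} \<Longrightarrow> n u < n v \<longleftrightarrow> u < v"
  using strict_mono_on_less[OF mono_n] by blast

lemma e_le: "u \<in> {-40..40} \<Longrightarrow> v \<in> {-40..40} \<Longrightarrow> e u \<le> e v \<longleftrightarrow> u \<le> v"
  using strict_mono_on_less_eq[OF mono_e] by blast

lemma n_le: "u \<in> {-40..40} \<Longrightarrow> v \<in> {-40..40} \<Longrightarrow> n u \<le> n v \<longleftrightarrow> u \<le> v"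
  using strict_mono_on_less_eq[OF mono_n] by blast

lemma e_n: assumes "u \<in> {-40..40}" "v \<in> {-40..40}" shows "e u < n v"
proof -
  have "e u \<le> e 40" "n (-40) \<le> n v" using assms by (simp_all add: e_le n_le)
  then show ?thesis using below by linarith
qed

lemma order: "0 < e (-28)" "e (-28) < e 1" "e 1 < e 7" "e 7 < n (-28)" "n (-28) < n 1" "n 1 < n 7" "n 7 < 2 * pi"
  using F(7)[of "-28"] F(8)[of 7] e_less[of "-28" 1] e_less[of 1 7] e_n[of 7 "-28"] n_less[of "-28" 1] n_less[of 1 7]
  by simp_all

lemma e_onto: assumes "e a \<le> t" "t \<le> e b" "-40 \<le> a" "a \<le> b" "b \<le> 40"
  obtains u where "a \<le> u" "u \<le> b" "t = e u"
proof -
  have "continuous_on {a..b} e" by (rule continuous_on_subset[OF F(5)]) (use assms in auto)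
  from IVT'[OF assms(1,2,4) this] show thesis using that by blast
qed

lemma n_onto: assumes "n a \<le> t" "t \<le> n b" "-40 \<le> a" "a \<le> b" "b \<le> 40"
  obtains u where "a \<le> u" "u \<le> b" "t = n u"
proof -
  have "continuous_on {a..b} n" by (rule continuous_on_subset[OF F(6)]) (use assms in auto)
  from IVT'[OF assms(1,2,4) this] show thesis using that by blast
qed

text \<open>
  The knot as a function of the angle is \<open>\<delta>\<close>, and \<open>\<sigma>\<close> reverses the middle part from \<open>e 7\<close> to \<open>n 1\<close>. The
  angles in \<open>T\<close> are those not strictly inside the two stretches that are cut out. The new knot \<open>c\<close> runs through
  the inner cap while the angle goes from \<open>e 1\<close> to \<open>e 7\<close>, then backwards through the middle part, and through the
  outer cap while the angle goes from \<open>n 1\<close> to \<open>n 7\<close>.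
\<close>

definition \<delta> :: "real \<Rightarrow> complex" where "\<delta> t = curve D (0, q * cis t)"
definition \<sigma> :: "real \<Rightarrow> real" where "\<sigma> t = (if e 7 \<le> t \<and> t \<le> n 1 then e 7 + n 1 - t else t)"
definition T :: "real set" where
  "T = {t. 0 \<le> t \<and> t < 2 * pi \<and> \<not> (e 1 < t \<and> t < e 7) \<and> \<not> (n 1 < t \<and> t < n 7)}"
definition c :: "real \<Rightarrow> complex" where
  "c t = (if e 1 \<le> t \<and> t \<le> e 7 then \<Phi> (inner_cap ((t - e 1) / (e 7 - e 1)))
     else if n 1 \<le> t \<and> t \<le> n 7 then \<Phi> (outer_cap (3 * ((t - n 1) / (n 7 - n 1))))
     else \<delta> (\<sigma> t))"
definition D' :: vdiagram where
  "D' = \<lparr>ncomp = 1, curve = (\<lambda>s. c (Arg2pi (snd s))),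
     decor = (\<lambda>s. if Arg2pi (snd s) \<in> T then decor D (0, q * cis (\<sigma> (Arg2pi (snd s)))) else Plain)\<rparr>"

abbreviation "B \<equiv> \<Phi> ` cball band_centre 5"
abbreviation "K \<equiv> \<Phi> ` cball kink_centre 20"

lemma source_D': "source D' = {0} \<times> sphere 0 1" by (auto simp: source_def D'_def)

lemma angle_D: assumes "s \<in> source D" obtains t where "0 \<le> t" "t < 2 * pi" "s = (0, q * cis t)"
proof -
  have "norm (snd s / q) = 1" "fst s = 0" using assms F(1) by (auto simp: source_D norm_divide)
  then obtain t where "0 \<le> t" "t < 2 * pi" "snd s / q = cis t" using circle_angle by blast
  then show thesis using that[of t] \<open>fst s = 0\<close> q0 by (simp add: prod_eq_iff field_simps)
qed

lemma angle_D': assumes "s \<in> source D'" obtains t where "0 \<le> t" "t < 2 * pi" "s = (0, cis t)"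
proof -
  have "norm (snd s) = 1" "fst s = 0" using assms by (auto simp: source_D')
  then obtain t where "0 \<le> t" "t < 2 * pi" "snd s = cis t" using circle_angle by blast
  then show thesis using that[of t] \<open>fst s = 0\<close> by (simp add: prod_eq_iff)
qed

lemma in_source: "(0, q * cis t) \<in> source D" "(0, cis t) \<in> source D'"
  using F(1) by (auto simp: source_D source_D' norm_mult)

lemma D'_at: assumes "0 \<le> t" "t < 2 * pi"
  shows "curve D' (0, cis t) = c t" "decor D' (0, cis t) = (if t \<in> T then decor D (0, q * cis (\<sigma> t)) else Plain)"
  using Arg2pi_cis[OF assms] by (simp_all add: D'_def)

lemma cis_eq: "0 \<le> s \<Longrightarrow> s < 2 * pi \<Longrightarrow> 0 \<le> t \<Longrightarrow> t < 2 * pi \<Longrightarrow> cis s = cis t \<longleftrightarrow> s = t"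
  using Arg2pi_cis by metis

lemma \<delta>_e: "u \<in> {-40..40} \<Longrightarrow> \<delta> (e u) = \<Phi> (of_real u)"
  and \<delta>_n: "u \<in> {-40..40} \<Longrightarrow> \<delta> (n u) = \<Phi> (\<i> * of_real u)"
  using F(9,10) by (auto simp: \<delta>_def)

lemma \<Phi>_eq: "norm z \<le> 40 \<Longrightarrow> norm w \<le> 40 \<Longrightarrow> \<Phi> z = \<Phi> w \<longleftrightarrow> z = w"
  using inj_onD[OF F(3), of z w] by auto

lemma \<Phi>_mem: assumes "norm z \<le> 40" "S \<subseteq> cball 0 40" shows "\<Phi> z \<in> \<Phi> ` S \<longleftrightarrow> z \<in> S"
proof
  assume "\<Phi> z \<in> \<Phi> ` S"
  then obtain w where "w \<in> S" "\<Phi> z = \<Phi> w" by blast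
  then show "z \<in> S" using assms \<Phi>_eq[of z w] by (auto simp: subset_iff)
qed simp

lemma \<delta>_mem:
  assumes "0 \<le> t" "t < 2 * pi" "S \<subseteq> cball 0 40"
  shows "\<delta> t \<in> \<Phi> ` S \<longleftrightarrow> (\<exists>u\<in>{-40..40}. t = e u \<and> of_real u \<in> S) \<or> (\<exists>u\<in>{-40..40}. t = n u \<and> \<i> * of_real u \<in> S)"
proof
  assume "\<delta> t \<in> \<Phi> ` S"
  then obtain z where z: "z \<in> S" "\<delta> t = \<Phi> z" by blast
  then have "norm z \<le> 40" using assms(3) by (auto simp: subset_iff)
  from F(12)[OF assms(1,2) this] z
  show "(\<exists>u\<in>{-40..40}. t = e u \<and> of_real u \<in> S) \<or> (\<exists>u\<in>{-40..40}. t = n u \<and> \<i> * of_real u \<in> S)"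
    unfolding \<delta>_def by blast
next
  assume "(\<exists>u\<in>{-40..40}. t = e u \<and> of_real u \<in> S) \<or> (\<exists>u\<in>{-40..40}. t = n u \<and> \<i> * of_real u \<in> S)"
  then show "\<delta> t \<in> \<Phi> ` S" using \<delta>_e \<delta>_n by (metis imageI)
qed

lemma chart_disk:
  assumes "ce = band_centre \<and> r = 5 \<or> ce = kink_centre \<and> r = 20"
  shows "closed (\<Phi> ` cball ce r)" "frontier (\<Phi> ` cball ce r) = \<Phi> ` sphere ce r" "disk (\<Phi> ` cball ce r)"
    "cball ce r \<subseteq> cball 0 40" "sphere ce r \<subseteq> cball 0 40"
proof -
  show s: "cball ce r \<subseteq> cball 0 40" using assms norm_bound_disks by auto
  then show "sphere ce r \<subseteq> cball 0 40" by auto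
  have "cball ce r \<subseteq> ball 0 50" using s by (auto simp: subset_iff)
  moreover have "r > 0" using assms by auto
  ultimately show "closed (\<Phi> ` cball ce r)" "frontier (\<Phi> ` cball ce r) = \<Phi> ` sphere ce r" "disk (\<Phi> ` cball ce r)"
    using frontier_chart_cball[OF open_ball F(2,3)] by auto
qed

lemmas B_disk = chart_disk[of band_centre 5, simplified]
lemmas K_disk = chart_disk[of kink_centre 20, simplified]

lemma crossings_chart:
  assumes "norm z \<le> 40" shows "\<Phi> z \<in> crossings D \<longleftrightarrow> z = 0"
proof
  assume "\<Phi> z \<in> crossings D"
  then obtain s1 s2 where s: "s1 \<in> source D" "s2 \<in> source D" "s1 \<noteq> s2" "curve D s1 = \<Phi> z" "curve D s2 = \<Phi> z"
    by (auto simp: crossings_def)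
  obtain t1 where t1: "0 \<le> t1" "t1 < 2 * pi" "s1 = (0, q * cis t1)" using angle_D[OF s(1)] .
  obtain t2 where t2: "0 \<le> t2" "t2 < 2 * pi" "s2 = (0, q * cis t2)" using angle_D[OF s(2)] .
  have ne: "t1 \<noteq> t2" using s(3) t1 t2 by auto
  have 1: "(\<exists>u\<in>{-40..40}. t1 = e u \<and> z = of_real u) \<or> (\<exists>u\<in>{-40..40}. t1 = n u \<and> z = \<i> * of_real u)"
    by (rule F(12)[OF t1(1,2) assms]) (use s t1 in simp)
  have 2: "(\<exists>u\<in>{-40..40}. t2 = e u \<and> z = of_real u) \<or> (\<exists>u\<in>{-40..40}. t2 = n u \<and> z = \<i> * of_real u)"
    by (rule F(12)[OF t2(1,2) assms]) (use s t2 in simp)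
  show "z = 0" using 1 2 ne by (auto simp: complex_eq_iff)
next
  assume "z = 0"
  have "curve D (0, q * cis (e 0)) = curve D (0, q * cis (n 0))" using F(9)[of 0] F(10)[of 0] by simp
  moreover have "(0, q * cis (e 0)) \<noteq> (0::nat, q * cis (n 0))"
    using cis_eq[of "e 0" "n 0"] F(7)[of 0] F(8)[of 0] F(11) q0 by auto
  ultimately have "curve D (0, q * cis (e 0)) \<in> crossings D" by (intro crossingsI[of _ _ "(0, q * cis (n 0))"] in_source)
  then show "\<Phi> z \<in> crossings D" using F(9)[of 0] \<open>z = 0\<close> by simp
qed

lemma crossings_B: "crossings D \<inter> B = {}"
proof -
  have "z = 0" if "z \<in> cball band_centre 5" "\<Phi> z \<in> crossings D" for z
    using crossings_chart[of z] that B_disk(4) by (auto simp: subset_iff)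
  moreover have "0 \<notin> cball band_centre 5" using real_axis_disk(1)[of 0] by simp
  ultimately show ?thesis by blast
qed

lemma x_in: "x \<in> K" "x \<notin> B" "x \<in> crossings D"
proof -
  have "0 \<in> cball kink_centre 20" using real_axis_disk(3)[of 0] by simp
  then show "x \<in> K" using F(4) by blast
  show c: "x \<in> crossings D" using crossings_chart[of 0] F(4) by simp
  then show "x \<notin> B" using crossings_B by blast
qed

lemma crossings_K: "crossings D \<inter> K = {x}"
proof -
  have "z = 0" if "z \<in> cball kink_centre 20" "\<Phi> z \<in> crossings D" for z
    using crossings_chart[of z] that K_disk(4) by (auto simp: subset_iff)
  then show ?thesis using x_in F(4) by blast
qed

lemma \<delta>_disk:
  assumes t: "0 \<le> t" "t < 2 * pi"
    and ce: "ce = band_centre \<and> r = 5 \<or> ce = kink_centre \<and> r = 20"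
    and ab: "-40 \<le> a" "a \<le> b" "b \<le> 40"
    and axis: "\<And>u. of_real u \<in> cball ce r \<longleftrightarrow> a \<le> u \<and> u \<le> b"
      "\<And>u. of_real u \<in> sphere ce r \<longleftrightarrow> u = a \<or> u = b"
  shows "\<delta> t \<in> \<Phi> ` cball ce r \<longleftrightarrow> e a \<le> t \<and> t \<le> e b \<or> n a \<le> t \<and> t \<le> n b"
    "\<delta> t \<in> frontier (\<Phi> ` cball ce r) \<longleftrightarrow> t = e a \<or> t = e b \<or> t = n a \<or> t = n b"
proof -
  note disk = chart_disk[OF ce]
  have im: "\<i> * of_real u \<in> cball ce r \<longleftrightarrow> a \<le> u \<and> u \<le> b"
    "\<i> * of_real u \<in> sphere ce r \<longleftrightarrow> u = a \<or> u = b" for u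
    using imag_axis_disk[of ce r u] ce axis[of u] by blast+
  have "\<delta> t \<in> \<Phi> ` cball ce r \<longleftrightarrow>
      (\<exists>u\<in>{-40..40}. t = e u \<and> a \<le> u \<and> u \<le> b) \<or> (\<exists>u\<in>{-40..40}. t = n u \<and> a \<le> u \<and> u \<le> b)"
    unfolding \<delta>_mem[OF t disk(4)] axis im ..
  also have "\<dots> \<longleftrightarrow> e a \<le> t \<and> t \<le> e b \<or> n a \<le> t \<and> t \<le> n b"
  proof
    assume "(\<exists>u\<in>{-40..40}. t = e u \<and> a \<le> u \<and> u \<le> b) \<or> (\<exists>u\<in>{-40..40}. t = n u \<and> a \<le> u \<and> u \<le> b)"
    then show "e a \<le> t \<and> t \<le> e b \<or> n a \<le> t \<and> t \<le> n b" using ab by (auto simp: e_le n_le)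
  next
    assume "e a \<le> t \<and> t \<le> e b \<or> n a \<le> t \<and> t \<le> n b"
    then show "(\<exists>u\<in>{-40..40}. t = e u \<and> a \<le> u \<and> u \<le> b) \<or> (\<exists>u\<in>{-40..40}. t = n u \<and> a \<le> u \<and> u \<le> b)"
    proof (elim disjE conjE)
      assume "e a \<le> t" "t \<le> e b"
      then obtain u where "a \<le> u" "u \<le> b" "t = e u" using ab by (rule e_onto)
      then show ?thesis using ab by (intro disjI1 bexI[of _ u]) auto
    next
      assume "n a \<le> t" "t \<le> n b"
      then obtain u where "a \<le> u" "u \<le> b" "t = n u" using ab by (rule n_onto)
      then show ?thesis using ab by (intro disjI2 bexI[of _ u]) auto
    qed
  qed
  finally show "\<delta> t \<in> \<Phi> ` cball ce r \<longleftrightarrow> e a \<le> t \<and> t \<le> e b \<or> n a \<le> t \<and> t \<le> n b" .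
  have "\<delta> t \<in> frontier (\<Phi> ` cball ce r) \<longleftrightarrow>
      (\<exists>u\<in>{-40..40}. t = e u \<and> (u = a \<or> u = b)) \<or> (\<exists>u\<in>{-40..40}. t = n u \<and> (u = a \<or> u = b))"
    unfolding disk(2) \<delta>_mem[OF t disk(5)] axis im ..
  then show "\<delta> t \<in> frontier (\<Phi> ` cball ce r) \<longleftrightarrow> t = e a \<or> t = e b \<or> t = n a \<or> t = n b"
    using ab by auto
qed

lemma \<delta>_B:
  assumes "0 \<le> t" "t < 2 * pi"
  shows "\<delta> t \<in> B \<longleftrightarrow> e 1 \<le> t \<and> t \<le> e 7 \<or> n 1 \<le> t \<and> t \<le> n 7"
    "\<delta> t \<in> frontier B \<longleftrightarrow> t = e 1 \<or> t = e 7 \<or> t = n 1 \<or> t = n 7"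
  by (rule \<delta>_disk[OF assms]; simp add: real_axis_disk del: mem_cball mem_sphere)+

lemma \<delta>_K:
  assumes "0 \<le> t" "t < 2 * pi"
  shows "\<delta> t \<in> K \<longleftrightarrow> e (-28) \<le> t \<and> t \<le> e 4 \<or> n (-28) \<le> t \<and> t \<le> n 4"
    "\<delta> t \<in> frontier K \<longleftrightarrow> t = e (-28) \<or> t = e 4 \<or> t = n (-28) \<or> t = n 4"
  by (rule \<delta>_disk[OF assms]; simp add: real_axis_disk del: mem_cball mem_sphere)+

lemma \<sigma>_T: assumes "t \<in> T" shows "\<sigma> t \<in> T" "\<sigma> (\<sigma> t) = t"
  using assms order by (auto simp: \<sigma>_def T_def)

lemma T_bounds: "t \<in> T \<Longrightarrow> 0 \<le> t \<and> t < 2 * pi" by (auto simp: T_def)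

lemma c_inner: "e 1 \<le> t \<Longrightarrow> t \<le> e 7 \<Longrightarrow> c t = \<Phi> (inner_cap ((t - e 1) / (e 7 - e 1)))"
  by (simp add: c_def)

lemma c_outer: "n 1 \<le> t \<Longrightarrow> t \<le> n 7 \<Longrightarrow> c t = \<Phi> (outer_cap (3 * ((t - n 1) / (n 7 - n 1))))"
  using order by (simp add: c_def)

lemma c_ends: "c (e 1) = \<Phi> 1" "c (e 7) = \<Phi> \<i>" "c (n 1) = \<Phi> 7" "c (n 7) = \<Phi> (7 * \<i>)"
  using c_inner[of "e 1"] c_inner[of "e 7"] c_outer[of "n 1"] c_outer[of "n 7"] order
  by (simp_all add: inner_cap_ends outer_cap_ends)

lemma \<delta>_ends: "\<delta> (e 1) = \<Phi> 1" "\<delta> (n 1) = \<Phi> \<i>" "\<delta> (e 7) = \<Phi> 7" "\<delta> (n 7) = \<Phi> (7 * \<i>)"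
  using \<delta>_e[of 1] \<delta>_e[of 7] \<delta>_n[of 1] \<delta>_n[of 7] by (simp_all add: mult.commute)

lemma c_T: assumes "t \<in> T" shows "c t = \<delta> (\<sigma> t)"
proof -
  consider "t = e 1" | "t = e 7" | "t = n 1" | "t = n 7" |
    "\<not> (e 1 \<le> t \<and> t \<le> e 7)" "\<not> (n 1 \<le> t \<and> t \<le> n 7)"
    using assms unfolding T_def by force
  then show ?thesis
  proof cases
    case 5
    then show ?thesis unfolding c_def by (simp only: if_False)
  qed (use order c_ends \<delta>_ends in \<open>simp_all add: \<sigma>_def\<close>)
qed

lemma c_B: assumes "0 \<le> t" "t < 2 * pi"
  shows "c t \<in> B \<longleftrightarrow> e 1 \<le> t \<and> t \<le> e 7 \<or> n 1 \<le> t \<and> t \<le> n 7"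
    "c t \<in> frontier B \<longleftrightarrow> t = e 1 \<or> t = e 7 \<or> t = n 1 \<or> t = n 7"
proof -
  have "(c t \<in> B \<longleftrightarrow> e 1 \<le> t \<and> t \<le> e 7 \<or> n 1 \<le> t \<and> t \<le> n 7) \<and>
    (c t \<in> frontier B \<longleftrightarrow> t = e 1 \<or> t = e 7 \<or> t = n 1 \<or> t = n 7)"
  proof -
    consider "e 1 \<le> t" "t \<le> e 7" | "n 1 \<le> t" "t \<le> n 7" | "\<not> (e 1 \<le> t \<and> t \<le> e 7)" "\<not> (n 1 \<le> t \<and> t \<le> n 7)"
      by blast
    then show ?thesis
    proof cases
      case 1
      define l where "l = (t - e 1) / (e 7 - e 1)"
      have l: "0 \<le> l" "l \<le> 1" "l = 0 \<longleftrightarrow> t = e 1" "l = 1 \<longleftrightarrow> t = e 7"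
        using 1 order by (auto simp: l_def)
      have n: "norm (inner_cap l) \<le> 40" using inner_cap_disk(1)[OF l(1,2)] B_disk(4) by (auto simp: subset_iff)
      show ?thesis
        unfolding c_inner[OF 1] l_def[symmetric] B_disk(2) \<Phi>_mem[OF n B_disk(4)] \<Phi>_mem[OF n B_disk(5)]
        using inner_cap_disk(1,2)[OF l(1,2)] l 1 order by auto
    next
      case 2
      define l where "l = 3 * ((t - n 1) / (n 7 - n 1))"
      have l: "0 \<le> l" "l \<le> 3" "l = 0 \<longleftrightarrow> t = n 1" "l = 3 \<longleftrightarrow> t = n 7"
        using 2 order by (auto simp: l_def divide_simps)
      have n: "norm (outer_cap l) \<le> 40" using outer_cap_disk(1)[OF l(1,2)] B_disk(4) by (auto simp: subset_iff)
      show ?thesis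
        unfolding c_outer[OF 2] l_def[symmetric] B_disk(2) \<Phi>_mem[OF n B_disk(4)] \<Phi>_mem[OF n B_disk(5)]
        using outer_cap_disk(1,2)[OF l(1,2)] l 2 order by auto
    next
      case 3
      then have t: "t \<in> T" using assms by (auto simp: T_def)
      have "\<not> (e 1 \<le> \<sigma> t \<and> \<sigma> t \<le> e 7)" "\<not> (n 1 \<le> \<sigma> t \<and> \<sigma> t \<le> n 7)"
        using 3 order by (auto simp: \<sigma>_def)
      moreover have "0 \<le> \<sigma> t" "\<sigma> t < 2 * pi" using T_bounds[OF \<sigma>_T(1)[OF t]] by auto
      ultimately have no: "c t \<notin> B" using \<delta>_B(1)[of "\<sigma> t"] c_T[OF t] by simp
      then have "c t \<notin> frontier B" using B_disk(1) by (auto simp: frontier_def)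
      moreover have "t \<noteq> e 1" "t \<noteq> e 7" "t \<noteq> n 1" "t \<noteq> n 7" using 3 order by auto
      ultimately show ?thesis using no 3 by blast
    qed
  qed
  then show "c t \<in> B \<longleftrightarrow> e 1 \<le> t \<and> t \<le> e 7 \<or> n 1 \<le> t \<and> t \<le> n 7"
    "c t \<in> frontier B \<longleftrightarrow> t = e 1 \<or> t = e 7 \<or> t = n 1 \<or> t = n 7" by auto
qed

lemma outside_iff: assumes "0 \<le> t" "t < 2 * pi"
  shows "\<delta> t \<notin> interior B \<longleftrightarrow> t \<in> T" "c t \<notin> interior B \<longleftrightarrow> t \<in> T"
proof -
  have int: "y \<in> interior B \<longleftrightarrow> y \<in> B \<and> y \<notin> frontier B" for y
    using B_disk(1) interior_subset[of B] by (auto simp: frontier_def)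
  show "\<delta> t \<notin> interior B \<longleftrightarrow> t \<in> T" "c t \<notin> interior B \<longleftrightarrow> t \<in> T"
    unfolding int \<delta>_B[OF assms] c_B[OF assms] T_def using assms order by auto
qed

lemma c_K: assumes "0 \<le> t" "t < 2 * pi"
  shows "c t \<in> K \<longleftrightarrow> e (-28) \<le> t \<and> t \<le> e 7 + n 1 - n (-28)"
    "c t \<in> frontier K \<longleftrightarrow> t = e (-28) \<or> t = e 7 + n 1 - n (-28)"
proof -
  have o: "e 1 < e 4" "e 4 < e 7" "n 1 < n 4" "n 4 < n 7"
    using e_less[of 1 4] e_less[of 4 7] n_less[of 1 4] n_less[of 4 7] by simp_all
  have "(c t \<in> K \<longleftrightarrow> e (-28) \<le> t \<and> t \<le> e 7 + n 1 - n (-28)) \<and>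
    (c t \<in> frontier K \<longleftrightarrow> t = e (-28) \<or> t = e 7 + n 1 - n (-28))"
  proof -
    consider "e 1 \<le> t" "t \<le> e 7" | "n 1 \<le> t" "t \<le> n 7" | "\<not> (e 1 \<le> t \<and> t \<le> e 7)" "\<not> (n 1 \<le> t \<and> t \<le> n 7)"
      by blast
    then show ?thesis
    proof cases
      case 1
      define l where "l = (t - e 1) / (e 7 - e 1)"
      have l: "0 \<le> l" "l \<le> 1" using 1 order by (auto simp: l_def)
      have n: "norm (inner_cap l) \<le> 40" using inner_cap_disk(1)[OF l(1,2)] B_disk(4) by (auto simp: subset_iff)
      show ?thesis
        unfolding c_inner[OF 1] l_def[symmetric] K_disk(2) \<Phi>_mem[OF n K_disk(4)] \<Phi>_mem[OF n K_disk(5)]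
        using inner_cap_disk(3,4)[OF l(1,2)] 1 order by auto
    next
      case 2
      define l where "l = 3 * ((t - n 1) / (n 7 - n 1))"
      have l: "0 \<le> l" "l \<le> 3" using 2 order by (auto simp: l_def divide_simps)
      have n: "norm (outer_cap l) \<le> 40" using outer_cap_disk(1)[OF l(1,2)] B_disk(4) by (auto simp: subset_iff)
      show ?thesis
        unfolding c_outer[OF 2] l_def[symmetric] K_disk(2) \<Phi>_mem[OF n K_disk(4)] \<Phi>_mem[OF n K_disk(5)]
        using outer_cap_disk(3)[OF l(1,2)] 2 order by auto
    next
      case 3
      then have t: "t \<in> T" using assms by (auto simp: T_def)
      have s: "0 \<le> \<sigma> t" "\<sigma> t < 2 * pi" using T_bounds[OF \<sigma>_T(1)[OF t]] by auto
      show ?thesis unfolding c_T[OF t] \<delta>_K[OF s] using 3 order o by (auto simp: \<sigma>_def)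
    qed
  qed
  then show "c t \<in> K \<longleftrightarrow> e (-28) \<le> t \<and> t \<le> e 7 + n 1 - n (-28)"
    "c t \<in> frontier K \<longleftrightarrow> t = e (-28) \<or> t = e 7 + n 1 - n (-28)" by auto
qed

lemma cont_\<delta>: "continuous_on S \<delta>"
  unfolding \<delta>_def
  by (rule continuous_on_compose2[OF curve_cont]) (use in_source in \<open>auto intro!: continuous_intros\<close>)

lemma cont_c: "continuous_on {0..2 * pi} c"
proof -
  have 1: "continuous_on {0..e 1} c"
  proof (rule continuous_on_eq[OF cont_\<delta>])
    show "\<delta> t = c t" if "t \<in> {0..e 1}" for t
      using that order c_ends(1) \<delta>_ends(1) by (cases "t = e 1") (auto simp: c_def \<sigma>_def)
  qed
  have cap: "continuous_on {a..b} (\<lambda>t. \<Phi> (f (k * ((t - a) / (b - a)))))"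
    if "continuous_on {0..k} f" "\<And>l. 0 \<le> l \<Longrightarrow> l \<le> k \<Longrightarrow> norm (f l) \<le> 40" "a < b" "k > 0" for a b k and f :: "real \<Rightarrow> complex"
  proof -
    have im: "k * ((t - a) / (b - a)) \<in> {0..k}" if "t \<in> {a..b}" for t
    proof -
      have "0 \<le> (t - a) / (b - a)" "(t - a) / (b - a) \<le> 1" using that \<open>a < b\<close> by (auto simp: divide_simps)
      then show ?thesis
        using \<open>k > 0\<close> mult_left_le[of "(t - a) / (b - a)" k] mult_nonneg_nonneg[of k "(t - a) / (b - a)"]
        unfolding atLeastAtMost_iff by (intro conjI) simp_all
    qed
    have "continuous_on {a..b} (\<lambda>t. f (k * ((t - a) / (b - a))))"
      by (rule continuous_on_compose2[OF that(1)]) (use im that(3) in \<open>auto intro!: continuous_intros\<close>)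
    then show ?thesis
      by (rule continuous_on_compose2[OF F(2)]) (use im that(2) in fastforce)
  qed
  have ci: "continuous_on {0..1} inner_cap" "continuous_on {0..3} outer_cap"
    unfolding inner_cap_def outer_cap_def ramp_def Complex_eq by (intro continuous_intros)+
  have bi: "norm (inner_cap l) \<le> 40" if "0 \<le> l" "l \<le> 1" for l
    using inner_cap_disk(1)[OF that] B_disk(4) by (auto simp: subset_iff)
  have bo: "norm (outer_cap l) \<le> 40" if "0 \<le> l" "l \<le> 3" for l
    using outer_cap_disk(1)[OF that] B_disk(4) by (auto simp: subset_iff)
  have 2: "continuous_on {e 1..e 7} c"
    by (rule continuous_on_eq[OF cap[OF ci(1) bi order(3)]]) (auto simp: c_inner)
  have 3: "continuous_on {e 7..n 1} c"
  proof (rule continuous_on_eq)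
    show "continuous_on {e 7..n 1} (\<lambda>t. \<delta> (e 7 + n 1 - t))"
      by (rule continuous_on_compose2[OF cont_\<delta>[of UNIV]]) (auto intro!: continuous_intros)
    show "\<delta> (e 7 + n 1 - t) = c t" if "t \<in> {e 7..n 1}" for t
    proof -
      have "t \<in> T" using that order by (auto simp: T_def)
      then show ?thesis using c_T[of t] that by (simp add: \<sigma>_def)
    qed
  qed
  have 4: "continuous_on {n 1..n 7} c"
    by (rule continuous_on_eq[OF cap[OF ci(2) bo order(6)]]) (auto simp: c_outer)
  have 5: "continuous_on {n 7..2 * pi} c"
  proof (rule continuous_on_eq[OF cont_\<delta>])
    show "\<delta> t = c t" if "t \<in> {n 7..2 * pi}" for t
    proof (cases "t = n 7")
      case True
      then show ?thesis using c_ends(4) \<delta>_ends(4) by metis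
    qed (use that order in \<open>auto simp: c_def \<sigma>_def\<close>)
  qed
  have "{0..2 * pi} = {0..e 1} \<union> {e 1..e 7} \<union> {e 7..n 1} \<union> {n 1..n 7} \<union> {n 7..2 * pi}"
    using order by auto
  then show ?thesis
    using 1 2 3 4 5 by (simp only:) (intro continuous_on_closed_Un closed_Un closed_atLeastAtMost)
qed

lemma cont_D': "continuous_on (source D') (curve D')"
proof -
  have "c 0 = c (2 * pi)" using order by (auto simp: c_def \<sigma>_def \<delta>_def)
  from continuous_on_circle_angle[OF cont_c this]
  show ?thesis unfolding source_D'
    by (auto simp: D'_def intro!: continuous_on_compose2[of "sphere 0 1" "\<lambda>z. c (Arg2pi z)"] continuous_intros)
qed

text \<open>
  On the angles in \<open>T\<close> the new knot is the old one composed with the involution \<open>\<sigma>\<close>, so \<open>\<sigma>\<close> induces the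
  correspondence of parameters. On the circle it is a rotation on one closed part and a reflection on the other.
\<close>

lemma agree_D': "agree_outside B D D'"
proof -
  define X where "X = {s \<in> source D. curve D s \<notin> interior B}"
  define X' where "X' = {s \<in> source D'. curve D' s \<notin> interior B}"
  have X: "X = (\<lambda>t. (0::nat, q * cis t)) ` T"
  proof (intro set_eqI iffI)
    fix s assume s: "s \<in> X"
    then obtain t where t: "0 \<le> t" "t < 2 * pi" "s = (0, q * cis t)" using angle_D unfolding X_def by blast
    then have "t \<in> T" using s outside_iff(1)[OF t(1,2)] by (simp add: X_def \<delta>_def)
    then show "s \<in> (\<lambda>t. (0::nat, q * cis t)) ` T" using t by blast
  next
    fix s assume "s \<in> (\<lambda>t. (0::nat, q * cis t)) ` T"
    then obtain t where t: "t \<in> T" "s = (0, q * cis t)" by blast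
    then show "s \<in> X" using outside_iff(1)[of t] T_bounds[OF t(1)] in_source(1) by (simp add: X_def \<delta>_def)
  qed
  have X': "X' = (\<lambda>t. (0::nat, cis t)) ` T"
  proof (intro set_eqI iffI)
    fix s assume s: "s \<in> X'"
    then obtain t where t: "0 \<le> t" "t < 2 * pi" "s = (0, cis t)" using angle_D' unfolding X'_def by blast
    then have "t \<in> T" using s outside_iff(2)[OF t(1,2)] D'_at(1)[OF t(1,2)] by (simp add: X'_def)
    then show "s \<in> (\<lambda>t. (0::nat, cis t)) ` T" using t by blast
  next
    fix s assume "s \<in> (\<lambda>t. (0::nat, cis t)) ` T"
    then obtain t where t: "t \<in> T" "s = (0, cis t)" by blast
    then show "s \<in> X'" using outside_iff(2)[of t] T_bounds[OF t(1)] in_source(2) D'_at(1)[of t] by (simp add: X'_def)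
  qed
  define h :: "nat \<times> complex \<Rightarrow> nat \<times> complex" where
    \<comment> \<open>the reflection that takes the angle \<open>t\<close> to \<open>e 7 + n 1 - t\<close>\<close>
    "h s = (0, if e 7 \<le> Arg2pi (snd s / q) \<and> Arg2pi (snd s / q) \<le> n 1
        then cis (e 7 + n 1) * cnj (snd s / q) else snd s / q)" for s
  have h_at: "h (0, q * cis t) = (0, cis (\<sigma> t))" if "0 \<le> t" "t < 2 * pi" for t
    using Arg2pi_cis[OF that] q0 by (simp add: h_def \<sigma>_def cis_cnj cis_mult)
  have closedX: "closed X"
  proof -
    have "closedin (top_of_set (source D)) X"
      using continuous_closedin_preimage[OF curve_cont, of "- interior B"]
      by (simp add: X_def vimage_def Int_def closed_Compl)
    then show ?thesis using compact_source[of D] closedin_compact compact_imp_closed by blast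
  qed
  have compX: "compact X"
    using compact_Int_closed[OF compact_source[of D] closedX] by (simp add: X_def Int_absorb1 Collect_mono_iff inf_absorb2)
  have cont_h: "continuous_on X h"
  proof -
    define X1 where "X1 = (\<lambda>t. (0::nat, q * cis t)) ` {e 7..n 1}"
    define X2 where "X2 = (\<lambda>t. (0::nat, q * cis t)) ` ({0..e 1} \<union> {n 7..2 * pi})"
    have "X \<subseteq> X1 \<union> X2" unfolding X X1_def X2_def T_def by (auto intro!: image_eqI)
    moreover have cl: "closed X1" "closed X2" unfolding X1_def X2_def
      by (intro compact_imp_closed compact_continuous_image continuous_intros compact_Un compact_Icc)+
    moreover have "continuous_on X1 h"
    proof (rule continuous_on_eq)
      show "continuous_on X1 (\<lambda>s. (0, cis (e 7 + n 1) * cnj (snd s / q)))" using q0 by (intro continuous_intros) auto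
      show "(0, cis (e 7 + n 1) * cnj (snd s / q)) = h s" if s: "s \<in> X1" for s
      proof -
        obtain t where t: "e 7 \<le> t" "t \<le> n 1" "s = (0, q * cis t)" using s by (auto simp: X1_def)
        have "Arg2pi (cis t) = t" by (rule Arg2pi_cis) (use t order in auto)
        then show ?thesis using t q0 by (simp add: h_def)
      qed
    qed
    moreover have "continuous_on X2 h"
    proof (rule continuous_on_eq)
      show "continuous_on X2 (\<lambda>s. (0, snd s / q))" using q0 by (intro continuous_intros) auto
      show "(0, snd s / q) = h s" if s: "s \<in> X2" for s
      proof -
        obtain t where t: "t \<in> {0..e 1} \<union> {n 7..2 * pi}" "s = (0, q * cis t)" using s unfolding X2_def by blast
        have "\<not> (e 7 \<le> Arg2pi (cis t) \<and> Arg2pi (cis t) \<le> n 1)"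
        proof (cases "t = 2 * pi")
          case True
          then have "Arg2pi (cis t) = 0" using Arg2pi_of_real[of 1] by simp
          then show ?thesis using order by simp
        next
          case False
          then have "Arg2pi (cis t) = t" by (intro Arg2pi_cis) (use t order in auto)
          then show ?thesis using t order by auto
        qed
        moreover have "snd s / q = cis t" using t q0 by simp
        ultimately show ?thesis unfolding h_def by (simp only: if_False)
      qed
    qed
    ultimately show ?thesis
      using continuous_on_closed_Un[of X1 X2 h] continuous_on_subset by blast
  qed
  have inj_h: "inj_on h X"
  proof (rule inj_onI)
    fix s s' assume "s \<in> X" "s' \<in> X" and eq: "h s = h s'"
    then obtain t t' where t: "t \<in> T" "s = (0, q * cis t)" "t' \<in> T" "s' = (0, q * cis t')" unfolding X by blast
    have "cis (\<sigma> t) = cis (\<sigma> t')" using eq t h_at T_bounds by simp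
    then have "\<sigma> t = \<sigma> t'" using cis_eq T_bounds[OF \<sigma>_T(1)[OF t(1)]] T_bounds[OF \<sigma>_T(1)[OF t(3)]] by simp
    then have "t = t'" using \<sigma>_T(2) t by metis
    then show "s = s'" using t by simp
  qed
  have img: "h ` X = X'"
  proof (intro set_eqI iffI)
    fix s assume "s \<in> h ` X"
    then obtain t where t: "t \<in> T" "s = h (0, q * cis t)" unfolding X by blast
    then have "s = (0, cis (\<sigma> t))" using h_at T_bounds by simp
    then show "s \<in> X'" unfolding X' using \<sigma>_T(1)[OF t(1)] by blast
  next
    fix s assume "s \<in> X'"
    then obtain t where t: "t \<in> T" "s = (0, cis t)" unfolding X' by blast
    have "h (0, q * cis (\<sigma> t)) = (0, cis t)"
      using h_at[of "\<sigma> t"] T_bounds[OF \<sigma>_T(1)[OF t(1)]] \<sigma>_T(2)[OF t(1)] by simp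
    moreover have "(0, q * cis (\<sigma> t)) \<in> X" unfolding X using \<sigma>_T(1)[OF t(1)] by blast
    ultimately show "s \<in> h ` X" using t(2) by (metis imageI)
  qed
  obtain k where "homeomorphism X X' h k" using homeomorphism_compact[OF compX cont_h img inj_h] by blast
  moreover have "curve D' (h s) = curve D s \<and> decor D' (h s) = decor D s"
    if "s \<in> source D" "curve D s \<notin> interior B" for s
  proof -
    have "s \<in> X" using that by (simp add: X_def)
    then obtain t where t: "t \<in> T" "s = (0, q * cis t)" unfolding X by blast
    note tb = T_bounds[OF t(1)] T_bounds[OF \<sigma>_T(1)[OF t(1)]]
    have "h s = (0, cis (\<sigma> t))" using h_at t tb by simp
    then show ?thesis using D'_at[of "\<sigma> t"] tb c_T[OF \<sigma>_T(1)[OF t(1)]] \<sigma>_T[OF t(1)] t(2)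
      by (simp add: \<delta>_def)
  qed
  ultimately show ?thesis unfolding agree_outside_def X_def X'_def by blast
qed

lemma c_inj_B:
  assumes "0 \<le> s" "s < 2 * pi" "0 \<le> t" "t < 2 * pi" "c s = c t" "c s \<in> B" shows "s = t"
proof -
  have ps: "(e 1 \<le> s \<and> s \<le> e 7) \<or> (n 1 \<le> s \<and> s \<le> n 7)" using c_B(1)[OF assms(1,2)] assms(6) by simp
  have pt: "(e 1 \<le> t \<and> t \<le> e 7) \<or> (n 1 \<le> t \<and> t \<le> n 7)" using c_B(1)[OF assms(3,4)] assms(5,6) by simp
  define l where "l u = (u - e 1) / (e 7 - e 1)" for u
  define m where "m u = 3 * ((u - n 1) / (n 7 - n 1))" for u
  have l: "0 \<le> l u \<and> l u \<le> 1 \<and> norm (inner_cap (l u)) \<le> 40 \<and> c u = \<Phi> (inner_cap (l u))" if "e 1 \<le> u \<and> u \<le> e 7" for u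
  proof -
    have "0 \<le> l u" "l u \<le> 1" using that order by (auto simp: l_def)
    then show ?thesis using inner_cap_disk(1)[of "l u"] B_disk(4) c_inner[of u] that by (auto simp: subset_iff l_def)
  qed
  have m: "0 \<le> m u \<and> m u \<le> 3 \<and> norm (outer_cap (m u)) \<le> 40 \<and> c u = \<Phi> (outer_cap (m u))" if "n 1 \<le> u \<and> u \<le> n 7" for u
  proof -
    have "0 \<le> m u" "m u \<le> 3" using that order by (auto simp: m_def divide_simps)
    then show ?thesis using outer_cap_disk(1)[of "m u"] B_disk(4) c_outer[of u] that by (auto simp: subset_iff m_def)
  qed
  from ps pt show ?thesis
  proof (elim disjE)
    assume a: "e 1 \<le> s \<and> s \<le> e 7" "e 1 \<le> t \<and> t \<le> e 7"
    then have "inner_cap (l s) = inner_cap (l t)" using l[OF a(1)] l[OF a(2)] assms(5) \<Phi>_eq by metis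
    then have "l s = l t" by (simp add: inner_cap_def)
    then show ?thesis using order by (simp add: l_def)
  next
    assume a: "n 1 \<le> s \<and> s \<le> n 7" "n 1 \<le> t \<and> t \<le> n 7"
    then have "outer_cap (m s) = outer_cap (m t)" using m[OF a(1)] m[OF a(2)] assms(5) \<Phi>_eq by metis
    then have "m s = m t" by (rule inj_onD[OF outer_cap_inj]) (use m[OF a(1)] m[OF a(2)] in auto)
    then show ?thesis using order by (simp add: m_def)
  next
    assume a: "e 1 \<le> s \<and> s \<le> e 7" "n 1 \<le> t \<and> t \<le> n 7"
    then have "inner_cap (l s) = outer_cap (m t)" using l[OF a(1)] m[OF a(2)] assms(5) \<Phi>_eq by metis
    then show ?thesis using caps_disjoint m[OF a(2)] by blast
  next
    assume a: "n 1 \<le> s \<and> s \<le> n 7" "e 1 \<le> t \<and> t \<le> e 7"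
    then have "inner_cap (l t) = outer_cap (m s)" using l[OF a(2)] m[OF a(1)] assms(5) \<Phi>_eq by metis
    then show ?thesis using caps_disjoint m[OF a(1)] by blast
  qed
qed

lemma crossings_D'_B: "crossings D' \<inter> B = {}"
proof -
  have False if y: "y \<in> crossings D'" "y \<in> B" for y
  proof -
    obtain s1 s2 where s: "s1 \<in> source D'" "s2 \<in> source D'" "s1 \<noteq> s2" "curve D' s1 = y" "curve D' s2 = y"
      using y by (auto simp: crossings_def)
    obtain t1 where t1: "0 \<le> t1" "t1 < 2 * pi" "s1 = (0, cis t1)" using angle_D'[OF s(1)] .
    obtain t2 where t2: "0 \<le> t2" "t2 < 2 * pi" "s2 = (0, cis t2)" using angle_D'[OF s(2)] .
    have "t1 = t2" by (rule c_inj_B) (use t1 t2 s y D'_at in auto)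
    then show False using s(3) t1 t2 by simp
  qed
  then show ?thesis by blast
qed

lemma diagram_D': "virtual_link_diagram D'"
proof (rule virtual_link_diagram_local_change[OF diagram_D agree_D' B_disk(1) cont_D'])
  fix s assume s: "s \<in> source D'" "curve D' s \<in> B - crossings D'"
  obtain t where t: "0 \<le> t" "t < 2 * pi" "s = (0, cis t)" using angle_D'[OF s(1)] .
  show "decor D' s = Plain"
  proof (cases "t \<in> T")
    case True
    have "c t \<in> B" using s(2) D'_at(1)[OF t(1,2)] t(3) by simp
    then have "curve D (0, q * cis (\<sigma> t)) \<notin> crossings D"
      using crossings_B c_T[OF True] by (auto simp: \<delta>_def)
    then have "decor D (0, q * cis (\<sigma> t)) = Plain"
      using diagram_D in_source(1) unfolding virtual_link_diagram_def by blast
    then show ?thesis using D'_at(2)[OF t(1,2)] t(3) by simp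
  qed (use D'_at(2)[OF t(1,2)] t(3) in simp)
qed (use crossings_D'_B in auto)

lemma crossings_D': "crossings D' = crossings D"
proof -
  have "y \<in> crossings D' \<longleftrightarrow> y \<in> crossings D" for y
  proof (cases "y \<in> B")
    case True then show ?thesis using crossings_B crossings_D'_B by blast
  next
    case False
    then show ?thesis using crossings_agree_outside[OF agree_D'] interior_subset by blast
  qed
  then show ?thesis by blast
qed

end

section \<open>Removing the kink\<close>

text \<open>The segment from \<open>-28\<close> to \<open>-28\<i>\<close>, a chord of the disk that contains the kink.\<close>

definition chord :: "real \<Rightarrow> complex" where "chord t = Complex (28 * t - 28) (- 28 * t)"

lemma chord_disk:
  assumes "0 \<le> t" "t \<le> 1"
  shows "chord t \<in> cball kink_centre 20" "chord t \<in> sphere kink_centre 20 \<longleftrightarrow> t = 0 \<or> t = 1"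
proof -
  have 1: "(28 * t - 28 - (-12))\<^sup>2 + (- 28 * t - (-12))\<^sup>2 = 20\<^sup>2 - 1568 * (t * (1 - t))"
    by (simp add: power2_eq_square algebra_simps)
  have 2: "0 \<le> t * (1 - t)" using assms by simp
  show "chord t \<in> cball kink_centre 20" "chord t \<in> sphere kink_centre 20 \<longleftrightarrow> t = 0 \<or> t = 1"
    unfolding in_disk_iff[OF zero_less_numeral] chord_def complex.sel 1 using 2 by auto
qed

context crossing_frame
begin

text \<open>
  After the H(2)-move the kink is passed between the angles \<open>tE\<close> and \<open>tN\<close>: from \<open>-28\<close> through the crossing to \<open>1\<close>,
  along the inner cap to \<open>\<i>\<close>, and through the crossing again to \<open>-28\<i>\<close>.
\<close>

definition "tE = e (-28)"
definition "tN = e 7 + n 1 - n (-28)"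

lemma tE_tN: "0 < tE" "tE < e 1" "e 7 < tN" "tN < n 1" "tE < tN" "tN < 2 * pi"
  using order unfolding tE_def tN_def by linarith+

definition "detour t = (0::nat, cis (tE + t * (tN - tE)))"

lemma detour_angle: assumes "0 \<le> t" "t \<le> 1"
  shows "tE \<le> tE + t * (tN - tE)" "tE + t * (tN - tE) \<le> tN"
    "0 \<le> tE + t * (tN - tE)" "tE + t * (tN - tE) < 2 * pi"
    "tE + t * (tN - tE) = tE \<longleftrightarrow> t = 0" "tE + t * (tN - tE) = tN \<longleftrightarrow> t = 1"
proof -
  have 1: "0 \<le> t * (tN - tE)" "t * (tN - tE) \<le> tN - tE" using assms tE_tN by (simp_all add: mult_left_le_one_le)
  show "tE \<le> tE + t * (tN - tE)" "tE + t * (tN - tE) \<le> tN"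
    "0 \<le> tE + t * (tN - tE)" "tE + t * (tN - tE) < 2 * pi" using 1 tE_tN by linarith+
  show "tE + t * (tN - tE) = tE \<longleftrightarrow> t = 0" using tE_tN by simp
  have "tE + t * (tN - tE) = tN \<longleftrightarrow> (t - 1) * (tN - tE) = 0" by (auto simp: algebra_simps)
  then show "tE + t * (tN - tE) = tN \<longleftrightarrow> t = 1" using tE_tN by simp
qed

lemma curve_detour: "0 \<le> t \<Longrightarrow> t \<le> 1 \<Longrightarrow> curve D' (detour t) = c (tE + t * (tN - tE))"
  using D'_at(1) detour_angle unfolding detour_def by simp

lemma strands_detour: "strands D' K 1 (\<lambda>_. detour)"
  unfolding strands_single
proof (intro conjI ballI)
  show "arc detour" unfolding arc_def path_def
  proof
    show "continuous_on {0..1} detour" unfolding detour_def by (intro continuous_intros)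
    show "inj_on detour {0..1}"
    proof (rule inj_onI)
      fix s t assume st: "s \<in> {0..1}" "t \<in> {0..1}" "detour s = detour t"
      then have "tE + s * (tN - tE) = tE + t * (tN - tE)"
        using cis_eq[OF detour_angle(3,4) detour_angle(3,4), of s t] by (simp add: detour_def)
      then show "s = t" using tE_tN by simp
    qed
  qed
  show "path_image detour = {s \<in> source D'. curve D' s \<in> K}"
  proof (intro set_eqI iffI)
    fix s assume "s \<in> path_image detour"
    then obtain t where t: "0 \<le> t" "t \<le> 1" "s = detour t" by (auto simp: path_image_def)
    then show "s \<in> {s \<in> source D'. curve D' s \<in> K}"
      using curve_detour[OF t(1,2)] c_K(1)[OF detour_angle(3,4)[OF t(1,2)]] detour_angle(1,2)[OF t(1,2)] in_source(2)
      by (simp add: tE_def tN_def detour_def)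
  next
    fix s assume s: "s \<in> {s \<in> source D'. curve D' s \<in> K}"
    then obtain t where t: "0 \<le> t" "t < 2 * pi" "s = (0, cis t)" using angle_D' by blast
    then have b: "tE \<le> t" "t \<le> tN" using s c_K(1)[OF t(1,2)] D'_at(1)[OF t(1,2)] by (simp_all add: tE_def tN_def)
    define l where "l = (t - tE) / (tN - tE)"
    have "0 \<le> l" "l \<le> 1" "t = tE + l * (tN - tE)" using b tE_tN by (simp_all add: l_def)
    then have "l \<in> {0..1}" "s = detour l" using t(3) by (simp_all add: detour_def)
    then show "s \<in> path_image detour" unfolding path_image_def by blast
  qed
  show "curve D' (detour t) \<in> frontier K \<longleftrightarrow> t = 0 \<or> t = 1" if "t \<in> {0..1}" for t
  proof -
    have t: "0 \<le> t" "t \<le> 1" using that by auto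
    show ?thesis
      unfolding curve_detour[OF t] c_K(2)[OF detour_angle(3,4)[OF t]] tE_def[symmetric] tN_def[symmetric]
        detour_angle(5,6)[OF t] ..
  qed
  have "x \<notin> frontier K"
  proof -
    have "norm (0::complex) \<le> 40" by simp
    moreover have "0 \<notin> sphere kink_centre 20" using real_axis_disk(4)[of 0] by simp
    ultimately show ?thesis using \<Phi>_mem[of 0, OF _ K_disk(5)] F(4) K_disk(2) by simp
  qed
  then show "crossings D' \<inter> frontier K = {}"
    using crossings_K crossings_D' K_disk(1) by (auto simp: frontier_def)
qed

lemma chord_norm: "0 \<le> t \<Longrightarrow> t \<le> 1 \<Longrightarrow> norm (chord t) \<le> 40"
  using chord_disk(1) K_disk(4) by (auto simp: subset_iff)

lemma unkinked_replacement: "strand_replacement D' K detour (\<lambda>t. \<Phi> (chord t)) (\<lambda>_. Plain)"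
proof
  show "virtual_link_diagram D'" by (rule diagram_D')
  show "strands D' K 1 (\<lambda>_. detour)" by (rule strands_detour)
  show "closed K" by (rule K_disk)
  show "path (\<lambda>t. \<Phi> (chord t))" unfolding path_def
  proof (rule continuous_on_compose2[OF F(2)])
    show "continuous_on {0..1} chord" unfolding chord_def Complex_eq by (intro continuous_intros)
    show "chord ` {0..1} \<subseteq> ball 0 50" using chord_norm by fastforce
  qed
  have T: "tE \<in> T" "\<sigma> tE = e (-28)" "tN \<in> T" "\<sigma> tN = n (-28)"
    using tE_tN order by (auto simp: T_def \<sigma>_def tE_def tN_def)
  have "curve D' (detour 0) = \<delta> (e (-28))" using curve_detour[of 0] c_T[OF T(1)] T(2) by simp
  then show "\<Phi> (chord 0) = curve D' (detour 0)"
    using \<delta>_e[of "-28"] by (simp add: chord_def Complex_eq)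
  have "curve D' (detour 1) = \<delta> (n (-28))" using curve_detour[of 1] c_T[OF T(3)] T(4) by simp
  then show "\<Phi> (chord 1) = curve D' (detour 1)"
    using \<delta>_n[of "-28"] by (simp add: chord_def Complex_eq)
  fix t :: real assume "t \<in> {0..1}"
  then have t: "0 \<le> t" "t \<le> 1" by auto
  show "\<Phi> (chord t) \<in> K" using chord_disk(1)[OF t] by blast
  show "\<Phi> (chord t) \<in> frontier K \<longleftrightarrow> t = 0 \<or> t = 1"
    unfolding K_disk(2) \<Phi>_mem[OF chord_norm[OF t] K_disk(5)] by (rule chord_disk(2)[OF t])
qed simp_all

interpretation U: strand_replacement D' K detour "\<lambda>t. \<Phi> (chord t)" "\<lambda>_. Plain"
  by (rule unkinked_replacement)

lemma unkinked:
  "\<exists>E. virtual_knot_diagram E \<and> generalized_reidemeister_move D' E \<and> crossings E = crossings D - {x}"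
proof -
  have inj: "inj_on (\<lambda>t. \<Phi> (chord t)) {0..1}"
  proof (rule inj_onI)
    fix s t :: real assume "s \<in> {0..1}" "t \<in> {0..1}" "\<Phi> (chord s) = \<Phi> (chord t)"
    then have "chord s = chord t" using \<Phi>_eq[OF chord_norm chord_norm, of s t] by simp
    then show "s = t" by (simp add: chord_def)
  qed
  have x: "crossings D' \<inter> K = {x}" using crossings_D' crossings_K by simp
  note u = U.unkink[OF inj refl K_disk(3) x]
  have "virtual_knot_diagram U.E" using u(1) by (simp add: virtual_knot_diagram_def D'_def)
  moreover have "generalized_reidemeister_move D' U.E" using u(2) unfolding generalized_reidemeister_move_def by blast
  moreover have "crossings U.E = crossings D - {x}" using u(3) crossings_D' by simp
  ultimately show ?thesis by blast
qed

end

section \<open>The band move is an extendable H(2)-move\<close>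

text \<open>
  Coordinates at the endpoint \<open>7\<close> of the H(2)-move: the horizontal line at height \<open>Y\<close> above \<open>4+4\<i>\<close> meets the right half of
  the circle in the abscissa \<open>4 + sqrt (25 - Y\<^sup>2)\<close>, and this point is taken to the imaginary axis. The real axis is at
  \<open>Y = -4\<close>, and the values stay so close to \<open>7\<close> that of both diagrams only the real axis is seen.
\<close>

definition near_end :: "complex \<Rightarrow> complex" where
  "near_end z = Complex (4 + sqrt (25 - (squash (Im z) - 4)\<^sup>2) + squash (Re z)) (squash (Im z))"

lemma near_end_root:
  fixes y :: real assumes "\<bar>y\<bar> < 1/2"
  shows "2 \<le> sqrt (25 - (y - 4)\<^sup>2)" "sqrt (25 - (y - 4)\<^sup>2) \<le> 5"
    "0 \<le> y \<Longrightarrow> 3 \<le> sqrt (25 - (y - 4)\<^sup>2)" "(y - 4)\<^sup>2 \<le> 25"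
proof -
  have b: "\<bar>y - 4\<bar> \<le> 9/2" using assms by linarith
  have "(y - 4)\<^sup>2 \<le> (9/2)\<^sup>2" using power_mono[OF b, of 2] by simp
  then have sq: "(y - 4)\<^sup>2 \<le> 21" by (simp add: power2_eq_square)
  then show "(y - 4)\<^sup>2 \<le> 25" by simp
  show "2 \<le> sqrt (25 - (y - 4)\<^sup>2)" by (rule real_le_rsqrt) (use sq in simp)
  show "sqrt (25 - (y - 4)\<^sup>2) \<le> 5" by (rule real_le_lsqrt) (use sq in simp_all)
  assume "0 \<le> y"
  then have "\<bar>y - 4\<bar> \<le> 4" using assms by linarith
  then have "(y - 4)\<^sup>2 \<le> 4\<^sup>2" using power_mono[of "\<bar>y - 4\<bar>" 4 2] by simp
  then show "3 \<le> sqrt (25 - (y - 4)\<^sup>2)" by (intro real_le_rsqrt) simp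
qed

lemma near_end_props:
  shows "5 < Re (near_end z)" "norm (near_end z) \<le> 40"
    "0 \<le> Im (near_end z) \<Longrightarrow> 6 < Re (near_end z)"
    "near_end z \<in> cball band_centre 5 \<longleftrightarrow> Re z \<le> 0"
    "Im z = 0 \<Longrightarrow> near_end z = of_real (7 + squash (Re z))"
    "Im (near_end z) = 0 \<longleftrightarrow> Im z = 0"
proof -
  note y = squash_bound[of "Im z"] and x = squash_bound[of "Re z"]
  note R = near_end_root[OF y]
  define r where "r = sqrt (25 - (squash (Im z) - 4)\<^sup>2)"
  note R = R[folded r_def]
  have ne: "near_end z = Complex (4 + r + squash (Re z)) (squash (Im z))" by (simp add: near_end_def r_def)
  show "5 < Re (near_end z)" using R(1) x unfolding ne by simp
  show "norm (near_end z) \<le> 40"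
    using cmod_le[of "near_end z"] R(1,2) x y unfolding ne by simp
  show "0 \<le> Im (near_end z) \<Longrightarrow> 6 < Re (near_end z)" using R(3) x unfolding ne by simp
  have "squash (Im z) = 0 \<longleftrightarrow> Im z = 0"
    using strict_mono_eq[OF squash_mono, of "Im z" 0] squash_sign(2) by simp
  then show "Im (near_end z) = 0 \<longleftrightarrow> Im z = 0" by (simp add: ne)
  show "near_end z = of_real (7 + squash (Re z))" if "Im z = 0"
  proof -
    have "r = 3" by (simp add: r_def that squash_sign(2) real_sqrt_unique)
    then show ?thesis by (simp add: ne that squash_sign(2) complex_eq_iff)
  qed
  have r2: "r\<^sup>2 = 25 - (squash (Im z) - 4)\<^sup>2" using R(4) by (simp add: r_def)
  have "near_end z \<in> cball band_centre 5 \<longleftrightarrow> (r + squash (Re z))\<^sup>2 + (squash (Im z) - 4)\<^sup>2 \<le> 25"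
    unfolding in_disk_iff[OF zero_less_numeral] ne by simp
  also have "(r + squash (Re z))\<^sup>2 + (squash (Im z) - 4)\<^sup>2 = 25 + squash (Re z) * (2 * r + squash (Re z))"
    using r2 by (simp add: power2_eq_square algebra_simps)
  also have "\<dots> \<le> 25 \<longleftrightarrow> squash (Re z) \<le> 0"
  proof -
    have "0 < 2 * r + squash (Re z)" using R(1) x by linarith
    then show ?thesis by (simp add: mult_le_0_iff)
  qed
  finally show "near_end z \<in> cball band_centre 5 \<longleftrightarrow> Re z \<le> 0" using squash_sign(1) by simp
qed

lemma near_end_inj: "inj near_end"
proof (rule injI)
  fix z w assume eq: "near_end z = near_end w"
  have "squash (Im z) = squash (Im w)" using arg_cong[OF eq, of Im] by (simp add: near_end_def)
  moreover from this have "squash (Re z) = squash (Re w)" using arg_cong[OF eq, of Re] by (simp add: near_end_def)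
  ultimately show "z = w" using strict_mono_eq[OF squash_mono] by (simp add: complex_eq_iff)
qed

lemma near_end_cont: "continuous_on UNIV near_end"
  unfolding near_end_def Complex_eq
  by (intro continuous_intros continuous_on_compose2[OF continuous_squash[of UNIV]]) auto

context crossing_frame
begin

text \<open>
  The endpoints in cyclic order are \<open>7\<i>\<close>, \<open>\<i>\<close>, \<open>1\<close>, \<open>7\<close>; the angles \<open>\<theta>\<close> come from the triangle with sides
  \<open>3\<close>, \<open>4\<close>, \<open>5\<close>. The map \<open>back\<close> gives the angle at which the new knot passes the real axis near \<open>7\<close>: to the
  left of \<open>7\<close> on the outer cap, to the right of it on the reversed middle part.
\<close>

definition "\<phi> z = \<Phi> (band_centre + 5 * z)"
definition "\<theta> j = (if j = 0 then pi - arcsin (3/5) else if j = 1 then pi + arcsin (3/5)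
   else if j = 2 then pi + arcsin (4/5) else 2 * pi - arcsin (4/5))" for j :: nat
definition "\<alpha> i = (if i = 0 then (\<lambda>t. (0::nat, q * cis (n (7 - 6 * t)))) else (\<lambda>t. (0, q * cis (e (1 + 6 * t)))))"
  for i :: nat
definition "\<alpha>' i = (if i = 0 then (\<lambda>t. (0::nat, cis (e 7 - t * (e 7 - e 1)))) else (\<lambda>t. (0, cis (n 1 + t * (n 7 - n 1)))))"
  for i :: nat
definition "\<tau> z = \<Phi> (near_end z)"
definition "ang y = 2 * pi + arcsin ((squash y - 4) / 5)"
definition "g v = (0::nat, q * cis (e (7 + squash v)))"
definition "back v = n 1 - (n 7 - n 1) * (min 0 (squash v) / 3) + (e 7 - e (7 + max 0 (squash v)))"
definition "g' v = (0::nat, cis (back v))"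

lemma disk_param: "\<exists>\<phi>'. homeomorphism (cball 0 1) B \<phi> \<phi>'"
proof (rule homeomorphism_compact)
  have n: "norm (band_centre + 5 * z) \<le> 40" "band_centre + 5 * z \<in> cball band_centre 5" if "z \<in> cball 0 1" for z
  proof -
    show "band_centre + 5 * z \<in> cball band_centre 5" using that by (simp add: dist_norm norm_mult)
    then show "norm (band_centre + 5 * z) \<le> 40" using B_disk(4) by (auto simp: subset_iff)
  qed
  show "continuous_on (cball 0 1) \<phi>" unfolding \<phi>_def
    by (rule continuous_on_compose2[OF F(2)]) (use n in \<open>fastforce intro!: continuous_intros\<close>)+
  show "inj_on \<phi> (cball 0 1)"
    by (rule inj_onI) (use n \<Phi>_eq in \<open>force simp: \<phi>_def\<close>)
  have "(\<lambda>z. band_centre + 5 * z) ` cball 0 1 = cball band_centre 5"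
  proof (intro set_eqI iffI)
    fix w assume w: "w \<in> cball band_centre 5"
    then have "norm ((w - band_centre) / 5) \<le> 1" by (simp add: norm_divide dist_norm norm_minus_commute)
    moreover have "w = b + 5 * ((w - b) / 5)" for b by (simp add: field_simps)
    then have "w = band_centre + 5 * ((w - band_centre) / 5)" .
    ultimately show "w \<in> (\<lambda>z. band_centre + 5 * z) ` cball 0 1" by (metis imageI mem_cball_0)
  qed (use n in auto)
  then show "\<phi> ` cball 0 1 = B" unfolding \<phi>_def by (metis image_image)
qed simp

lemma arcsin_vals: "cos (arcsin (3/5)) = 4/5" "cos (arcsin (4/5)) = 3/5" "sin (arcsin (3/5)) = 3/5"
  "sin (arcsin (4/5)) = 4/5" "0 < arcsin (3/5)" "arcsin (3/5) < arcsin (4/5)" "arcsin (4/5) < pi / 2"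
proof -
  show "cos (arcsin (3/5)) = 4/5" "cos (arcsin (4/5)) = 3/5"
  proof -
    have "sqrt (1 - (3/5)\<^sup>2) = 4/5" "sqrt (1 - (4/5)\<^sup>2) = 3/5"
      by (rule real_sqrt_unique; simp add: power2_eq_square)+
    then show "cos (arcsin (3/5)) = 4/5" "cos (arcsin (4/5)) = 3/5"
      using cos_arcsin[of "3/5"] cos_arcsin[of "4/5"] by simp_all
  qed
  show "sin (arcsin (3/5)) = 3/5" "sin (arcsin (4/5)) = 4/5" by simp_all
  show "0 < arcsin (3/5)" using arcsin_less_mono[of 0 "3/5"] by simp
  show "arcsin (3/5) < arcsin (4/5)" by (subst arcsin_less_mono) simp_all
  show "arcsin (4/5) < pi / 2" using arcsin_lt_bounded[of "4/5"] by simp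
qed

lemma points: "\<phi> (cis (\<theta> 0)) = \<Phi> (7 * \<i>)" "\<phi> (cis (\<theta> 1)) = \<Phi> \<i>" "\<phi> (cis (\<theta> 2)) = \<Phi> 1" "\<phi> (cis (\<theta> 3)) = \<Phi> 7"
proof -
  have "band_centre + 5 * cis (\<theta> 0) = 7 * \<i>" "band_centre + 5 * cis (\<theta> 1) = \<i>"
    "band_centre + 5 * cis (\<theta> 2) = 1" "band_centre + 5 * cis (\<theta> 3) = 7"
    by (simp_all add: \<theta>_def complex_eq_iff cos_diff cos_add sin_diff sin_add arcsin_vals)
  then show "\<phi> (cis (\<theta> 0)) = \<Phi> (7 * \<i>)" "\<phi> (cis (\<theta> 1)) = \<Phi> \<i>" "\<phi> (cis (\<theta> 2)) = \<Phi> 1" "\<phi> (cis (\<theta> 3)) = \<Phi> 7"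
    unfolding \<phi>_def by simp_all
qed

lemma \<theta>_order: "0 \<le> \<theta> 0" "\<theta> 0 < \<theta> 1" "\<theta> 1 < \<theta> 2" "\<theta> 2 < \<theta> 3" "\<theta> 3 < 2 * pi"
  using arcsin_vals pi_gt_zero by (simp_all add: \<theta>_def)

lemma strands2I:
  assumes "arc (a 0)" "arc (a 1)" "path_image (a 0) \<inter> path_image (a 1) = {}"
    "path_image (a 0) \<union> path_image (a 1) = {s \<in> source E. curve E s \<in> C}"
    "\<And>t. t \<in> {0..1} \<Longrightarrow> curve E (a 0 t) \<in> frontier C \<longleftrightarrow> t = 0 \<or> t = 1"
    "\<And>t. t \<in> {0..1} \<Longrightarrow> curve E (a 1 t) \<in> frontier C \<longleftrightarrow> t = 0 \<or> t = 1"
    "crossings E \<inter> frontier C = {}"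
  shows "strands E C 2 a"
proof -
  have "{..<2} = {0, 1::nat}" by auto
  then have "(\<Union>i<2. path_image (a i)) = path_image (a 0) \<union> path_image (a 1)" by simp
  then show ?thesis unfolding strands_def using assms
    by (auto simp: less_2_cases_iff Int_commute)
qed

lemma param_arc:
  assumes "continuous_on {0..1} f" "\<And>s t. s \<in> {0..1} \<Longrightarrow> t \<in> {0..1} \<Longrightarrow> f s = f t \<Longrightarrow> s = t"
    "\<And>t. t \<in> {0..1} \<Longrightarrow> 0 \<le> f t \<and> f t < 2 * pi" "w \<noteq> 0"
  shows "arc (\<lambda>t. (0::nat, w * cis (f t)))"
  unfolding arc_def path_def
proof
  show "continuous_on {0..1} (\<lambda>t. (0::nat, w * cis (f t)))"
    by (intro continuous_intros assms(1) continuous_on_compose2[OF continuous_on_cis[OF continuous_on_id]])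
  show "inj_on (\<lambda>t. (0::nat, w * cis (f t))) {0..1}"
  proof (rule inj_onI)
    fix s t :: real assume st: "s \<in> {0..1}" "t \<in> {0..1}" "(0::nat, w * cis (f s)) = (0, w * cis (f t))"
    then have "f s = f t" using cis_eq[of "f s" "f t"] assms(3)[of s] assms(3)[of t] assms(4) by simp
    then show "s = t" using assms(2) st by blast
  qed
qed

lemma no_crossings_frontier: "crossings D \<inter> frontier B = {}" "crossings D' \<inter> frontier B = {}"
  using crossings_B crossings_D'_B B_disk(1) by (auto simp: frontier_def)

lemma strands_D: "strands D B 2 \<alpha>"
proof (rule strands2I)
  note One_nat_def [simp del]
  have en: "7 - 6 * t \<in> {-40..40}" "1 + 6 * t \<in> {-40..40}" if "t \<in> {0..1}" for t :: real using that by auto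
  have a0: "\<alpha> 0 = (\<lambda>t. (0, q * cis (n (7 - 6 * t))))" and a1: "\<alpha> 1 = (\<lambda>t. (0, q * cis (e (1 + 6 * t))))"
    by (simp_all add: \<alpha>_def)
  have n_eq: "n u = n v \<longleftrightarrow> u = v" and e_eq: "e u = e v \<longleftrightarrow> u = v" if "u \<in> {-40..40}" "v \<in> {-40..40}" for u v
    using n_le[OF that] n_le[OF that(2,1)] e_le[OF that] e_le[OF that(2,1)] by auto
  show "arc (\<alpha> 0)" unfolding a0
  proof (rule param_arc)
    show "continuous_on {0..1} (\<lambda>t. n (7 - 6 * t))"
      by (rule continuous_on_compose2[OF F(6)]) (auto intro!: continuous_intros)
    show "s = t" if "s \<in> {0..1}" "t \<in> {0..1}" "n (7 - 6 * s) = n (7 - 6 * t)" for s t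
      using that n_eq[OF en(1) en(1), of s t] by simp
    show "0 \<le> n (7 - 6 * t) \<and> n (7 - 6 * t) < 2 * pi" if "t \<in> {0..1}" for t
      using F(8)[OF en(1)[OF that]] by simp
  qed (rule q0)
  show "arc (\<alpha> 1)" unfolding a1
  proof (rule param_arc)
    show "continuous_on {0..1} (\<lambda>t. e (1 + 6 * t))"
      by (rule continuous_on_compose2[OF F(5)]) (auto intro!: continuous_intros)
    show "s = t" if "s \<in> {0..1}" "t \<in> {0..1}" "e (1 + 6 * s) = e (1 + 6 * t)" for s t
      using that e_eq[OF en(2) en(2), of s t] by simp
    show "0 \<le> e (1 + 6 * t) \<and> e (1 + 6 * t) < 2 * pi" if "t \<in> {0..1}" for t
      using F(7)[OF en(2)[OF that]] by simp
  qed (rule q0)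
  show "path_image (\<alpha> 0) \<inter> path_image (\<alpha> 1) = {}"
  proof -
    have False if st: "s \<in> {0..1}" "t \<in> {0..1}" "\<alpha> 0 s = \<alpha> 1 t" for s t
    proof -
      have "n (7 - 6 * s) = e (1 + 6 * t)"
        using st(3)[unfolded a0 a1] cis_eq[of "n (7 - 6 * s)" "e (1 + 6 * t)"] F(8)[OF en(1)[OF st(1)]] F(7)[OF en(2)[OF st(2)]] q0
        by simp
      then show False using e_n[OF en(2)[OF st(2)] en(1)[OF st(1)]] by simp
    qed
    then show ?thesis unfolding path_image_def by blast
  qed
  have at: "curve D (\<alpha> 0 t) = \<delta> (n (7 - 6 * t))" "curve D (\<alpha> 1 t) = \<delta> (e (1 + 6 * t))" for t
    by (simp_all add: a0 a1 \<delta>_def)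
  show "path_image (\<alpha> 0) \<union> path_image (\<alpha> 1) = {s \<in> source D. curve D s \<in> B}"
  proof (intro set_eqI iffI)
    fix s assume "s \<in> path_image (\<alpha> 0) \<union> path_image (\<alpha> 1)"
    then consider t where "t \<in> {0..1}" "s = \<alpha> 0 t" | t where "t \<in> {0..1}" "s = \<alpha> 1 t"
      unfolding path_image_def by blast
    then show "s \<in> {s \<in> source D. curve D s \<in> B}"
    proof cases
      case (1 t)
      have "n 1 \<le> n (7 - 6 * t)" "n (7 - 6 * t) \<le> n 7" using 1(1) n_le[OF _ en(1)[OF 1(1)]] n_le[OF en(1)[OF 1(1)]] by auto
      then show ?thesis unfolding 1(2)
        using \<delta>_B(1)[of "n (7 - 6 * t)"] F(8)[OF en(1)[OF 1(1)]] at(1)[of t] in_source(1) by (simp add: a0)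
    next
      case (2 t)
      have "e 1 \<le> e (1 + 6 * t)" "e (1 + 6 * t) \<le> e 7" using 2(1) e_le[OF _ en(2)[OF 2(1)]] e_le[OF en(2)[OF 2(1)]] by auto
      then show ?thesis unfolding 2(2)
        using \<delta>_B(1)[of "e (1 + 6 * t)"] F(7)[OF en(2)[OF 2(1)]] at(2)[of t] in_source(1) by (simp add: a1)
    qed
  next
    fix s assume s: "s \<in> {s \<in> source D. curve D s \<in> B}"
    then obtain t where t: "0 \<le> t" "t < 2 * pi" "s = (0, q * cis t)" using angle_D by blast
    then have "e 1 \<le> t \<and> t \<le> e 7 \<or> n 1 \<le> t \<and> t \<le> n 7" using s \<delta>_B(1)[OF t(1,2)] by (simp add: \<delta>_def)
    then show "s \<in> path_image (\<alpha> 0) \<union> path_image (\<alpha> 1)"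
    proof (elim disjE conjE)
      assume "e 1 \<le> t" "t \<le> e 7"
      then obtain u where u: "1 \<le> u" "u \<le> 7" "t = e u" by (rule e_onto) auto
      have "1 + 6 * ((u - 1) / 6) = u" by (simp add: field_simps)
      then have "s = \<alpha> 1 ((u - 1) / 6)" "(u - 1) / 6 \<in> {0..1}" using u t by (simp_all add: a1)
      then show ?thesis unfolding path_image_def by blast
    next
      assume "n 1 \<le> t" "t \<le> n 7"
      then obtain u where u: "1 \<le> u" "u \<le> 7" "t = n u" by (rule n_onto) auto
      have "7 - 6 * ((7 - u) / 6) = u" by (simp add: field_simps)
      then have "s = \<alpha> 0 ((7 - u) / 6)" "(7 - u) / 6 \<in> {0..1}" using u t by (simp_all add: a0)
      then show ?thesis unfolding path_image_def by blast
    qed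
  qed
  have 17: "(1::real) \<in> {-40..40}" "(7::real) \<in> {-40..40}" by auto
  show "curve D (\<alpha> 0 t) \<in> frontier B \<longleftrightarrow> t = 0 \<or> t = 1" if "t \<in> {0..1}" for t
  proof -
    note m = en(1)[OF that]
    have "n (7 - 6 * t) \<noteq> e 1" "n (7 - 6 * t) \<noteq> e 7" using e_n[OF 17(1) m] e_n[OF 17(2) m] by auto
    then show ?thesis
      using \<delta>_B(2)[of "n (7 - 6 * t)"] F(8)[OF m] n_eq[OF m 17(1)] n_eq[OF m 17(2)] by (auto simp: at)
  qed
  show "curve D (\<alpha> 1 t) \<in> frontier B \<longleftrightarrow> t = 0 \<or> t = 1" if "t \<in> {0..1}" for t
  proof -
    note m = en(2)[OF that]
    have "e (1 + 6 * t) \<noteq> n 1" "e (1 + 6 * t) \<noteq> n 7" using e_n[OF m 17(1)] e_n[OF m 17(2)] by auto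
    then show ?thesis
      using \<delta>_B(2)[of "e (1 + 6 * t)"] F(7)[OF m] e_eq[OF m 17(1)] e_eq[OF m 17(2)] by (auto simp: at)
  qed
qed (rule no_crossings_frontier)

lemma strands_D': "strands D' B 2 \<alpha>'"
proof (rule strands2I)
  note One_nat_def [simp del]
  have a0: "\<alpha>' 0 = (\<lambda>t. (0, 1 * cis (e 7 - t * (e 7 - e 1))))" and a1: "\<alpha>' 1 = (\<lambda>t. (0, 1 * cis (n 1 + t * (n 7 - n 1))))"
    by (simp_all add: \<alpha>'_def)
  have r0: "e 1 \<le> e 7 - t * (e 7 - e 1)" "e 7 - t * (e 7 - e 1) \<le> e 7"
    and r1: "n 1 \<le> n 1 + t * (n 7 - n 1)" "n 1 + t * (n 7 - n 1) \<le> n 7" if "t \<in> {0..1}" for t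
  proof -
    have "0 \<le> t * d \<and> t * d \<le> d" if "0 < d" for d
      using that \<open>t \<in> {0..1}\<close> by (simp add: mult_left_le_one_le)
    from this[of "e 7 - e 1"] this[of "n 7 - n 1"]
    show "e 1 \<le> e 7 - t * (e 7 - e 1)" "e 7 - t * (e 7 - e 1) \<le> e 7"
      "n 1 \<le> n 1 + t * (n 7 - n 1)" "n 1 + t * (n 7 - n 1) \<le> n 7"
      using order by linarith+
  qed
  have b0: "0 \<le> e 7 - t * (e 7 - e 1)" "e 7 - t * (e 7 - e 1) < 2 * pi"
    and b1: "0 \<le> n 1 + t * (n 7 - n 1)" "n 1 + t * (n 7 - n 1) < 2 * pi" if "t \<in> {0..1}" for t
    using r0[OF that] r1[OF that] order by linarith+
  show "arc (\<alpha>' 0)" unfolding a0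
    by (rule param_arc) (use order b0 in \<open>auto intro!: continuous_intros\<close>)
  show "arc (\<alpha>' 1)" unfolding a1
    by (rule param_arc) (use order b1 in \<open>auto intro!: continuous_intros\<close>)
  show "path_image (\<alpha>' 0) \<inter> path_image (\<alpha>' 1) = {}"
  proof -
    have False if st: "s \<in> {0..1}" "t \<in> {0..1}" "\<alpha>' 0 s = \<alpha>' 1 t" for s t
    proof -
      have "e 7 - s * (e 7 - e 1) = n 1 + t * (n 7 - n 1)"
        using st(3)[unfolded a0 a1] cis_eq[OF b0[OF st(1)] b1[OF st(2)]] by simp
      then show False using r0[OF st(1)] r1[OF st(2)] order by linarith
    qed
    then show ?thesis unfolding path_image_def by blast
  qed
  have at: "curve D' (\<alpha>' 0 t) = c (e 7 - t * (e 7 - e 1))" "curve D' (\<alpha>' 1 t) = c (n 1 + t * (n 7 - n 1))"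
    if "t \<in> {0..1}" for t
    using D'_at(1)[OF b0[OF that]] D'_at(1)[OF b1[OF that]] by (simp_all add: a0 a1)
  show "path_image (\<alpha>' 0) \<union> path_image (\<alpha>' 1) = {s \<in> source D'. curve D' s \<in> B}"
  proof (intro set_eqI iffI)
    fix s assume "s \<in> path_image (\<alpha>' 0) \<union> path_image (\<alpha>' 1)"
    then consider t where "t \<in> {0..1}" "s = \<alpha>' 0 t" | t where "t \<in> {0..1}" "s = \<alpha>' 1 t"
      unfolding path_image_def by blast
    then show "s \<in> {s \<in> source D'. curve D' s \<in> B}"
    proof cases
      case (1 t)
      have "s \<in> source D'" unfolding 1(2) a0 using in_source(2) by simp
      then show ?thesis using c_B(1)[OF b0[OF 1(1)]] r0[OF 1(1)] at(1)[OF 1(1)] 1(2) by simp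
    next
      case (2 t)
      have "s \<in> source D'" unfolding 2(2) a1 using in_source(2) by simp
      then show ?thesis using c_B(1)[OF b1[OF 2(1)]] r1[OF 2(1)] at(2)[OF 2(1)] 2(2) by simp
    qed
  next
    fix s assume s: "s \<in> {s \<in> source D'. curve D' s \<in> B}"
    then obtain t where t: "0 \<le> t" "t < 2 * pi" "s = (0, cis t)" using angle_D' by blast
    then have "e 1 \<le> t \<and> t \<le> e 7 \<or> n 1 \<le> t \<and> t \<le> n 7"
      using s c_B(1)[OF t(1,2)] D'_at(1)[OF t(1,2)] by simp
    then show "s \<in> path_image (\<alpha>' 0) \<union> path_image (\<alpha>' 1)"
    proof (elim disjE conjE)
      assume b: "e 1 \<le> t" "t \<le> e 7"
      define l where "l = (e 7 - t) / (e 7 - e 1)"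
      have "l \<in> {0..1}" "t = e 7 - l * (e 7 - e 1)" using b order by (simp_all add: l_def)
      then have "s = \<alpha>' 0 l" "l \<in> {0..1}" using t by (simp_all add: a0)
      then show ?thesis unfolding path_image_def by blast
    next
      assume b: "n 1 \<le> t" "t \<le> n 7"
      define l where "l = (t - n 1) / (n 7 - n 1)"
      have "l \<in> {0..1}" "t = n 1 + l * (n 7 - n 1)" using b order by (simp_all add: l_def)
      then have "s = \<alpha>' 1 l" "l \<in> {0..1}" using t by (simp_all add: a1)
      then show ?thesis unfolding path_image_def by blast
    qed
  qed
  show "curve D' (\<alpha>' 0 t) \<in> frontier B \<longleftrightarrow> t = 0 \<or> t = 1" if t: "t \<in> {0..1}" for t
  proof -
    have "e 7 - t * (e 7 - e 1) = e 7 \<longleftrightarrow> t = 0" using order by simp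
    moreover have "e 7 - t * (e 7 - e 1) = e 1 \<longleftrightarrow> (1 - t) * (e 7 - e 1) = 0" by (auto simp: algebra_simps)
    moreover have "(1 - t) * (e 7 - e 1) = 0 \<longleftrightarrow> t = 1" using order by simp
    moreover have "e 7 - t * (e 7 - e 1) \<noteq> n 1" "e 7 - t * (e 7 - e 1) \<noteq> n 7" using r0[OF t] order by auto
    ultimately show ?thesis using c_B(2)[OF b0[OF t]] at(1)[OF t] by metis
  qed
  show "curve D' (\<alpha>' 1 t) \<in> frontier B \<longleftrightarrow> t = 0 \<or> t = 1" if t: "t \<in> {0..1}" for t
  proof -
    have "n 1 + t * (n 7 - n 1) = n 1 \<longleftrightarrow> t = 0" using order by simp
    moreover have "n 1 + t * (n 7 - n 1) = n 7 \<longleftrightarrow> (1 - t) * (n 7 - n 1) = 0" by (auto simp: algebra_simps)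
    moreover have "(1 - t) * (n 7 - n 1) = 0 \<longleftrightarrow> t = 1" using order by simp
    moreover have "n 1 + t * (n 7 - n 1) \<noteq> e 1" "n 1 + t * (n 7 - n 1) \<noteq> e 7" using r1[OF t] order by auto
    ultimately show ?thesis using c_B(2)[OF b1[OF t]] at(2)[OF t] by metis
  qed
qed (rule no_crossings_frontier)

lemma squash_range: "7 + squash v \<in> {-40..40}" "6 < 7 + squash v" "7 + squash v < 8"
  "7 + max 0 (squash v) \<in> {-40..40}"
  using squash_bound[of v] by (auto simp: abs_if split: if_splits)

lemma \<tau>_cont: "continuous_on UNIV \<tau>" unfolding \<tau>_def
proof (rule continuous_on_compose2[OF F(2) near_end_cont])
  have "norm (near_end z) < 50" for z by (rule le_less_trans[OF near_end_props(2)]) simp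
  then show "range near_end \<subseteq> ball 0 50" by auto
qed

lemma \<tau>_inj: "inj \<tau>"
  by (rule injI) (use \<Phi>_eq near_end_props(2) near_end_inj in \<open>simp add: \<tau>_def inj_def\<close>)

lemma \<tau>_side: "\<tau> z \<in> B \<longleftrightarrow> Re z \<le> 0"
  unfolding \<tau>_def \<Phi>_mem[OF near_end_props(2) B_disk(4)] by (rule near_end_props(4))

lemma \<tau>_real: "\<tau> (of_real v) = \<Phi> (of_real (7 + squash v))"
  unfolding \<tau>_def using near_end_props(5)[of "of_real v"] by simp

lemma \<delta>_\<tau>:
  assumes "0 \<le> t" "t < 2 * pi" "\<delta> t = \<tau> z"
  shows "t = e (7 + squash (Re z))"
proof -
  from F(12)[OF assms(1,2) near_end_props(2)] assms(3)
  have "(\<exists>u\<in>{-40..40}. t = e u \<and> near_end z = of_real u) \<or> (\<exists>u\<in>{-40..40}. t = n u \<and> near_end z = \<i> * of_real u)"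
    by (simp add: \<delta>_def \<tau>_def)
  then show ?thesis
  proof (elim disjE bexE conjE)
    fix u assume u: "t = e u" "near_end z = of_real u"
    then have "Im z = 0" using near_end_props(6)[of z] by simp
    then have "of_real u = complex_of_real (7 + squash (Re z))" using near_end_props(5) u(2) by metis
    then have "u = 7 + squash (Re z)" by (simp only: of_real_eq_iff)
    then show ?thesis using u(1) by simp
  next
    fix u assume u: "near_end z = \<i> * complex_of_real u"
    then show ?thesis using near_end_props(1)[of z] by simp
  qed
qed

lemma chart_D: "disk_chart D \<tau> g B"
proof
  show "virtual_link_diagram D" by (rule diagram_D)
  show "continuous_on UNIV \<tau>" "inj \<tau>" by (rule \<tau>_cont \<tau>_inj)+
  show "continuous_on UNIV g" unfolding g_def
    by (intro continuous_intros continuous_on_compose2[OF continuous_on_cis[OF continuous_on_id]]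
        continuous_on_compose2[OF F(5)] continuous_squash) (use squash_range in auto)
  show cg: "curve D (g u) = \<tau> (of_real u)" for u
    using \<delta>_e[OF squash_range(1), of u] unfolding \<tau>_real by (simp add: g_def \<delta>_def)
  show "range g = {s \<in> source D. curve D s \<in> range \<tau>}"
  proof (intro set_eqI iffI)
    fix s assume "s \<in> range g"
    then show "s \<in> {s \<in> source D. curve D s \<in> range \<tau>}" using cg in_source(1) by (auto simp: g_def)
  next
    fix s assume s: "s \<in> {s \<in> source D. curve D s \<in> range \<tau>}"
    then obtain t where t: "0 \<le> t" "t < 2 * pi" "s = (0, q * cis t)" using angle_D by blast
    obtain z where "\<delta> t = \<tau> z" using s t(3) by (auto simp: \<delta>_def)
    then have "t = e (7 + squash (Re z))" by (rule \<delta>_\<tau>[OF t(1,2)])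
    then have "s = g (Re z)" using t(3) by (simp add: g_def)
    then show "s \<in> range g" by blast
  qed
  show "\<tau> z \<in> B \<longleftrightarrow> Re z \<le> 0" for z by (rule \<tau>_side)
qed (use B_disk crossings_B in auto)

lemma back_bounds: "0 \<le> back v" "back v < 2 * pi"
  "squash v \<le> 0 \<Longrightarrow> back v = n 1 + (n 7 - n 1) * (- squash v / 3)"
  "0 \<le> squash v \<Longrightarrow> back v = e 7 + n 1 - e (7 + squash v)"
  "squash v \<le> 0 \<Longrightarrow> n 1 \<le> back v \<and> back v \<le> n 7"
  "0 \<le> squash v \<Longrightarrow> e 7 < back v \<and> back v \<le> n 1"
proof -
  show 3: "squash v \<le> 0 \<Longrightarrow> back v = n 1 + (n 7 - n 1) * (- squash v / 3)"
    and 4: "0 \<le> squash v \<Longrightarrow> back v = e 7 + n 1 - e (7 + squash v)" by (simp_all add: back_def)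
  show 5: "n 1 \<le> back v \<and> back v \<le> n 7" if "squash v \<le> 0"
  proof -
    have k: "0 \<le> - squash v / 3" "- squash v / 3 \<le> 1" using squash_bound[of v] that by auto
    have "0 \<le> (n 7 - n 1) * (- squash v / 3)" by (rule mult_nonneg_nonneg[OF _ k(1)]) (use order in simp)
    moreover have "(n 7 - n 1) * (- squash v / 3) \<le> n 7 - n 1" by (rule mult_left_le[OF k(2)]) (use order in simp)
    ultimately have "0 \<le> (n 7 - n 1) * (- squash v / 3)" "(n 7 - n 1) * (- squash v / 3) \<le> n 7 - n 1" .
    then show ?thesis unfolding 3[OF that] by linarith
  qed
  show 6: "e 7 < back v \<and> back v \<le> n 1" if "0 \<le> squash v"
  proof -
    have "e 7 \<le> e (7 + squash v)" "e (7 + squash v) < n 1"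
      using e_le[of 7 "7 + squash v"] e_n[of "7 + squash v" 1] squash_range(1)[of v] that by auto
    then show ?thesis unfolding 4[OF that] by linarith
  qed
  show "0 \<le> back v" "back v < 2 * pi" using 5 6 order by (cases "squash v \<le> 0"; force)+
qed

lemma c_back: "c (back v) = \<tau> (of_real v)"
proof (cases "squash v \<le> 0")
  case True
  define l where "l = - squash v"
  have l: "0 \<le> l" "l \<le> 1" using squash_bound[of v] True by (auto simp: l_def)
  have "3 * ((back v - n 1) / (n 7 - n 1)) = l"
  proof -
    have "3 * ((n 1 + d * (- squash v / 3) - n 1) / d) = - squash v" if "d \<noteq> 0" for d using that by simp
    from this[of "n 7 - n 1"] show ?thesis unfolding back_bounds(3)[OF True] l_def using order by simp
  qed
  then have "c (back v) = \<Phi> (outer_cap l)" using c_outer[of "back v"] back_bounds(5)[OF True] by simp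
  moreover have "outer_cap l = of_real (7 + squash v)"
    using l by (simp add: outer_cap_def ramp_def complex_eq_iff l_def)
  ultimately show ?thesis unfolding \<tau>_real by simp
next
  case False
  then have s: "0 \<le> squash v" by simp
  have "back v \<in> T" using back_bounds(6)[OF s] order by (auto simp: T_def)
  moreover have "\<sigma> (back v) = e (7 + squash v)"
    using back_bounds(4,6)[OF s] by (simp add: \<sigma>_def)
  ultimately show ?thesis unfolding \<tau>_real using c_T \<delta>_e[OF squash_range(1)] by simp
qed

lemma c_\<tau>:
  assumes t: "0 \<le> t" "t < 2 * pi" and eq: "c t = \<tau> z"
  shows "t = back (Re z)"
proof -
  consider "e 1 \<le> t" "t \<le> e 7" | "n 1 \<le> t" "t \<le> n 7" | "\<not> (e 1 \<le> t \<and> t \<le> e 7)" "\<not> (n 1 \<le> t \<and> t \<le> n 7)"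
    by blast
  then show ?thesis
  proof cases
    case 1
    define l where "l = (t - e 1) / (e 7 - e 1)"
    have l: "0 \<le> l" "l \<le> 1" using 1 order by (auto simp: l_def)
    have "norm (inner_cap l) \<le> 40" using inner_cap_disk(1)[OF l] B_disk(4) by (auto simp: subset_iff)
    then have "inner_cap l = near_end z"
      using eq \<Phi>_eq near_end_props(2) unfolding c_inner[OF 1] l_def[symmetric] \<tau>_def by blast
    then have "Re (near_end z) = 1 - l" by (metis complex.sel(1) inner_cap_def)
    then show ?thesis using near_end_props(1)[of z] l by linarith
  next
    case 2
    define l where "l = 3 * ((t - n 1) / (n 7 - n 1))"
    have l: "0 \<le> l" "l \<le> 3" using 2 order by (auto simp: l_def divide_simps)
    have "norm (outer_cap l) \<le> 40" using outer_cap_disk(1)[OF l] B_disk(4) by (auto simp: subset_iff)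
    then have cap: "outer_cap l = near_end z"
      using eq \<Phi>_eq near_end_props(2) unfolding c_outer[OF 2] l_def[symmetric] \<tau>_def by blast
    from l show ?thesis
    proof (cases rule: outer_cap_cases)
      case 1
      then have "Im (near_end z) = 0" using cap by (metis complex.sel(2))
      then have "near_end z = of_real (7 + squash (Re z))" using near_end_props(5,6) by metis
      then have sq: "squash (Re z) = - l" using 1(2) cap by (simp add: complex_eq_iff)
      have "t = n 1 + d * (3 * ((t - n 1) / d) / 3)" if "d \<noteq> 0" for d using that by (simp add: field_simps)
      from this[of "n 7 - n 1"] have "t = n 1 + (n 7 - n 1) * (l / 3)" unfolding l_def using order by linarith
      then show ?thesis using back_bounds(3)[of "Re z"] sq l by simp
    next
      case 2
      have "near_end z = Complex (6 - 6 * (l - 1)) (6 * (l - 1))" using cap 2(3) by metis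
      then have "Re (near_end z) \<le> 6" "0 \<le> Im (near_end z)" using 2(1) by simp_all
      then show ?thesis using near_end_props(3)[of z] by linarith
    next
      case 3
      then have "Re (near_end z) = 0" using cap by (metis complex.sel(1))
      then show ?thesis using near_end_props(1)[of z] by linarith
    qed
  next
    case 3
    then have tT: "t \<in> T" using t by (auto simp: T_def)
    define u where "u = 7 + squash (Re z)"
    have u: "u \<in> {-40..40}" "6 < u" using squash_range[of "Re z"] by (simp_all add: u_def)
    have s: "\<sigma> t = e u" unfolding u_def
      by (rule \<delta>_\<tau>) (use T_bounds[OF \<sigma>_T(1)[OF tT]] c_T[OF tT] eq in auto)
    have eu: "e 1 < e u" "e u < n 1" using e_less[of 1 u] e_n[of u 1] u by auto
    have mid: "e 7 \<le> t \<and> t \<le> n 1"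
    proof (rule ccontr)
      assume a: "\<not> (e 7 \<le> t \<and> t \<le> n 1)"
      then have "\<sigma> t = t" unfolding \<sigma>_def by (simp only: if_False)
      then have "t = e u" using s by simp
      then show False using a 3 eu by linarith
    qed
    then have t': "t = e 7 + n 1 - e u" using s by (simp add: \<sigma>_def)
    then have "e 7 \<le> e u" using mid by linarith
    then have "7 \<le> u" using e_le[of 7 u] u by simp
    then have "0 \<le> squash (Re z)" by (simp add: u_def)
    then show ?thesis using back_bounds(4)[of "Re z"] t' by (simp add: u_def)
  qed
qed

lemma chart_D': "disk_chart D' \<tau> g' B"
proof
  show "virtual_link_diagram D'" by (rule diagram_D')
  show "continuous_on UNIV \<tau>" "inj \<tau>" by (rule \<tau>_cont \<tau>_inj)+
  show "continuous_on UNIV g'" unfolding g'_def back_def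
    by (intro continuous_intros continuous_on_compose2[OF continuous_on_cis[OF continuous_on_id]]
        continuous_on_compose2[OF F(5)] continuous_squash) (use squash_range(4) in auto)
  show cg: "curve D' (g' u) = \<tau> (of_real u)" for u
    using D'_at(1)[OF back_bounds(1,2)] c_back by (simp add: g'_def)
  show "range g' = {s \<in> source D'. curve D' s \<in> range \<tau>}"
  proof (intro set_eqI iffI)
    fix s assume "s \<in> range g'"
    then show "s \<in> {s \<in> source D'. curve D' s \<in> range \<tau>}" using cg in_source(2) by (auto simp: g'_def)
  next
    fix s assume s: "s \<in> {s \<in> source D'. curve D' s \<in> range \<tau>}"
    then obtain t where t: "0 \<le> t" "t < 2 * pi" "s = (0, cis t)" using angle_D' by blast
    obtain z where "c t = \<tau> z" using s t(3) D'_at(1)[OF t(1,2)] by auto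
    then have "t = back (Re z)" by (rule c_\<tau>[OF t(1,2)])
    then have "s = g' (Re z)" using t(3) by (simp add: g'_def)
    then show "s \<in> range g'" by blast
  qed
  show "\<tau> z \<in> B \<longleftrightarrow> Re z \<le> 0" for z by (rule \<tau>_side)
qed (use B_disk crossings_D'_B in auto)

lemma ang_point: "\<tau> (Complex 0 y) = \<phi> (cis (ang y))"
proof -
  define Y where "Y = squash y - 4"
  note R = near_end_root[OF squash_bound[of y]]
  have Y: "\<bar>Y\<bar> \<le> 5" using squash_bound[of y] by (simp add: Y_def)
  have "5 * sqrt (1 - (Y / 5)\<^sup>2) = sqrt (25 - Y\<^sup>2)"
  proof -
    have "25 * (1 - (Y / 5)\<^sup>2) = 25 - Y\<^sup>2" by (simp add: power2_eq_square)
    then have "sqrt 25 * sqrt (1 - (Y / 5)\<^sup>2) = sqrt (25 - Y\<^sup>2)" by (metis real_sqrt_mult)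
    moreover have "sqrt 25 = 5" by (rule real_sqrt_unique) auto
    ultimately show ?thesis by simp
  qed
  moreover have "cos (arcsin (Y / 5)) = sqrt (1 - (Y / 5)\<^sup>2)" "sin (arcsin (Y / 5)) = Y / 5"
    using Y by (auto intro!: cos_arcsin sin_arcsin)
  ultimately have "band_centre + 5 * cis (ang y) = near_end (Complex 0 y)"
    by (simp add: complex_eq_iff ang_def near_end_def squash_sign(2) Y_def[symmetric] cos_add sin_add)
      (simp add: Y_def)
  then show ?thesis by (simp add: \<phi>_def \<tau>_def)
qed

lemma ang_props: "strict_mono ang" "ang 0 = \<theta> 3" "\<theta> 2 < ang y" "ang y < 2 * pi"
proof -
  have Y: "-1 < (squash v - 4) / 5" "(squash v - 4) / 5 < 0" for v
    using squash_bound[of v] by (auto simp: abs_if split: if_splits)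
  show "strict_mono ang"
  proof (rule strict_monoI)
    fix u v :: real assume "u < v"
    then have "squash u < squash v" using squash_mono by (simp add: strict_mono_def)
    then show "ang u < ang v" unfolding ang_def
      using arcsin_less_mono[of "(squash u - 4) / 5" "(squash v - 4) / 5"] Y[of u] Y[of v] by simp
  qed
  show "ang 0 = \<theta> 3" using arcsin_minus[of "4/5"] by (simp add: ang_def \<theta>_def squash_sign(2))
  have "arcsin ((squash y - 4) / 5) < arcsin 0" using Y[of y] by (subst arcsin_less_mono) auto
  then show "ang y < 2 * pi" by (simp add: ang_def)
  have "- (pi / 2) < arcsin ((squash y - 4) / 5)" using arcsin_lt_bounded[of "(squash y - 4) / 5"] Y[of y] by simp
  then show "\<theta> 2 < ang y" using arcsin_vals(7) by (simp add: ang_def \<theta>_def)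
qed

lemma extendable: "\<exists>\<phi>'. extendable_H_move 2 D D' B \<phi> \<phi>' \<theta> \<alpha> \<alpha>' \<tau> ang g g'"
proof -
  obtain \<phi>' where \<phi>': "homeomorphism (cball 0 1) B \<phi> \<phi>'" using disk_param by blast
  have "extendable_H_move 2 D D' B \<phi> \<phi>' \<theta> \<alpha> \<alpha>' \<tau> ang g g'"
  proof (rule extendable_H_move.intro)
    have four: "j = 0 \<or> j = 1 \<or> j = 2 \<or> j = 3" if "j < 2 * 2" for j :: nat using that by auto
    show "homeomorphism (cball 0 1) B \<phi> \<phi>'" by (rule \<phi>')
    show "agree_outside B D D'" by (rule agree_D')
    show "strict_mono_on {..<2 * 2} \<theta>"
    proof (rule strict_mono_onI)
      fix i j :: nat assume "i \<in> {..<2 * 2}" "j \<in> {..<2 * 2}" "i < j"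
      then show "\<theta> i < \<theta> j" using four[of i] four[of j] \<theta>_order by auto
    qed
    show "0 \<le> \<theta> j \<and> \<theta> j < 2 * pi" if "j < 2 * 2" for j using four[OF that] \<theta>_order by auto
    show "strands D B 2 \<alpha>" by (rule strands_D)
    show "strands D' B 2 \<alpha>'" by (rule strands_D')
    have p3: "\<phi> (cis (\<theta> (Suc 0))) = \<Phi> \<i>" "\<phi> (cis (\<theta> (Suc (Suc 0)))) = \<Phi> 1"
      using points(2,3) by (simp_all add: numeral_2_eq_2)
    show "curve D (\<alpha> i 0) = \<phi> (cis (\<theta> (2 * i)))" if "i < 2" for i
      using that \<delta>_ends points by (auto simp: less_2_cases_iff \<alpha>_def \<delta>_def)
    show "curve D (\<alpha> i 1) = \<phi> (cis (\<theta> (2 * i + 1)))" if "i < 2" for i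
      using that \<delta>_ends points p3 by (auto simp: less_2_cases_iff \<alpha>_def \<delta>_def)
    have cD': "curve D' (0, cis (e 1)) = \<Phi> 1" "curve D' (0, cis (e 7)) = \<Phi> \<i>"
      "curve D' (0, cis (n 1)) = \<Phi> 7" "curve D' (0, cis (n 7)) = \<Phi> (7 * \<i>)"
      using D'_at(1) c_ends order by simp_all
    show "curve D' (\<alpha>' i 0) = \<phi> (cis (\<theta> (2 * i + 1)))" if "i < 2" for i
      using that cD' points p3 by (auto simp: less_2_cases_iff \<alpha>'_def)
    show "curve D' (\<alpha>' i 1) = \<phi> (cis (\<theta> ((2 * i + 2) mod (2 * 2))))" if "i < 2" for i
      using that cD' points p3 by (auto simp: less_2_cases_iff \<alpha>'_def)
    show "ncomp D' = ncomp D" using knot by (simp add: D'_def virtual_knot_diagram_def)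
    show "disk_chart D \<tau> g B" "disk_chart D' \<tau> g' B" by (rule chart_D chart_D')+
    show "strict_mono ang" "\<tau> (Complex 0 y) = \<phi> (cis (ang y))" for y by (rule ang_props ang_point)+
    show "ang 0 = \<theta> (2 * 2 - 1)" using ang_props(2) by simp
    show "\<theta> (2 * 2 - 2) < ang y \<and> ang y < 2 * pi" for y using ang_props(3,4) by simp
  qed simp
  then show ?thesis by blast
qed

text \<open>
  An H(m)-move simulates the band move, which turns the crossing into a kink; replacing the kink by the chord removes
  it.
\<close>

lemma remove_crossing:
  assumes "m \<ge> 2"
  shows "\<exists>E. virtual_knot_diagram E \<and> H_transformable m D E \<and> crossings E = crossings D - {x}"
proof -
  obtain \<phi>' where "extendable_H_move 2 D D' B \<phi> \<phi>' \<theta> \<alpha> \<alpha>' \<tau> ang g g'" using extendable by blast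
  from extendable_H_move_transformable[OF this, of "m - 2"]
  have band: "H_transformable m D D'" using le_add_diff_inverse[OF assms] by metis
  obtain E where E: "virtual_knot_diagram E" "generalized_reidemeister_move D' E"
      "crossings E = crossings D - {x}"
    using unkinked by (elim exE conjE)
  have "H_transformable m D' E"
    unfolding H_transformable_def using E(2) by (intro r_into_rtranclp) simp
  with band have "H_transformable m D E" unfolding H_transformable_def by (rule rtranclp_trans)
  then show ?thesis using E by blast
qed

end

section \<open>Unknotting\<close>

theorem theorem2p1:
  fixes n :: nat and D :: vdiagram
  assumes "n \<ge> 2" and "virtual_knot_diagram D"
  shows "\<exists>E. H_transformable n D E \<and> trivial_knot_diagram E"
  using assms(2)
proof (induction "card (crossings D)" arbitrary: D rule: less_induct)
  case less
  have fin: "finite (crossings D)"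
    using less.prems by (simp add: virtual_knot_diagram_def virtual_link_diagram_def generic_immersion_def)
  show ?case
  proof (cases "crossings D = {}")
    case True
    then have "trivial_knot_diagram D"
      using less.prems unfolding trivial_knot_diagram_def virtually_equivalent_def by blast
    then show ?thesis unfolding H_transformable_def by blast
  next
    case False
    then obtain x where x: "x \<in> crossings D" by blast
    obtain q \<Phi> e k where "frame D x q \<Phi> e k" using frame_exists[OF less.prems x] by blast
    then obtain \<Phi> e k where f: "frame D x q \<Phi> e k" "strict_mono_on {-40..40} e"
      "strict_mono_on {-40..40} k" "e 40 < k (-40)" using frame_ordered by blast
    interpret crossing_frame D x q \<Phi> e k by unfold_locales (use less.prems f in auto)
    obtain E where E: "virtual_knot_diagram E" "H_transformable n D E" "crossings E = crossings D - {x}"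
      using remove_crossing[OF assms(1)] by blast
    have "card (crossings E) < card (crossings D)"
      unfolding E(3) by (rule card_Diff1_less[OF fin x])
    from less.hyps[OF this E(1)] obtain E' where "H_transformable n E E'" "trivial_knot_diagram E'" by blast
    then show ?thesis using E(2) unfolding H_transformable_def by (meson rtranclp_trans)
  qed
qed

end
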